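(* Let $\mathcal{P}_0$ be a family of distributions $P$ of $(X,Y,Z)$ with $Z\in\mathbb{R}^d$, $Y\in\mathbb{R}$, such that for each $P\in\mathcal{P}_0$ there is $\boldsymbol\gamma_P\in\mathbb{R}^d$ with $$Y=\boldsymbol\gamma_P^\top Z+\varepsilon_P,\qquad\mathbb{E}_P(\varepsilon_P\mid X,Z)=0.$$ Let $T$ be computed using Algorithm 1 (see context), where ordinary least squares (OLS) is used to construct both $\hat m$ and $\hat m_{\hat f}$, and the regressions involved in the construction of $\hat f$ are arbitrary. Suppose that: (a) there exist $\delta\in(0,2]$ and $c,C>0$ such that $\mathbb{E}_P(\varepsilon_P^2\mid X,Z)\ge c$ and $\mathbb{E}_P(|\varepsilon_P|^{2+\delta}\mid X,Z)\le C$ for all $P\in\mathcal{P}_0$; (b) writing $u_{n,i}:=\hat f(X_i,Z_i)-\hat m_{\hat f}(Z_i)$ and $\upsilon_{n,i}:=u_{n,i}/\bigl(\sum_{i'=1}^nu_{n,i'}^2\bigr)^{1/2}$ for $i\in[n]$, we have $\max_{i\in[n]}|\upsilon_{n,i}|=o_{\mathcal{P}_0}(1)$ and $\sum_{i=1}^n\upsilon_{n,i}^2=1+o_{\mathcal{P}_0}(1)$; (c) letting $\hat{\boldsymbol\gamma}$ denote the coefficient vector from the $\hat m$ regression (so $\hat m(z)=\hat{\boldsymbol\gamma}^\top z$), $\max_{i\in[n]}\|Z_i\|_\infty\cdot\|\hat{\boldsymbol\gamma}-\boldsymbol\gamma_P\|_1=o_{\mathcal{P}_0}(1)$; and that all OLS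 estimators exist almost surely. Then, as $n\to\infty$, $$\sup_{P\in\mathcal{P}_0}\sup_{t\in\mathbb{R}}\bigl|\mathbb{P}_P(T\le t)-\Phi(t)\bigr|\to0.$$
   Context: Conventions: $0/0:=0$, $\mathrm{sgn}(0):=0$, $\Phi$ is the standard normal distribution function. Families of distributions may depend on $n$. $X_{P,n}=o_{\mathcal P}(1)$ means $\sup_{P\in\mathcal P}\mathbb P_P(|X_{P,n}|>\epsilon)\to0$ for every $\epsilon>0$. Conditional inequalities hold almost surely. A regression method is any procedure which, from response–predictor pairs, returns a fitted function (possibly using extra independent randomness). Algorithm 1 (Projected Covariance Measure). Data: $2n$ i.i.d. copies $(X_i,Y_i,Z_i)$ of $(X,Y,Z)$, split into $\mathcal D_1$ (indices $\mathcal I_1=[n]=\{1,\dots,n\}$) and $\mathcal D_2$ (indices $\mathcal I_2=\{n+1,\dots,2n\}$); user-chosen regression methods. 1. (i) Regress $Y$ on $(X,Z)$ using $\mathcal D_2$, giving $\hat g$. (ii) If $\hat g$ can be modified so that all components involving only $Z$ are set to $0$, let $\tilde g$ be this modified version; alternatively set $\tilde g:=\hat g$. (iii) Regress $\tilde g(X,Z)$ on $Z$ using $\mathcal D_2$, giving $\tilde m$; set $\tilde h(x,z):=\tilde g(x,z)-\tilde m(z)$. (iv) With $\hat\rho:=\frac1n\sum_{i\in\mathcal I_2}\{Y_i-\hat g(X_i,Z_i)+\tilde g(X_i,Z_i)-\tilde m(Z_i)\}\tilde h(X_i,Z_i)$, set $\hat h:=\mathrm{sgn}(\hat\rho)\tilde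 h$. 2. Regress $\{Y-\hat g(X,Z)\}^2$ on $(X,Z)$ using $\mathcal D_2$, giving $\tilde v$. Let $a(c):=\frac1n\sum_{i\in\mathcal I_2}\frac{\{Y_i-\hat g(X_i,Z_i)\}^2}{\max\{\tilde v(X_i,Z_i),0\}+c}$; if $a(0)\le1$ set $\hat c:=0$, otherwise let $\hat c$ solve $a(c)=1$. Set $\hat v:=\max\{\tilde v,0\}+\hat c$. 3. Set $\hat f:=\hat h/\hat v$. Regress $\hat f(X,Z)$ on $Z$ using $\mathcal D_1$, giving $\hat m_{\hat f}$; regress $Y$ on $Z$ using $\mathcal D_1$, giving $\hat m$. For $i\in\mathcal I_1$ let $L_i:=\{Y_i-\hat m(Z_i)\}\{\hat f(X_i,Z_i)-\hat m_{\hat f}(Z_i)\}$ and $$T:=\frac{\frac1{\sqrt n}\sum_{i\in\mathcal I_1}L_i}{\sqrt{\frac1n\sum_{i\in\mathcal I_1}L_i^2-\bigl(\frac1n\sum_{i\in\mathcal I_1}L_i\bigr)^2}}.$$ *)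

theory Defs
  imports "HOL-Probability.Probability"
begin

text \<open>A vector in \<open>d\<close>-dimensional Euclidean space is a function supported by the indices \<open>0, ..., d - 1\<close>
  (and \<open>undefined\<close> elsewhere), so that the dimension may change with the sample size.\<close>

type_synonym rvec = "nat \<Rightarrow> real"
type_synonym 'x obs = "'x \<times> real \<times> rvec"

definition rvec_space :: "nat \<Rightarrow> rvec measure" where
  "rvec_space d = PiM {..<d} (\<lambda>_. borel)"

definition obs_space :: "'x measure \<Rightarrow> nat \<Rightarrow> 'x obs measure" where
  "obs_space MX d = MX \<Otimes>\<^sub>M borel \<Otimes>\<^sub>M rvec_space d"

definition dotp :: "nat \<Rightarrow> rvec \<Rightarrow> rvec \<Rightarrow> real" where
  "dotp d a b = (\<Sum>j<d. a j * b j)"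

definition norm_1 :: "nat \<Rightarrow> rvec \<Rightarrow> real" where
  "norm_1 d a = (\<Sum>j<d. \<bar>a j\<bar>)"

definition norm_inf :: "nat \<Rightarrow> rvec \<Rightarrow> real" where
  "norm_inf d a = Max ((\<lambda>j. \<bar>a j\<bar>) ` {..<d})"

definition obsY :: "'x obs \<Rightarrow> real" where
  "obsY w = fst (snd w)"

definition obsZ :: "'x obs \<Rightarrow> rvec" where
  "obsZ w = snd (snd w)"

definition obsXZ :: "'x obs \<Rightarrow> 'x \<times> rvec" where
  "obsXZ w = (fst w, snd (snd w))"

definition sigma_XZ :: "'x measure \<Rightarrow> nat \<Rightarrow> 'x obs measure" where
  "sigma_XZ MX d = vimage_algebra (space (obs_space MX d)) obsXZ (MX \<Otimes>\<^sub>M rvec_space d)"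

definition noise :: "nat \<Rightarrow> rvec \<Rightarrow> 'x obs \<Rightarrow> real" where
  "noise d \<gamma> w = obsY w - dotp d \<gamma> (obsZ w)"

text \<open>\<open>real_cond_exp\<close> is meaningful only for integrable functions, hence the first conjunct.\<close>

definition linear_model :: "'x measure \<Rightarrow> nat \<Rightarrow> 'x obs measure \<Rightarrow> rvec \<Rightarrow> bool" where
  "linear_model MX d P \<gamma> \<longleftrightarrow>
     integrable P (noise d \<gamma>) \<and>
     (AE w in P. real_cond_exp P (sigma_XZ MX d) (noise d \<gamma>) w = 0)"

text \<open>The \<open>ennreal\<close>-valued conditional expectation needs no integrability; in particular the upper
  bound below cannot hold through a junk value for a non-integrable power.\<close>

definition noise_moments ::
  "'x measure \<Rightarrow> nat \<Rightarrow> 'x obs measure \<Rightarrow> rvec \<Rightarrow> real \<Rightarrow> real \<Rightarrow> real \<Rightarrow> bool" where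
  "noise_moments MX d P \<gamma> \<delta> c C \<longleftrightarrow>
     (AE w in P. nn_cond_exp P (sigma_XZ MX d) (\<lambda>w. ennreal ((noise d \<gamma> w)\<^sup>2)) w \<ge> ennreal c) \<and>
     (AE w in P. nn_cond_exp P (sigma_XZ MX d)
                   (\<lambda>w. ennreal (\<bar>noise d \<gamma> w\<bar> powr (2 + \<delta>))) w \<le> ennreal C)"

text \<open>A regression method maps a seed (the auxiliary randomness) and an indexed family of
  (response, predictor) pairs to a fitted function.\<close>

type_synonym ('u, 'w) regression = "'u \<Rightarrow> (nat \<Rightarrow> real \<times> 'w) \<Rightarrow> 'w \<Rightarrow> real"

text \<open>Procedures are otherwise arbitrary; without joint measurability the law of the test statistic
  would be undefined. The spaces of predictors \<open>W\<close> and of evaluation points \<open>V\<close> differ only for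
  \<open>z_part\<close> below.\<close>

definition measurable_procedure ::
  "'u measure \<Rightarrow> nat set \<Rightarrow> 'w measure \<Rightarrow> 'v measure \<Rightarrow>
     ('u \<Rightarrow> (nat \<Rightarrow> real \<times> 'w) \<Rightarrow> 'v \<Rightarrow> real) \<Rightarrow> bool" where
  "measurable_procedure U I W V R \<longleftrightarrow>
     (\<lambda>(u, D, v). R u D v)
       \<in> borel_measurable (U \<Otimes>\<^sub>M PiM I (\<lambda>_. borel \<Otimes>\<^sub>M W) \<Otimes>\<^sub>M V)"

text \<open>\<open>z_part\<close> is the sum of those components of the fitted \<open>reg_g\<close> that involve only \<open>z\<close> and that
  are set to zero in the modified version of the fit; making no modification is \<open>z_part = 0\<close>.
  All fields receive the same seed, so their auxiliary randomness may be independent or shared.\<close>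

record ('u, 'x) pcm_methods =
  reg_g :: "('u, 'x \<times> rvec) regression"
  z_part :: "'u \<Rightarrow> (nat \<Rightarrow> real \<times> 'x \<times> rvec) \<Rightarrow> rvec \<Rightarrow> real"
  reg_m :: "('u, rvec) regression"
  reg_v :: "('u, 'x \<times> rvec) regression"

definition I1 :: "nat \<Rightarrow> nat set" where
  "I1 n = {1..n}"

definition I2 :: "nat \<Rightarrow> nat set" where
  "I2 n = {n + 1..2 * n}"

definition measurable_methods ::
  "'u measure \<Rightarrow> 'x measure \<Rightarrow> nat \<Rightarrow> nat \<Rightarrow> ('u, 'x) pcm_methods \<Rightarrow> bool" where
  "measurable_methods U MX d n R \<longleftrightarrow>
     measurable_procedure U (I2 n) (MX \<Otimes>\<^sub>M rvec_space d) (MX \<Otimes>\<^sub>M rvec_space d) (reg_g R) \<and>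
     measurable_procedure U (I2 n) (MX \<Otimes>\<^sub>M rvec_space d) (rvec_space d) (z_part R) \<and>
     measurable_procedure U (I2 n) (rvec_space d) (rvec_space d) (reg_m R) \<and>
     measurable_procedure U (I2 n) (MX \<Otimes>\<^sub>M rvec_space d) (MX \<Otimes>\<^sub>M rvec_space d) (reg_v R)"

definition rss :: "nat \<Rightarrow> nat set \<Rightarrow> (nat \<Rightarrow> real \<times> rvec) \<Rightarrow> rvec \<Rightarrow> real" where
  "rss d I D \<beta> = (\<Sum>i\<in>I. (fst (D i) - dotp d \<beta> (snd (D i)))\<^sup>2)"

definition ols_solution :: "nat \<Rightarrow> nat set \<Rightarrow> (nat \<Rightarrow> real \<times> rvec) \<Rightarrow> rvec \<Rightarrow> bool" where
  "ols_solution d I D \<beta> \<longleftrightarrow> is_arg_min (rss d I D) (\<lambda>b. b \<in> {..<d} \<rightarrow>\<^sub>E UNIV) \<beta>"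

text \<open>A minimiser of the residual sum of squares always exists; the OLS estimator is said to exist
  if the minimiser is unique, i.e. if the design matrix has full column rank.\<close>

definition ols_exists :: "nat \<Rightarrow> nat set \<Rightarrow> (nat \<Rightarrow> real \<times> rvec) \<Rightarrow> bool" where
  "ols_exists d I D \<longleftrightarrow> (\<exists>!\<beta>. ols_solution d I D \<beta>)"

definition ols_coef :: "nat \<Rightarrow> nat set \<Rightarrow> (nat \<Rightarrow> real \<times> rvec) \<Rightarrow> rvec" where
  "ols_coef d I D = (if ols_exists d I D then THE \<beta>. ols_solution d I D \<beta> else (\<lambda>_\<in>{..<d}. 0))"

text \<open>In the definitions of the Projected Covariance Measure below, \<open>R\<close> collects the regression methods, \<open>n\<close> is half the sample size, \<open>D\<close> is the
  sample, indexed by \<open>I1 n \<union> I2 n\<close>, and \<open>u\<close> is the seed.\<close>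

definition D2_YXZ :: "nat \<Rightarrow> (nat \<Rightarrow> 'x obs) \<Rightarrow> nat \<Rightarrow> real \<times> 'x \<times> rvec" where
  "D2_YXZ n D = (\<lambda>i\<in>I2 n. (obsY (D i), obsXZ (D i)))"

definition ghat ::
  "('u, 'x) pcm_methods \<Rightarrow> nat \<Rightarrow> (nat \<Rightarrow> 'x obs) \<Rightarrow> 'u \<Rightarrow> 'x \<times> rvec \<Rightarrow> real" where
  "ghat R n D u = reg_g R u (D2_YXZ n D)"

definition gtilde ::
  "('u, 'x) pcm_methods \<Rightarrow> nat \<Rightarrow> (nat \<Rightarrow> 'x obs) \<Rightarrow> 'u \<Rightarrow> 'x \<times> rvec \<Rightarrow> real" where
  "gtilde R n D u = (\<lambda>(x, z). ghat R n D u (x, z) - z_part R u (D2_YXZ n D) z)"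

definition mtilde ::
  "('u, 'x) pcm_methods \<Rightarrow> nat \<Rightarrow> (nat \<Rightarrow> 'x obs) \<Rightarrow> 'u \<Rightarrow> rvec \<Rightarrow> real" where
  "mtilde R n D u = reg_m R u (\<lambda>i\<in>I2 n. (gtilde R n D u (obsXZ (D i)), obsZ (D i)))"

definition htilde ::
  "('u, 'x) pcm_methods \<Rightarrow> nat \<Rightarrow> (nat \<Rightarrow> 'x obs) \<Rightarrow> 'u \<Rightarrow> 'x \<times> rvec \<Rightarrow> real" where
  "htilde R n D u = (\<lambda>(x, z). gtilde R n D u (x, z) - mtilde R n D u z)"

definition rhohat ::
  "('u, 'x) pcm_methods \<Rightarrow> nat \<Rightarrow> (nat \<Rightarrow> 'x obs) \<Rightarrow> 'u \<Rightarrow> real" where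
  "rhohat R n D u = (1 / real n) * (\<Sum>i\<in>I2 n.
     (obsY (D i) - ghat R n D u (obsXZ (D i)) + gtilde R n D u (obsXZ (D i))
        - mtilde R n D u (obsZ (D i)))
     * htilde R n D u (obsXZ (D i)))"

definition hhat ::
  "('u, 'x) pcm_methods \<Rightarrow> nat \<Rightarrow> (nat \<Rightarrow> 'x obs) \<Rightarrow> 'u \<Rightarrow> 'x \<times> rvec \<Rightarrow> real" where
  "hhat R n D u = (\<lambda>w. sgn (rhohat R n D u) * htilde R n D u w)"

definition vtilde ::
  "('u, 'x) pcm_methods \<Rightarrow> nat \<Rightarrow> (nat \<Rightarrow> 'x obs) \<Rightarrow> 'u \<Rightarrow> 'x \<times> rvec \<Rightarrow> real" where
  "vtilde R n D u =
     reg_v R u (\<lambda>i\<in>I2 n. ((obsY (D i) - ghat R n D u (obsXZ (D i)))\<^sup>2, obsXZ (D i)))"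

text \<open>The function \<open>a\<close> of the variance correction. Division in \<open>ennreal\<close> satisfies \<open>0 / 0 = 0\<close> and
  \<open>r / 0 = \<infinity>\<close> for \<open>r > 0\<close>, which real division does not.\<close>

definition acrit ::
  "('u, 'x) pcm_methods \<Rightarrow> nat \<Rightarrow> (nat \<Rightarrow> 'x obs) \<Rightarrow> 'u \<Rightarrow> real \<Rightarrow> ennreal" where
  "acrit R n D u c =
     (\<Sum>i\<in>I2 n. ennreal ((obsY (D i) - ghat R n D u (obsXZ (D i)))\<^sup>2)
                  / ennreal (max (vtilde R n D u (obsXZ (D i))) 0 + c)) / of_nat n"

text \<open>If \<open>a(0) > 1\<close>, then \<open>a\<close> is continuous and strictly decreasing on the positive reals with limit
  \<open>a(0)\<close> at 0 and limit 0 at infinity, so the solution is unique.\<close>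

definition chat ::
  "('u, 'x) pcm_methods \<Rightarrow> nat \<Rightarrow> (nat \<Rightarrow> 'x obs) \<Rightarrow> 'u \<Rightarrow> real" where
  "chat R n D u =
     (if acrit R n D u 0 \<le> 1 then 0 else THE c. 0 \<le> c \<and> acrit R n D u c = 1)"

definition vhat ::
  "('u, 'x) pcm_methods \<Rightarrow> nat \<Rightarrow> (nat \<Rightarrow> 'x obs) \<Rightarrow> 'u \<Rightarrow> 'x \<times> rvec \<Rightarrow> real" where
  "vhat R n D u = (\<lambda>w. max (vtilde R n D u w) 0 + chat R n D u)"

text \<open>Real division makes \<open>fhat\<close> equal to 0 wherever \<open>vhat\<close> vanishes.\<close>

definition fhat ::
  "('u, 'x) pcm_methods \<Rightarrow> nat \<Rightarrow> (nat \<Rightarrow> 'x obs) \<Rightarrow> 'u \<Rightarrow> 'x \<times> rvec \<Rightarrow> real" where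
  "fhat R n D u = (\<lambda>w. hhat R n D u w / vhat R n D u w)"

definition D1_fZ ::
  "('u, 'x) pcm_methods \<Rightarrow> nat \<Rightarrow> (nat \<Rightarrow> 'x obs) \<Rightarrow> 'u \<Rightarrow> nat \<Rightarrow> real \<times> rvec" where
  "D1_fZ R n D u = (\<lambda>i\<in>I1 n. (fhat R n D u (obsXZ (D i)), obsZ (D i)))"

definition D1_YZ :: "nat \<Rightarrow> (nat \<Rightarrow> 'x obs) \<Rightarrow> nat \<Rightarrow> real \<times> rvec" where
  "D1_YZ n D = (\<lambda>i\<in>I1 n. (obsY (D i), obsZ (D i)))"

definition mfhat_ols ::
  "('u, 'x) pcm_methods \<Rightarrow> nat \<Rightarrow> nat \<Rightarrow> (nat \<Rightarrow> 'x obs) \<Rightarrow> 'u \<Rightarrow> rvec \<Rightarrow> real" where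
  "mfhat_ols R d n D u = dotp d (ols_coef d (I1 n) (D1_fZ R n D u))"

definition gammahat :: "nat \<Rightarrow> nat \<Rightarrow> (nat \<Rightarrow> 'x obs) \<Rightarrow> rvec" where
  "gammahat d n D = ols_coef d (I1 n) (D1_YZ n D)"

definition mhat_ols :: "nat \<Rightarrow> nat \<Rightarrow> (nat \<Rightarrow> 'x obs) \<Rightarrow> rvec \<Rightarrow> real" where
  "mhat_ols d n D = dotp d (gammahat d n D)"

definition pcm_u ::
  "('u, 'x) pcm_methods \<Rightarrow> nat \<Rightarrow> nat \<Rightarrow> (nat \<Rightarrow> 'x obs) \<Rightarrow> 'u \<Rightarrow> nat \<Rightarrow> real" where
  "pcm_u R d n D u i = fhat R n D u (obsXZ (D i)) - mfhat_ols R d n D u (obsZ (D i))"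

definition pcm_upsilon ::
  "('u, 'x) pcm_methods \<Rightarrow> nat \<Rightarrow> nat \<Rightarrow> (nat \<Rightarrow> 'x obs) \<Rightarrow> 'u \<Rightarrow> nat \<Rightarrow> real" where
  "pcm_upsilon R d n D u i = pcm_u R d n D u i / sqrt (\<Sum>k\<in>I1 n. (pcm_u R d n D u k)\<^sup>2)"

definition pcm_L ::
  "('u, 'x) pcm_methods \<Rightarrow> nat \<Rightarrow> nat \<Rightarrow> (nat \<Rightarrow> 'x obs) \<Rightarrow> 'u \<Rightarrow> nat \<Rightarrow> real" where
  "pcm_L R d n D u i =
     (obsY (D i) - mhat_ols d n D (obsZ (D i)))
     * (fhat R n D u (obsXZ (D i)) - mfhat_ols R d n D u (obsZ (D i)))"

definition pcm_T ::
  "('u, 'x) pcm_methods \<Rightarrow> nat \<Rightarrow> nat \<Rightarrow> (nat \<Rightarrow> 'x obs) \<Rightarrow> 'u \<Rightarrow> real" where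
  "pcm_T R d n D u =
     ((1 / sqrt (real n)) * (\<Sum>i\<in>I1 n. pcm_L R d n D u i))
     / sqrt ((1 / real n) * (\<Sum>i\<in>I1 n. (pcm_L R d n D u i)\<^sup>2)
              - ((1 / real n) * (\<Sum>i\<in>I1 n. pcm_L R d n D u i))\<^sup>2)"

definition pcm_experiment ::
  "'u measure \<Rightarrow> nat \<Rightarrow> 'x obs measure \<Rightarrow> ((nat \<Rightarrow> 'x obs) \<times> 'u) measure" where
  "pcm_experiment U n P = PiM (I1 n \<union> I2 n) (\<lambda>_. P) \<Otimes>\<^sub>M U"

text \<open>Suprema of probabilities are taken in \<open>ennreal\<close>, so that the supremum over an empty family is 0.\<close>

definition uniform_oP ::
  "(nat \<Rightarrow> 'p set) \<Rightarrow> (nat \<Rightarrow> 'p \<Rightarrow> 'w measure) \<Rightarrow> (nat \<Rightarrow> 'p \<Rightarrow> 'w \<Rightarrow> real) \<Rightarrow> bool" where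
  "uniform_oP \<P> M V \<longleftrightarrow>
     (\<forall>e>0. (\<lambda>n. SUP P\<in>\<P> n. emeasure (M n P) {w \<in> space (M n P). \<bar>V n P w\<bar> > e}) \<longlonglongrightarrow> 0)"

end

theory Submission
  imports Defs "Jordan_Normal_Form.Determinant"
begin

text \<open>The normal equations of the regression of \<open>fhat\<close> on \<open>Z\<close> make the weights \<open>\<upsilon>\<^sub>i\<close> orthogonal to the
  \<open>Z\<^sub>i\<close>, so the numerator of \<open>T\<close> is, up to scaling, \<open>S = \<Sum> \<upsilon>\<^sub>i \<epsilon>\<^sub>i\<close>; the estimation error of \<open>m\<close> only
  enters the denominator, where (c) makes it negligible. Given everything but the responses of the
  first subsample, the weights are constants and the noise is independent and centred. No conditional
  law is needed to exploit this: it suffices that \<open>\<epsilon>\<^sub>j\<close> and \<open>\<epsilon>\<^sub>j\<^sup>2 - \<sigma>\<^sub>j\<^sup>2\<close> integrate to 0 against every bounded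
  function of the data that is unchanged when the response \<open>Y\<^sub>j\<close> is erased. Adding the summands one at a
  time then compares the characteristic function of \<open>S\<close>, divided by its conditional standard deviation,
  with the normal one, and the same telescoping for \<open>x \<mapsto> sqrt (1 + x\<^sup>2)\<close>, whose increments are bounded
  both linearly and quadratically, gives the weak law for \<open>\<Sum> \<upsilon>\<^sub>i\<^sup>2 \<epsilon>\<^sub>i\<^sup>2\<close> with only \<open>2 + \<delta>\<close> moments.
  Uniformity over the family follows along a sequence of bad distributions.

  The measure of a non-measurable set is 0 by convention, so the measurability of \<open>T\<close> has real content.
  Least squares coefficients are measurable by Cramer's rule, and \<open>chat\<close> because \<open>chat \<le> x\<close> is
  equivalent to \<open>a(x) \<le> 1\<close>.\<close>

section \<open>A central limit theorem for conditionally centred arrays\<close>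

text \<open>The weights and the conditional variances are random, so \<open>S\<close> has no
  deterministic scale and its characteristic function does not factorise. But both survive the
  erasure of any response and therefore act as constants when a summand is added: the exponential of
  a partial sum, compensated by the conditional variances, is almost a martingale, and after
  division by the conditional standard deviation the total compensator is the constant
  \<open>exp (t\<^sup>2 / 2)\<close>. The lower bound \<open>c\<close> keeps the rescaled weights
  comparable with the original ones. Each step costs a multiple of the mean of |w_i|^(2 + \<eta>).
  As the squared weights sum to at most 1, the total is governed by the largest |w_i|^\<eta>, which
  is how the first half of (b) enters. The exponent is \<open>min \<delta> 1\<close> because the
  second-order expansion of the exponential gains at most one further power. Division by zero yields
  0, so the squared weights sum to 0 or 1 and to nothing else; the degenerate event is carried along
  as a separate error term, which the second half of (b) makes negligible.\<close>

lemma sqrt_one_plus_sq_add_le: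
  fixes x y :: real
  shows "sqrt (1 + (x + y)\<^sup>2) \<le> sqrt (1 + x\<^sup>2) + x / sqrt (1 + x\<^sup>2) * y + min (2 * \<bar>y\<bar>) (y\<^sup>2 / 2)"
proof -
  define r where "r = sqrt (1 + x\<^sup>2)"
  have r: "r \<ge> 1" "r\<^sup>2 = 1 + x\<^sup>2" by (auto simp: r_def)
  have xr: "\<bar>x\<bar> \<le> r" unfolding r_def by (rule real_le_rsqrt) auto
  \<comment> \<open>The square of the right-hand side in \<open>*\<close> exceeds 1 + (x + y)^2 by a
    perfect square, and \<open>*\<close> supplies the sign needed to take roots.\<close>
  have A: "sqrt (1 + (x + y)\<^sup>2) \<le> r + x / r * y + y\<^sup>2 / 2"
  proof -
    have *: "r + x / r * y + y\<^sup>2 / (2 * r) \<ge> 0"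
    proof -
      have "2 * r * (r + x / r * y + y\<^sup>2 / (2 * r)) = 2 * r\<^sup>2 + 2 * x * y + y\<^sup>2"
        using r(1) by (simp add: field_simps power2_eq_square)
      also have "\<dots> = 2 + x\<^sup>2 + (x + y)\<^sup>2" by (simp add: r(2) power2_sum)
      also have "\<dots> \<ge> 0" by simp
      finally show ?thesis using r(1) by (simp add: zero_le_mult_iff)
    qed
    have "1 + (x + y)\<^sup>2 = r\<^sup>2 + 2 * x * y + y\<^sup>2" by (simp add: r(2) power2_sum)
    also have "\<dots> \<le> (r + (x / r * y + y\<^sup>2 / (2 * r)))\<^sup>2"
    proof -
      have "(r + (x / r * y + y\<^sup>2 / (2 * r)))\<^sup>2 = r\<^sup>2 + 2 * r * (x / r * y + y\<^sup>2 / (2 * r)) + (x / r * y + y\<^sup>2 / (2 * r))\<^sup>2"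
        by (simp add: power2_sum)
      moreover have "2 * r * (x / r * y + y\<^sup>2 / (2 * r)) = 2 * x * y + y\<^sup>2"
        using r(1) by (simp add: field_simps power2_eq_square)
      ultimately show ?thesis by simp
    qed
    finally have "sqrt (1 + (x + y)\<^sup>2) \<le> r + x / r * y + y\<^sup>2 / (2 * r)"
      using * by (intro real_le_lsqrt) (auto simp: add.assoc)
    also have "y\<^sup>2 / (2 * r) \<le> y\<^sup>2 / 2" using r(1) by (intro divide_left_mono) auto
    finally show ?thesis by simp
  qed
  \<comment> \<open>The function has Lipschitz constant 1, and the tangent term is at least -|y|;
    together they give the factor 2.\<close>
  have B: "sqrt (1 + (x + y)\<^sup>2) \<le> r + x / r * y + 2 * \<bar>y\<bar>"
  proof -
    have "1 + (x + y)\<^sup>2 \<le> (r + \<bar>y\<bar>)\<^sup>2"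
    proof -
      have "x * y \<le> \<bar>x\<bar> * \<bar>y\<bar>" by (metis abs_ge_self abs_mult)
      also have "\<dots> \<le> r * \<bar>y\<bar>" using xr by (intro mult_right_mono) auto
      finally show ?thesis by (simp add: power2_sum r(2))
    qed
    then have "sqrt (1 + (x + y)\<^sup>2) \<le> r + \<bar>y\<bar>" using r(1) by (intro real_le_lsqrt) auto
    moreover have "- \<bar>y\<bar> \<le> x / r * y"
    proof -
      have "\<bar>x / r * y\<bar> \<le> 1 * \<bar>y\<bar>"
        unfolding abs_mult using xr r(1) by (intro mult_right_mono) (auto simp: abs_divide)
      then show ?thesis by linarith
    qed
    ultimately show ?thesis by simp
  qed
  from A B show ?thesis unfolding r_def by simp
qed

lemma abs_div_sqrt_le: "\<bar>x / sqrt (1 + x\<^sup>2)\<bar> \<le> 1" for x :: real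
proof -
  have "\<bar>x\<bar> \<le> sqrt (1 + x\<^sup>2)" by (rule real_le_rsqrt) auto
  moreover have "0 < sqrt (1 + x\<^sup>2)" by (simp add: add_pos_nonneg)
  ultimately show ?thesis by (simp add: abs_divide)
qed

text \<open>Interpolates between the linear and the quadratic increment bound. With
  \<open>p = 1 + \<eta> / 2\<close> and y built from squared noise, this asks for moments of order 2
  + \<eta> only.\<close>

lemma min_abs_sq_le_powr:
  fixes y p :: real
  assumes "1 \<le> p" "p \<le> 2"
  shows "min (2 * \<bar>y\<bar>) (y\<^sup>2 / 2) \<le> 2 * \<bar>y\<bar> powr p"
proof (cases "\<bar>y\<bar> \<le> 1")
  case True
  show ?thesis
  proof (cases "y = 0")
    case False
    have "\<bar>y\<bar> powr 2 \<le> \<bar>y\<bar> powr p" using True False assms by (intro powr_mono') auto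
    moreover have "\<bar>y\<bar> powr 2 = y\<^sup>2" using False by (simp add: powr_numeral)
    ultimately show ?thesis using zero_le_power2[of y] by linarith
  qed simp
next
  case False
  then have "\<bar>y\<bar> powr 1 \<le> \<bar>y\<bar> powr p" using assms by (intro powr_mono) auto
  then show ?thesis using False by simp
qed

text \<open>Replaces the variance computation for martingale differences that are merely integrable.
  The factor in \<open>orth\<close> is the derivative of sqrt (1 + x^2) at the preceding partial
  sum, so the first-order terms vanish and only the remainders \<open>g\<close> accumulate.\<close>

lemma (in prob_space) expectation_sqrt_one_plus_sq_le:
  fixes \<xi> g :: "nat \<Rightarrow> 'a \<Rightarrow> real"
  assumes \<xi>: "\<And>i. i \<in> {1..n} \<Longrightarrow> integrable M (\<xi> i)"
    and g: "\<And>i. i \<in> {1..n} \<Longrightarrow> integrable M (g i)"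
    and le: "\<And>i \<omega>. i \<in> {1..n} \<Longrightarrow> \<omega> \<in> space M \<Longrightarrow> min (2 * \<bar>\<xi> i \<omega>\<bar>) ((\<xi> i \<omega>)\<^sup>2 / 2) \<le> g i \<omega>"
    and orth: "\<And>j. j < n \<Longrightarrow>
      (\<integral>\<omega>. (\<Sum>i=1..j. \<xi> i \<omega>) / sqrt (1 + (\<Sum>i=1..j. \<xi> i \<omega>)\<^sup>2) * \<xi> (Suc j) \<omega> \<partial>M) = 0"
  shows "integrable M (\<lambda>\<omega>. sqrt (1 + (\<Sum>i=1..n. \<xi> i \<omega>)\<^sup>2))"
    and "(\<integral>\<omega>. sqrt (1 + (\<Sum>i=1..n. \<xi> i \<omega>)\<^sup>2) \<partial>M) \<le> 1 + (\<Sum>i=1..n. \<integral>\<omega>. g i \<omega> \<partial>M)"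
proof -
  define S where "S j \<omega> = (\<Sum>i=1..j. \<xi> i \<omega>)" for j \<omega>
  have S_int: "integrable M (S j)" if "j \<le> n" for j
    unfolding S_def using that by (intro Bochner_Integration.integrable_sum \<xi>) auto
  have int: "integrable M (\<lambda>\<omega>. sqrt (1 + (S j \<omega>)\<^sup>2))" if "j \<le> n" for j
  proof (rule Bochner_Integration.integrable_bound[where f = "\<lambda>\<omega>. 1 + \<bar>S j \<omega>\<bar>"])
    show "integrable M (\<lambda>\<omega>. 1 + \<bar>S j \<omega>\<bar>)" using S_int[OF that] by auto
    show "(\<lambda>\<omega>. sqrt (1 + (S j \<omega>)\<^sup>2)) \<in> borel_measurable M"
      using S_int[OF that] by (auto dest: borel_measurable_integrable)
    have "sqrt (1 + x\<^sup>2) \<le> 1 + \<bar>x\<bar>" for x :: real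
      by (rule real_le_lsqrt) (auto simp: power2_sum)
    then show "AE x in M. norm (sqrt (1 + (S j x)\<^sup>2)) \<le> norm (1 + \<bar>S j x\<bar>)" by auto
  qed
  have "(\<integral>\<omega>. sqrt (1 + (S j \<omega>)\<^sup>2) \<partial>M) \<le> 1 + (\<Sum>i=1..j. \<integral>\<omega>. g i \<omega> \<partial>M)" if "j \<le> n" for j
    using that
  proof (induction j)
    case 0
    then show ?case by (simp add: S_def prob_space)
  next
    case (Suc j)
    have Suc_mem: "Suc j \<in> {1..n}" using Suc.prems by auto
    have S_Suc: "S (Suc j) \<omega> = S j \<omega> + \<xi> (Suc j) \<omega>" for \<omega> by (simp add: S_def)
    have [measurable]: "S j \<in> borel_measurable M" "\<xi> (Suc j) \<in> borel_measurable M"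
      using S_int[of j] \<xi>[OF Suc_mem] Suc.prems by (auto dest: borel_measurable_integrable)
    have int2: "integrable M (\<lambda>\<omega>. S j \<omega> / sqrt (1 + (S j \<omega>)\<^sup>2) * \<xi> (Suc j) \<omega>)"
    proof (rule Bochner_Integration.integrable_bound[OF \<xi>[OF Suc_mem]])
      show "AE x in M. norm (S j x / sqrt (1 + (S j x)\<^sup>2) * \<xi> (Suc j) x) \<le> norm (\<xi> (Suc j) x)"
      proof (rule AE_I2)
        fix x
        have "norm (S j x / sqrt (1 + (S j x)\<^sup>2) * \<xi> (Suc j) x) \<le> 1 * \<bar>\<xi> (Suc j) x\<bar>"
          unfolding real_norm_def abs_mult[of "S j x / _"] by (intro mult_right_mono abs_div_sqrt_le) auto
        then show "norm (S j x / sqrt (1 + (S j x)\<^sup>2) * \<xi> (Suc j) x) \<le> norm (\<xi> (Suc j) x)" by simp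
      qed
    qed measurable
    have "(\<integral>\<omega>. sqrt (1 + (S (Suc j) \<omega>)\<^sup>2) \<partial>M)
      \<le> (\<integral>\<omega>. sqrt (1 + (S j \<omega>)\<^sup>2) + S j \<omega> / sqrt (1 + (S j \<omega>)\<^sup>2) * \<xi> (Suc j) \<omega> + g (Suc j) \<omega> \<partial>M)"
    proof (rule integral_mono)
      show "integrable M (\<lambda>\<omega>. sqrt (1 + (S (Suc j) \<omega>)\<^sup>2))" by (rule int) fact
      show "integrable M (\<lambda>\<omega>. sqrt (1 + (S j \<omega>)\<^sup>2) + S j \<omega> / sqrt (1 + (S j \<omega>)\<^sup>2) * \<xi> (Suc j) \<omega> + g (Suc j) \<omega>)"
        using int[of j] int2 g[OF Suc_mem] Suc.prems by auto
      fix \<omega> assume "\<omega> \<in> space M"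
      then show "sqrt (1 + (S (Suc j) \<omega>)\<^sup>2) \<le> sqrt (1 + (S j \<omega>)\<^sup>2) + S j \<omega> / sqrt (1 + (S j \<omega>)\<^sup>2) * \<xi> (Suc j) \<omega> + g (Suc j) \<omega>"
        using sqrt_one_plus_sq_add_le[of "S j \<omega>" "\<xi> (Suc j) \<omega>"] le[OF Suc_mem, of \<omega>]
        unfolding S_Suc by linarith
    qed
    also have "\<dots> = (\<integral>\<omega>. sqrt (1 + (S j \<omega>)\<^sup>2) \<partial>M) + (\<integral>\<omega>. S j \<omega> / sqrt (1 + (S j \<omega>)\<^sup>2) * \<xi> (Suc j) \<omega> \<partial>M)
       + (\<integral>\<omega>. g (Suc j) \<omega> \<partial>M)"
      using int[of j] int2 g[OF Suc_mem] Suc.prems by simp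
    also have "(\<integral>\<omega>. S j \<omega> / sqrt (1 + (S j \<omega>)\<^sup>2) * \<xi> (Suc j) \<omega> \<partial>M) = 0"
      unfolding S_def using Suc.prems by (intro orth) auto
    finally show ?case using Suc by simp
  qed
  from this[of n] int[of n] show "integrable M (\<lambda>\<omega>. sqrt (1 + (\<Sum>i=1..n. \<xi> i \<omega>)\<^sup>2))"
    "(\<integral>\<omega>. sqrt (1 + (\<Sum>i=1..n. \<xi> i \<omega>)\<^sup>2) \<partial>M) \<le> 1 + (\<Sum>i=1..n. \<integral>\<omega>. g i \<omega> \<partial>M)"
    by (simp_all add: S_def)
qed

text \<open>Markov's inequality for sqrt (1 + X^2) - 1. Subtracting the value at 0 is what makes the
  probability small when only the excess b is small.\<close>

lemma (in prob_space) prob_abs_gt_le_sqrt: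
  fixes X :: "'a \<Rightarrow> real"
  assumes [measurable]: "X \<in> borel_measurable M"
    and int: "integrable M (\<lambda>\<omega>. sqrt (1 + (X \<omega>)\<^sup>2))"
    and le: "(\<integral>\<omega>. sqrt (1 + (X \<omega>)\<^sup>2) \<partial>M) \<le> 1 + b" and r: "r > 0"
  shows "prob {\<omega> \<in> space M. \<bar>X \<omega>\<bar> > r} \<le> b / (sqrt (1 + r\<^sup>2) - 1)"
proof -
  define q where "q = sqrt (1 + r\<^sup>2) - 1"
  have q: "q > 0" using r by (simp add: q_def)
  have "prob {\<omega> \<in> space M. \<bar>X \<omega>\<bar> > r} \<le> prob {\<omega> \<in> space M. sqrt (1 + (X \<omega>)\<^sup>2) - 1 \<ge> q}"
  proof (rule finite_measure_mono)
    show "{\<omega> \<in> space M. r < \<bar>X \<omega>\<bar>} \<subseteq> {\<omega> \<in> space M. q \<le> sqrt (1 + (X \<omega>)\<^sup>2) - 1}"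
    proof safe
      fix \<omega> assume "r < \<bar>X \<omega>\<bar>"
      then have "r\<^sup>2 \<le> (X \<omega>)\<^sup>2" using r by (intro abs_le_square_iff[THEN iffD1]) auto
      then show "q \<le> sqrt (1 + (X \<omega>)\<^sup>2) - 1" by (simp add: q_def)
    qed
  qed measurable
  also have "\<dots> \<le> (\<integral>\<omega>. sqrt (1 + (X \<omega>)\<^sup>2) - 1 \<partial>M) / q"
    by (rule integral_Markov_inequality_measure[where A = "{}"]) (use q int in auto)
  also have "\<dots> \<le> b / q"
    using le int q by (intro divide_right_mono) (auto simp: prob_space)
  finally show ?thesis by (simp add: q_def)
qed

section \<open>Bounded multipliers and Taylor remainders\<close>

lemma integrable_scaleR_bounded:
  fixes f :: "'a \<Rightarrow> real" and H :: "'a \<Rightarrow> 'b :: {banach, second_countable_topology, real_normed_algebra_1}"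
  assumes f: "integrable M f" and [measurable]: "H \<in> borel_measurable M" and "\<And>\<omega>. \<omega> \<in> space M \<Longrightarrow> norm (H \<omega>) \<le> B"
  shows "integrable M (\<lambda>\<omega>. f \<omega> *\<^sub>R H \<omega>)"
proof (rule Bochner_Integration.integrable_bound[where f = "\<lambda>\<omega>. B * f \<omega>"])
  show "integrable M (\<lambda>\<omega>. B * f \<omega>)" using f by simp
  have [measurable]: "f \<in> borel_measurable M" using f by auto
  show "(\<lambda>\<omega>. f \<omega> *\<^sub>R H \<omega>) \<in> borel_measurable M" by measurable
  show "AE \<omega> in M. norm (f \<omega> *\<^sub>R H \<omega>) \<le> norm (B * f \<omega>)"
  proof (rule AE_I2)
    fix \<omega> assume "\<omega> \<in> space M"
    then have "norm (H \<omega>) \<le> \<bar>B\<bar>" using assms(3) by fastforce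
    then show "norm (f \<omega> *\<^sub>R H \<omega>) \<le> norm (B * f \<omega>)"
      by (simp add: abs_mult) (metis abs_ge_zero mult.commute mult_right_mono)
  qed
qed

lemma integrable_mult_bounded:
  fixes f H :: "'a \<Rightarrow> real"
  assumes "integrable M f" "H \<in> borel_measurable M" "\<And>x. x \<in> space M \<Longrightarrow> \<bar>H x\<bar> \<le> B"
  shows "integrable M (\<lambda>x. H x * f x)"
  using integrable_scaleR_bounded[of M f H B] assms by (simp add: mult.commute)

lemma norm_integral_le_integral:
  fixes f :: "'a \<Rightarrow> 'b::{banach, second_countable_topology}"
  assumes "integrable M f" "integrable M g" "\<And>x. x \<in> space M \<Longrightarrow> norm (f x) \<le> g x"
  shows "norm (\<integral>x. f x \<partial>M) \<le> (\<integral>x. g x \<partial>M)"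
  using assms by (intro order_trans[OF integral_norm_bound] integral_mono) auto

text \<open>The cubic remainder is the better one for |x| <= 1, the quadratic one beyond;
  \<open>\<eta> \<le> 1\<close> is as much as the cubic one can give.\<close>

lemma cmod_iexp_quadratic_le:
  fixes x \<eta> :: real
  assumes "0 < \<eta>" "\<eta> \<le> 1"
  shows "cmod (iexp x - (1 + \<i> * x - x\<^sup>2 / 2)) \<le> \<bar>x\<bar> powr (2 + \<eta>)"
proof -
  have sum: "(\<Sum>k\<le>2. (\<i> * complex_of_real x) ^ k / fact k) = 1 + \<i> * x - x\<^sup>2 / 2"
    by (simp add: numeral_2_eq_2 power_mult_distrib flip: power2_eq_square power_Suc)
  have b1: "cmod (iexp x - (1 + \<i> * x - x\<^sup>2 / 2)) \<le> \<bar>x\<bar> ^ 3 / 6"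
    using iexp_approx1[of x 2] unfolding sum by (simp add: fact_numeral)
  have b2: "cmod (iexp x - (1 + \<i> * x - x\<^sup>2 / 2)) \<le> \<bar>x\<bar> ^ 2"
    using iexp_approx2[of x 2] unfolding sum by simp
  consider "x = 0" | "0 < \<bar>x\<bar>" "\<bar>x\<bar> \<le> 1" | "\<bar>x\<bar> > 1" by force
  then show ?thesis
  proof cases
    case 2
    have "\<bar>x\<bar> ^ 3 / 6 \<le> \<bar>x\<bar> powr 3" using 2 by (simp add: powr_numeral)
    also have "\<dots> \<le> \<bar>x\<bar> powr (2 + \<eta>)" using 2 assms by (intro powr_mono') auto
    finally show ?thesis using b1 by linarith
  next
    case 3
    have "\<bar>x\<bar> ^ 2 = \<bar>x\<bar> powr 2" using 3 by (simp add: powr_numeral)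
    also have "\<dots> \<le> \<bar>x\<bar> powr (2 + \<eta>)" using 3 assms by (intro powr_mono) auto
    finally show ?thesis using b2 by linarith
  qed (simp)
qed

text \<open>The upper half inverts the quadratic lower bound of exp y: the product of 1 - y + y^2/2
  and 1 + y + y^2/2 is 1 + (y^2/2)^2, hence at least 1.\<close>

lemma abs_exp_minus_linear_le:
  fixes y :: real
  assumes "0 \<le> y"
  shows "\<bar>exp (- y) - (1 - y)\<bar> \<le> y\<^sup>2 / 2"
proof -
  have "exp (- y) \<ge> 1 - y" using exp_ge_add_one_self[of "- y"] by simp
  moreover have "exp (- y) \<le> 1 - y + y\<^sup>2 / 2"
  proof -
    have pos: "0 < 1 + y + y\<^sup>2 / 2" using assms by (simp add: add_pos_nonneg)
    have "exp (- y) = 1 / exp y" by (simp add: exp_minus inverse_eq_divide)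
    also have "\<dots> \<le> 1 / (1 + y + y\<^sup>2 / 2)"
      using exp_lower_Taylor_quadratic[OF assms] pos by (intro divide_left_mono) auto
    also have "\<dots> \<le> 1 - y + y\<^sup>2 / 2"
    proof -
      have "(1 - y + y\<^sup>2 / 2) * (1 + y + y\<^sup>2 / 2) = 1 + (y\<^sup>2 / 2)\<^sup>2"
        by (simp add: power2_eq_square field_simps)
      also have "\<dots> \<ge> 1" by simp
      finally show ?thesis using pos by (simp add: pos_divide_le_eq)
    qed
    finally show ?thesis .
  qed
  ultimately show ?thesis by simp
qed

text \<open>\<open>\<zeta> j\<close> erases the \<open>j\<close>-th response from the data, so the functions invariant under \<open>\<zeta> j\<close> are those
  that are measurable with respect to everything except the \<open>j\<close>-th response. The last three
  assumptions give the conditional moments of \<open>e j\<close> given this information.\<close>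

locale conditional_array = prob_space M for M :: "'a measure" +
  fixes n :: nat and \<zeta> :: "nat \<Rightarrow> 'a \<Rightarrow> 'a" and e w v :: "nat \<Rightarrow> 'a \<Rightarrow> real" and c K \<eta> :: real
  assumes c_pos: "0 < c" and K_ge: "1 \<le> K" and eta: "0 < \<eta>" "\<eta> \<le> 1"
    and meas[measurable]: "\<And>i. e i \<in> borel_measurable M" "\<And>i. w i \<in> borel_measurable M"
      "\<And>i. v i \<in> borel_measurable M"
    and v_bounds: "\<And>i \<omega>. i \<in> {1..n} \<Longrightarrow> \<omega> \<in> space M \<Longrightarrow> c \<le> v i \<omega> \<and> v i \<omega> \<le> K"
    and sum_sq: "\<And>\<omega>. \<omega> \<in> space M \<Longrightarrow> (\<Sum>i=1..n. (w i \<omega>)\<^sup>2) \<in> {0, 1}"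
    and e_int: "\<And>i. i \<in> {1..n} \<Longrightarrow> integrable M (e i)"
    and e_sq_int: "\<And>i. i \<in> {1..n} \<Longrightarrow> integrable M (\<lambda>\<omega>. (e i \<omega>)\<^sup>2)"
    and e_powr_int: "\<And>i. i \<in> {1..n} \<Longrightarrow> integrable M (\<lambda>\<omega>. \<bar>e i \<omega>\<bar> powr (2 + \<eta>))"
    and w_inv: "\<And>i j \<omega>. i \<in> {1..n} \<Longrightarrow> j \<in> {1..n} \<Longrightarrow> \<omega> \<in> space M \<Longrightarrow> w i (\<zeta> j \<omega>) = w i \<omega>"
    and v_inv: "\<And>i j \<omega>. i \<in> {1..n} \<Longrightarrow> j \<in> {1..n} \<Longrightarrow> \<omega> \<in> space M \<Longrightarrow> v i (\<zeta> j \<omega>) = v i \<omega>"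
    and e_inv: "\<And>i j \<omega>. i \<in> {1..n} \<Longrightarrow> j \<in> {1..n} \<Longrightarrow> i \<noteq> j \<Longrightarrow> \<omega> \<in> space M \<Longrightarrow> e i (\<zeta> j \<omega>) = e i \<omega>"
    and mean: "\<And>j H B. j \<in> {1..n} \<Longrightarrow> H \<in> borel_measurable M \<Longrightarrow>
      (\<And>\<omega>. \<omega> \<in> space M \<Longrightarrow> \<bar>H \<omega>\<bar> \<le> B) \<Longrightarrow> (\<And>\<omega>. \<omega> \<in> space M \<Longrightarrow> H (\<zeta> j \<omega>) = H \<omega>) \<Longrightarrow>
      (\<integral>\<omega>. H \<omega> * e j \<omega> \<partial>M) = 0"
    and var: "\<And>j H B. j \<in> {1..n} \<Longrightarrow> H \<in> borel_measurable M \<Longrightarrow>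
      (\<And>\<omega>. \<omega> \<in> space M \<Longrightarrow> \<bar>H \<omega>\<bar> \<le> B) \<Longrightarrow> (\<And>\<omega>. \<omega> \<in> space M \<Longrightarrow> H (\<zeta> j \<omega>) = H \<omega>) \<Longrightarrow>
      (\<integral>\<omega>. H \<omega> * (e j \<omega>)\<^sup>2 \<partial>M) = (\<integral>\<omega>. H \<omega> * v j \<omega> \<partial>M)"
    and mom: "\<And>j H B. j \<in> {1..n} \<Longrightarrow> H \<in> borel_measurable M \<Longrightarrow>
      (\<And>\<omega>. \<omega> \<in> space M \<Longrightarrow> 0 \<le> H \<omega> \<and> H \<omega> \<le> B) \<Longrightarrow> (\<And>\<omega>. \<omega> \<in> space M \<Longrightarrow> H (\<zeta> j \<omega>) = H \<omega>) \<Longrightarrow>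
      (\<integral>\<omega>. H \<omega> * \<bar>e j \<omega>\<bar> powr (2 + \<eta>) \<partial>M) \<le> K * (\<integral>\<omega>. H \<omega> \<partial>M)"
begin

text \<open>The Lyapunov sum of the weights alone. The noise contributes at most the factor
  \<open>K\<close> by \<open>mom\<close>, so every error that must vanish is a multiple of this
  quantity.\<close>

definition lyapunov :: real where
  "lyapunov = (\<Sum>i=1..n. \<integral>\<omega>. \<bar>w i \<omega>\<bar> powr (2 + \<eta>) \<partial>M)"

text \<open>The conditional variance of \<open>weighted_sum\<close> given everything but the
  responses with indices \<open>1..n\<close>.\<close>

definition scale_sq :: "'a \<Rightarrow> real" where
  "scale_sq \<omega> = (\<Sum>i=1..n. (w i \<omega>)\<^sup>2 * v i \<omega>)"

definition weighted_sum :: "'a \<Rightarrow> real" where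
  "weighted_sum \<omega> = (\<Sum>i=1..n. w i \<omega> * e i \<omega>)"

definition weighted_sq :: "'a \<Rightarrow> real" where
  "weighted_sq \<omega> = (\<Sum>i=1..n. (w i \<omega>)\<^sup>2 * (e i \<omega>)\<^sup>2)"

lemma scale_sq_measurable[measurable]: "scale_sq \<in> borel_measurable M"
  and weighted_sum_measurable[measurable]: "weighted_sum \<in> borel_measurable M"
  and weighted_sq_measurable[measurable]: "weighted_sq \<in> borel_measurable M"
  unfolding scale_sq_def weighted_sum_def weighted_sq_def by measurable

lemma w_abs_le: "\<bar>w i \<omega>\<bar> \<le> 1" if "i \<in> {1..n}" "\<omega> \<in> space M"
proof -
  have "(w i \<omega>)\<^sup>2 \<le> (\<Sum>i=1..n. (w i \<omega>)\<^sup>2)" using that by (intro member_le_sum) auto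
  also have "\<dots> \<le> 1" using sum_sq[OF that(2)] by auto
  finally show ?thesis by (simp add: abs_square_le_1)
qed

lemma w_eq_0: "w i \<omega> = 0" if "i \<in> {1..n}" "\<omega> \<in> space M" "(\<Sum>i=1..n. (w i \<omega>)\<^sup>2) = 0"
  using that by (subst (asm) sum_nonneg_eq_0_iff) auto

lemma scale_sq_bounds:
  assumes "\<omega> \<in> space M" "(\<Sum>i=1..n. (w i \<omega>)\<^sup>2) = 1"
  shows "c \<le> scale_sq \<omega>" "scale_sq \<omega> \<le> K"
proof -
  have "(\<Sum>i=1..n. (w i \<omega>)\<^sup>2 * c) \<le> scale_sq \<omega>" "scale_sq \<omega> \<le> (\<Sum>i=1..n. (w i \<omega>)\<^sup>2 * K)"
    unfolding scale_sq_def using v_bounds assms(1) by (intro sum_mono mult_left_mono; auto)+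
  then show "c \<le> scale_sq \<omega>" "scale_sq \<omega> \<le> K"
    using assms(2) by (simp_all flip: sum_distrib_right)
qed

lemma scale_sq_inv: "scale_sq (\<zeta> j \<omega>) = scale_sq \<omega>" if "j \<in> {1..n}" "\<omega> \<in> space M"
  unfolding scale_sq_def using that by (intro sum.cong) (auto simp: w_inv v_inv)

lemma w_powr_int: "integrable M (\<lambda>\<omega>. \<bar>w i \<omega>\<bar> powr (2 + \<eta>))" if "i \<in> {1..n}"
  using w_abs_le[OF that] eta
  by (intro integrable_const_bound[where B = 1]) (auto intro!: powr_le1)

lemma lyapunov_nonneg: "0 \<le> lyapunov"
  unfolding lyapunov_def by (intro sum_nonneg integral_nonneg) auto

lemma weighted_powr:
  assumes i: "i \<in> {1..n}"
  shows "integrable M (\<lambda>\<omega>. \<bar>w i \<omega>\<bar> powr (2 + \<eta>) * \<bar>e i \<omega>\<bar> powr (2 + \<eta>))"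
    and "(\<integral>\<omega>. \<bar>w i \<omega>\<bar> powr (2 + \<eta>) * \<bar>e i \<omega>\<bar> powr (2 + \<eta>) \<partial>M)
      \<le> K * (\<integral>\<omega>. \<bar>w i \<omega>\<bar> powr (2 + \<eta>) \<partial>M)"
proof -
  have b: "\<bar>w i \<omega>\<bar> powr (2 + \<eta>) \<le> 1" if "\<omega> \<in> space M" for \<omega>
    using w_abs_le[OF i that] eta by (intro powr_le1) auto
  show "integrable M (\<lambda>\<omega>. \<bar>w i \<omega>\<bar> powr (2 + \<eta>) * \<bar>e i \<omega>\<bar> powr (2 + \<eta>))"
    using integrable_scaleR_bounded[OF e_powr_int[OF i], of "\<lambda>\<omega>. \<bar>w i \<omega>\<bar> powr (2 + \<eta>)" 1] b
    by (simp add: mult.commute)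
  show "(\<integral>\<omega>. \<bar>w i \<omega>\<bar> powr (2 + \<eta>) * \<bar>e i \<omega>\<bar> powr (2 + \<eta>) \<partial>M)
      \<le> K * (\<integral>\<omega>. \<bar>w i \<omega>\<bar> powr (2 + \<eta>) \<partial>M)"
    by (rule mom[OF i, where B = 1]) (use b i in \<open>auto simp: w_inv\<close>)
qed

lemma mean_complex:
  fixes H :: "'a \<Rightarrow> complex"
  assumes j: "j \<in> {1..n}" and [measurable]: "H \<in> borel_measurable M"
    and bd: "\<And>\<omega>. \<omega> \<in> space M \<Longrightarrow> cmod (H \<omega>) \<le> B" and inv: "\<And>\<omega>. \<omega> \<in> space M \<Longrightarrow> H (\<zeta> j \<omega>) = H \<omega>"
  shows "integrable M (\<lambda>\<omega>. H \<omega> * e j \<omega>)" "(CLINT \<omega>|M. H \<omega> * e j \<omega>) = 0"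
proof -
  show int: "integrable M (\<lambda>\<omega>. H \<omega> * e j \<omega>)"
    using integrable_scaleR_bounded[OF e_int[OF j] _ bd] by (simp add: scaleR_conv_of_real mult.commute)
  show "(CLINT \<omega>|M. H \<omega> * e j \<omega>) = 0"
  proof (rule complex_eqI)
    show "Re (CLINT \<omega>|M. H \<omega> * e j \<omega>) = Re 0"
      using mean[OF j, of "\<lambda>\<omega>. Re (H \<omega>)" B] bd inv abs_Re_le_cmod
      by (simp flip: integral_Re[OF int]) (metis order_trans)
    show "Im (CLINT \<omega>|M. H \<omega> * e j \<omega>) = Im 0"
      using mean[OF j, of "\<lambda>\<omega>. Im (H \<omega>)" B] bd inv abs_Im_le_cmod
      by (simp flip: integral_Im[OF int]) (metis order_trans)
  qed
qed

lemma v_int: "integrable M (v j)" if "j \<in> {1..n}"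
  using v_bounds[OF that] c_pos by (intro integrable_const_bound[where B = K]) (auto, force)

lemma var_diff:
  fixes H :: "'a \<Rightarrow> real"
  assumes j: "j \<in> {1..n}" and [measurable]: "H \<in> borel_measurable M"
    and bd: "\<And>\<omega>. \<omega> \<in> space M \<Longrightarrow> \<bar>H \<omega>\<bar> \<le> B" and inv: "\<And>\<omega>. \<omega> \<in> space M \<Longrightarrow> H (\<zeta> j \<omega>) = H \<omega>"
  shows "(\<integral>\<omega>. H \<omega> * ((e j \<omega>)\<^sup>2 - v j \<omega>) \<partial>M) = 0"
proof -
  have "integrable M (\<lambda>\<omega>. H \<omega> * v j \<omega>)" "integrable M (\<lambda>\<omega>. H \<omega> * (e j \<omega>)\<^sup>2)"
    using integrable_scaleR_bounded[OF v_int[OF j], of H B] integrable_scaleR_bounded[OF e_sq_int[OF j], of H B] bd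
    by (simp_all add: mult.commute)
  then show ?thesis using var[OF assms] by (simp add: right_diff_distrib)
qed

lemma var_complex:
  fixes H :: "'a \<Rightarrow> complex"
  assumes j: "j \<in> {1..n}" and [measurable]: "H \<in> borel_measurable M"
    and bd: "\<And>\<omega>. \<omega> \<in> space M \<Longrightarrow> cmod (H \<omega>) \<le> B" and inv: "\<And>\<omega>. \<omega> \<in> space M \<Longrightarrow> H (\<zeta> j \<omega>) = H \<omega>"
  shows "integrable M (\<lambda>\<omega>. H \<omega> * of_real ((e j \<omega>)\<^sup>2 - v j \<omega>))"
    "(CLINT \<omega>|M. H \<omega> * of_real ((e j \<omega>)\<^sup>2 - v j \<omega>)) = 0"
proof -
  show int: "integrable M (\<lambda>\<omega>. H \<omega> * of_real ((e j \<omega>)\<^sup>2 - v j \<omega>))"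
    using integrable_scaleR_bounded[of M "\<lambda>\<omega>. (e j \<omega>)\<^sup>2 - v j \<omega>" H, OF _ _ bd] v_int[OF j] e_sq_int[OF j]
    by (simp add: scaleR_conv_of_real mult.commute del: of_real_diff of_real_power)
  show "(CLINT \<omega>|M. H \<omega> * of_real ((e j \<omega>)\<^sup>2 - v j \<omega>)) = 0"
  proof (rule complex_eqI)
    have "\<bar>Re (H \<omega>)\<bar> \<le> B" "\<bar>Im (H \<omega>)\<bar> \<le> B" if "\<omega> \<in> space M" for \<omega>
      using bd[OF that] abs_Re_le_cmod[of "H \<omega>"] abs_Im_le_cmod[of "H \<omega>"] by linarith+
    then show "Re (CLINT \<omega>|M. H \<omega> * of_real ((e j \<omega>)\<^sup>2 - v j \<omega>)) = Re 0"
      "Im (CLINT \<omega>|M. H \<omega> * of_real ((e j \<omega>)\<^sup>2 - v j \<omega>)) = Im 0"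
      using var_diff[OF j, of "\<lambda>\<omega>. Re (H \<omega>)" B] var_diff[OF j, of "\<lambda>\<omega>. Im (H \<omega>)" B] inv
      by (simp_all del: of_real_diff of_real_power flip: integral_Re[OF int] integral_Im[OF int])
  qed
qed

text \<open>Telescopes from \<open>E 0 = 1\<close> to \<open>E n\<close>, which off the degenerate
  event is \<open>exp (t\<^sup>2 / 2)\<close> times the exponential of \<open>W\<close>. Multiplying
  by the reciprocal constant turns closeness of the mean of \<open>E n\<close> to 1 into closeness
  of the characteristic function to the normal one.\<close>

lemma cmod_char_weighted_sum_le:
  fixes t :: real
  defines "W \<equiv> \<lambda>\<omega>. weighted_sum \<omega> / sqrt (scale_sq \<omega>)"
  shows "cmod (char (distr M borel W) t - exp (- (t\<^sup>2) / 2))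
    \<le> ((\<bar>t\<bar> / sqrt c) powr (2 + \<eta>) * K + t ^ 4 * K\<^sup>2 / (8 * c\<^sup>2)) * lyapunov
      + prob {\<omega> \<in> space M. (\<Sum>i=1..n. (w i \<omega>)\<^sup>2) = 0}"
proof -
  define a where "a i \<omega> = w i \<omega> / sqrt (scale_sq \<omega>)" for i \<omega>
  define y where "y i \<omega> = t\<^sup>2 * (a i \<omega>)\<^sup>2 * v i \<omega> / 2" for i \<omega>
  \<comment> \<open>the exponential factor compensates the conditional variance, which makes \<open>E\<close> almost a martingale\<close>
  define E where "E j \<omega> = iexp (t * (\<Sum>i=1..j. a i \<omega> * e i \<omega>)) * of_real (exp (\<Sum>i=1..j. y i \<omega>))" for j \<omega>
  \<comment> \<open>\<open>A\<close> arises from |t a e|^(2 + \<eta>) with |a| <= |w| / sqrt c.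
    \<open>D\<close> arises from y^2 / 2 with y <= t^2 w^2 K / (2 c), the factor w^4 being absorbed
    into |w|^(2 + \<eta>).\<close>
  define A where "A = (\<bar>t\<bar> / sqrt c) powr (2 + \<eta>)"
  define D where "D = t ^ 4 * K\<^sup>2 / (8 * c\<^sup>2)"
  have [measurable]: "a i \<in> borel_measurable M" "y i \<in> borel_measurable M" "E i \<in> borel_measurable M" for i
    unfolding E_def y_def a_def by measurable
  have a_le: "\<bar>a i \<omega>\<bar> \<le> \<bar>w i \<omega>\<bar> / sqrt c" if i: "i \<in> {1..n}" and \<omega>: "\<omega> \<in> space M" for i \<omega>
  proof (cases "(\<Sum>i=1..n. (w i \<omega>)\<^sup>2) = 0")
    case True
    then show ?thesis using w_eq_0[OF i \<omega>] by (simp add: a_def)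
  next
    case False
    then have "c \<le> scale_sq \<omega>" using sum_sq[OF \<omega>] scale_sq_bounds[OF \<omega>] by simp
    then show ?thesis using c_pos unfolding a_def abs_divide
      by (intro frac_le) auto
  qed
  have y_nonneg: "0 \<le> y i \<omega>" if "i \<in> {1..n}" "\<omega> \<in> space M" for i \<omega>
    unfolding y_def using v_bounds[OF that] c_pos by simp
  \<comment> \<open>Dividing by the conditional variance makes the total compensator deterministic
    off the degenerate event.\<close>
  have y_sum: "(\<Sum>i=1..n. y i \<omega>) = (if (\<Sum>i=1..n. (w i \<omega>)\<^sup>2) = 0 then 0 else t\<^sup>2 / 2)" if \<omega>: "\<omega> \<in> space M" for \<omega>
  proof (cases "(\<Sum>i=1..n. (w i \<omega>)\<^sup>2) = 0")
    case True
    then show ?thesis using w_eq_0[OF _ \<omega>] by (simp add: a_def y_def)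
  next
    case False
    then have s: "scale_sq \<omega> > 0" using sum_sq[OF \<omega>] scale_sq_bounds[OF \<omega>] c_pos by simp
    have "(\<Sum>i=1..n. y i \<omega>) = (\<Sum>i=1..n. (t\<^sup>2 / 2 / scale_sq \<omega>) * ((w i \<omega>)\<^sup>2 * v i \<omega>))"
      using s by (intro sum.cong) (auto simp: y_def a_def power_divide)
    also have "\<dots> = t\<^sup>2 / 2"
      using s by (subst sum_distrib_left[symmetric], subst scale_sq_def[symmetric]) simp
    finally show ?thesis using False by simp
  qed
  have E_norm: "cmod (E j \<omega>) = exp (\<Sum>i=1..j. y i \<omega>)" for j \<omega>
    by (simp add: E_def norm_mult)
  have y_partial: "(\<Sum>i=1..j. y i \<omega>) \<le> t\<^sup>2 / 2" if "j \<le> n" "\<omega> \<in> space M" for j \<omega>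
  proof -
    have "(\<Sum>i=1..j. y i \<omega>) \<le> (\<Sum>i=1..n. y i \<omega>)"
      using that by (intro sum_mono2) (auto intro!: y_nonneg)
    also have "\<dots> \<le> t\<^sup>2 / 2" using y_sum[OF that(2)] by simp
    finally show ?thesis .
  qed
  have E_int: "integrable M (E j)" if "j \<le> n" for j
    using y_partial[OF that] by (intro integrable_const_bound[where B = "exp (t\<^sup>2 / 2)"]) (auto simp: E_norm)
  have step: "cmod ((CLINT \<omega>|M. E (Suc j) \<omega>) - (CLINT \<omega>|M. E j \<omega>))
      \<le> exp (t\<^sup>2 / 2) * (A * K + D) * (\<integral>\<omega>. \<bar>w (Suc j) \<omega>\<bar> powr (2 + \<eta>) \<partial>M)" if j: "j < n" for j
  proof -
    let ?k = "Suc j"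
    have k: "?k \<in> {1..n}" using j by auto
    define x where "x \<omega> = t * (a ?k \<omega> * e ?k \<omega>)" for \<omega>
    \<comment> \<open>\<open>H\<close> already contains the new compensator but not the new noise,
      so it is unchanged when the response with index \<open>Suc j\<close> is erased and may
      multiply the centred terms.\<close>
    define H where "H \<omega> = E j \<omega> * of_real (exp (y ?k \<omega>))" for \<omega>
    define r where "r \<omega> = (iexp (x \<omega>) - (1 + \<i> * x \<omega> - (x \<omega>)\<^sup>2 / 2)) - of_real (exp (- y ?k \<omega>) - (1 - y ?k \<omega>))" for \<omega>
    have [measurable]: "x \<in> borel_measurable M" "H \<in> borel_measurable M" "r \<in> borel_measurable M"
      unfolding x_def[abs_def] H_def[abs_def] r_def[abs_def] by measurable
    have H_le: "cmod (H \<omega>) \<le> exp (t\<^sup>2 / 2)" if "\<omega> \<in> space M" for \<omega>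
    proof -
      have "cmod (H \<omega>) = exp (\<Sum>i=1..?k. y i \<omega>)" by (simp add: H_def norm_mult E_norm exp_add)
      then show ?thesis using y_partial[of ?k \<omega>] that k by simp
    qed
    have a_inv: "a i (\<zeta> ?k \<omega>) = a i \<omega>" "y i (\<zeta> ?k \<omega>) = y i \<omega>"
      if "i \<in> {1..n}" "\<omega> \<in> space M" for i \<omega>
      using that k by (simp_all add: a_def y_def scale_sq_inv w_inv v_inv)
    have H_inv: "H (\<zeta> ?k \<omega>) = H \<omega>" if "\<omega> \<in> space M" for \<omega>
    proof -
      have "(\<Sum>i=1..j. a i (\<zeta> ?k \<omega>) * e i (\<zeta> ?k \<omega>)) = (\<Sum>i=1..j. a i \<omega> * e i \<omega>)"
        "(\<Sum>i=1..j. y i (\<zeta> ?k \<omega>)) = (\<Sum>i=1..j. y i \<omega>)"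
        using that k by (auto intro!: sum.cong simp: a_inv e_inv)
      then show ?thesis using a_inv[OF k that] by (simp add: H_def E_def)
    qed
    \<comment> \<open>The compensator is chosen so that the second-order terms combine into a
      multiple of e^2 - v. The first two summands therefore integrate to 0 and only \<open>r\<close>
      remains.\<close>
    have diff: "E ?k \<omega> - E j \<omega> = \<i> * t * a ?k \<omega> * H \<omega> * e ?k \<omega>
        + of_real (- (t\<^sup>2 / 2 * (a ?k \<omega>)\<^sup>2)) * H \<omega> * of_real ((e ?k \<omega>)\<^sup>2 - v ?k \<omega>) + H \<omega> * r \<omega>" for \<omega>
    proof -
      have 1: "E ?k \<omega> - E j \<omega> = H \<omega> * (iexp (x \<omega>) - of_real (exp (- y ?k \<omega>)))"
      proof -
        have "E ?k \<omega> = E j \<omega> * iexp (x \<omega>) * of_real (exp (y ?k \<omega>))"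
        proof -
          have i: "iexp (t * (p + b)) = iexp (t * p) * iexp (t * b)" for p b :: real
            by (simp add: distrib_left exp_add)
          have s: "(\<Sum>i=1..?k. g i) = (\<Sum>i=1..j. g i) + g ?k" for g :: "nat \<Rightarrow> real" by simp
          show ?thesis unfolding E_def s i x_def exp_add by (simp only: of_real_mult mult_ac)
        qed
        moreover have "E j \<omega> = H \<omega> * of_real (exp (- y ?k \<omega>))"
          unfolding H_def mult.assoc of_real_mult[symmetric] exp_add[symmetric] by simp
        moreover have "E j \<omega> * iexp (x \<omega>) * of_real (exp (y ?k \<omega>)) = H \<omega> * iexp (x \<omega>)"
          unfolding H_def by (simp only: mult_ac)
        ultimately show ?thesis unfolding right_diff_distrib by argo
      qed
      have 2: "iexp (x \<omega>) - of_real (exp (- y ?k \<omega>)) = \<i> * x \<omega> + of_real (y ?k \<omega> - (x \<omega>)\<^sup>2 / 2) + r \<omega>"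
        by (simp add: r_def)
      have 3: "y ?k \<omega> - (x \<omega>)\<^sup>2 / 2 = - (t\<^sup>2 / 2 * (a ?k \<omega>)\<^sup>2) * ((e ?k \<omega>)\<^sup>2 - v ?k \<omega>)"
        by (simp add: y_def x_def power_mult_distrib field_simps)
      show ?thesis unfolding 1 2 3 by (simp only: x_def of_real_mult distrib_left mult_ac)
    qed
    have a_bd: "\<bar>a ?k \<omega>\<bar> \<le> 1 / sqrt c" if "\<omega> \<in> space M" for \<omega>
      using a_le[OF k that] w_abs_le[OF k that] c_pos
      by (meson divide_right_mono order_trans real_sqrt_ge_zero less_imp_le)
    have m1: "integrable M (\<lambda>\<omega>. \<i> * t * a ?k \<omega> * H \<omega> * e ?k \<omega>)" "(CLINT \<omega>|M. \<i> * t * a ?k \<omega> * H \<omega> * e ?k \<omega>) = 0"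
    proof -
      have "cmod (\<i> * t * a ?k \<omega> * H \<omega>) \<le> \<bar>t\<bar> * (1 / sqrt c) * exp (t\<^sup>2 / 2)" if "\<omega> \<in> space M" for \<omega>
        unfolding norm_mult using a_bd[OF that] H_le[OF that]
        by (intro mult_mono) (auto intro!: mult_nonneg_nonneg simp: less_imp_le[OF c_pos])
      note * = mean_complex[OF k _ this]
      show "integrable M (\<lambda>\<omega>. \<i> * t * a ?k \<omega> * H \<omega> * e ?k \<omega>)"
        by (rule *) (auto simp: a_inv[OF k] H_inv)
      show "(CLINT \<omega>|M. \<i> * t * a ?k \<omega> * H \<omega> * e ?k \<omega>) = 0"
        by (rule *) (auto simp: a_inv[OF k] H_inv)
    qed
    let ?G = "\<lambda>\<omega>. of_real (- (t\<^sup>2 / 2 * (a ?k \<omega>)\<^sup>2)) * H \<omega>"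
    have m2: "integrable M (\<lambda>\<omega>. ?G \<omega> * of_real ((e ?k \<omega>)\<^sup>2 - v ?k \<omega>))"
      "(CLINT \<omega>|M. ?G \<omega> * of_real ((e ?k \<omega>)\<^sup>2 - v ?k \<omega>)) = 0"
    proof -
      have "cmod (?G \<omega>) \<le> (t\<^sup>2 / 2 * (1 / sqrt c)\<^sup>2) * exp (t\<^sup>2 / 2)" if "\<omega> \<in> space M" for \<omega>
      proof -
        have "\<bar>a ?k \<omega>\<bar>\<^sup>2 \<le> (1 / sqrt c)\<^sup>2" using a_bd[OF that] by (intro power_mono) auto
        then have "cmod (of_real (- (t\<^sup>2 / 2 * (a ?k \<omega>)\<^sup>2))) \<le> t\<^sup>2 / 2 * (1 / sqrt c)\<^sup>2"
          unfolding norm_of_real abs_minus abs_mult by (intro mult_mono) auto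
        then show ?thesis unfolding norm_mult
          using H_le[OF that] by (intro mult_mono) auto
      qed
      note * = var_complex[OF k _ this]
      show "integrable M (\<lambda>\<omega>. ?G \<omega> * of_real ((e ?k \<omega>)\<^sup>2 - v ?k \<omega>))"
        by (rule *) (auto simp: a_inv[OF k] H_inv)
      show "(CLINT \<omega>|M. ?G \<omega> * of_real ((e ?k \<omega>)\<^sup>2 - v ?k \<omega>)) = 0"
        by (rule *) (auto simp: a_inv[OF k] H_inv)
    qed
    let ?g = "\<lambda>\<omega>. exp (t\<^sup>2 / 2) * (A * (\<bar>w ?k \<omega>\<bar> powr (2 + \<eta>) * \<bar>e ?k \<omega>\<bar> powr (2 + \<eta>)) + D * \<bar>w ?k \<omega>\<bar> powr (2 + \<eta>))"
    have A_nonneg: "0 \<le> A" "0 \<le> D" by (simp_all add: A_def D_def)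
    have Hr: "cmod (H \<omega> * r \<omega>) \<le> ?g \<omega>" if \<omega>: "\<omega> \<in> space M" for \<omega>
    proof -
      have "cmod (r \<omega>) \<le> \<bar>x \<omega>\<bar> powr (2 + \<eta>) + (y ?k \<omega>)\<^sup>2 / 2"
        unfolding r_def using cmod_iexp_quadratic_le[OF eta, of "x \<omega>"] abs_exp_minus_linear_le[OF y_nonneg[OF k \<omega>]]
        by - (rule order_trans[OF norm_triangle_ineq4], intro add_mono; simp only: norm_of_real)
      also have "\<bar>x \<omega>\<bar> powr (2 + \<eta>) \<le> A * (\<bar>w ?k \<omega>\<bar> powr (2 + \<eta>) * \<bar>e ?k \<omega>\<bar> powr (2 + \<eta>))"
      proof -
        have "\<bar>x \<omega>\<bar> \<le> \<bar>t\<bar> * (\<bar>w ?k \<omega>\<bar> / sqrt c * \<bar>e ?k \<omega>\<bar>)"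
          unfolding x_def abs_mult using a_le[OF k \<omega>] by (intro mult_left_mono mult_right_mono) auto
        also have "\<dots> = (\<bar>t\<bar> / sqrt c) * (\<bar>w ?k \<omega>\<bar> * \<bar>e ?k \<omega>\<bar>)" by simp
        finally have "\<bar>x \<omega>\<bar> powr (2 + \<eta>) \<le> ((\<bar>t\<bar> / sqrt c) * (\<bar>w ?k \<omega>\<bar> * \<bar>e ?k \<omega>\<bar>)) powr (2 + \<eta>)"
          using eta by (intro powr_mono2) auto
        also have "\<dots> = A * (\<bar>w ?k \<omega>\<bar> powr (2 + \<eta>) * \<bar>e ?k \<omega>\<bar> powr (2 + \<eta>))"
        proof -
          have "(p * (q * r)) powr s = p powr s * (q powr s * r powr s)"
            if "0 \<le> p" "0 \<le> q" "0 \<le> r" for p q r s :: real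
            using that by (simp add: powr_mult)
          note powr_mult3 = this
          show ?thesis unfolding A_def by (rule powr_mult3) (use c_pos in auto)
        qed
        finally show ?thesis .
      qed
      also have "(y ?k \<omega>)\<^sup>2 / 2 \<le> D * \<bar>w ?k \<omega>\<bar> powr (2 + \<eta>)"
      proof -
        have "\<bar>a ?k \<omega>\<bar>\<^sup>2 \<le> (\<bar>w ?k \<omega>\<bar> / sqrt c)\<^sup>2" using a_le[OF k \<omega>] by (intro power_mono) auto
        then have a2: "(a ?k \<omega>)\<^sup>2 \<le> (w ?k \<omega>)\<^sup>2 / c" using c_pos by (simp add: power_divide)
        have "y ?k \<omega> \<le> t\<^sup>2 * ((w ?k \<omega>)\<^sup>2 / c) * K / 2"
          unfolding y_def using a2 v_bounds[OF k \<omega>] c_pos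
          by (intro divide_right_mono mult_mono mult_left_mono) auto
        then have "(y ?k \<omega>)\<^sup>2 / 2 \<le> (t\<^sup>2 * ((w ?k \<omega>)\<^sup>2 / c) * K / 2)\<^sup>2 / 2"
          using y_nonneg[OF k \<omega>] by (intro divide_right_mono power_mono) auto
        also have "\<dots> = D * (w ?k \<omega>) ^ 4"
          using c_pos by (simp add: D_def power_mult_distrib power_divide field_simps flip: power_mult)
        also have "\<dots> \<le> D * \<bar>w ?k \<omega>\<bar> powr (2 + \<eta>)"
        proof (intro mult_left_mono A_nonneg)
          show "(w ?k \<omega>) ^ 4 \<le> \<bar>w ?k \<omega>\<bar> powr (2 + \<eta>)"
          proof (cases "w ?k \<omega> = 0")
            case False
            have "(w ?k \<omega>) ^ 4 = \<bar>w ?k \<omega>\<bar> powr 4" using False by (simp add: powr_numeral)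
            also have "\<dots> \<le> \<bar>w ?k \<omega>\<bar> powr (2 + \<eta>)"
              using False w_abs_le[OF k \<omega>] eta by (intro powr_mono') auto
            finally show ?thesis .
          qed simp
        qed
        finally show ?thesis .
      qed
      finally have "cmod (r \<omega>) \<le> A * (\<bar>w ?k \<omega>\<bar> powr (2 + \<eta>) * \<bar>e ?k \<omega>\<bar> powr (2 + \<eta>)) + D * \<bar>w ?k \<omega>\<bar> powr (2 + \<eta>)"
        by simp
      then show ?thesis unfolding norm_mult using H_le[OF \<omega>] by (intro mult_mono) auto
    qed
    have g_int: "integrable M ?g" using weighted_powr(1)[OF k] w_powr_int[OF k] by auto
    have Hr_int: "integrable M (\<lambda>\<omega>. H \<omega> * r \<omega>)"
      using Hr by (intro Bochner_Integration.integrable_bound[OF g_int]) (auto intro!: AE_I2 intro: order_trans[OF _ abs_ge_self])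
    have "(CLINT \<omega>|M. E ?k \<omega>) - (CLINT \<omega>|M. E j \<omega>) = (CLINT \<omega>|M. E ?k \<omega> - E j \<omega>)"
      using E_int j by simp
    also have "\<dots> = (CLINT \<omega>|M. H \<omega> * r \<omega>)"
      unfolding diff using m1 m2 Hr_int by simp
    finally have eq: "(CLINT \<omega>|M. E ?k \<omega>) - (CLINT \<omega>|M. E j \<omega>) = (CLINT \<omega>|M. H \<omega> * r \<omega>)" .
    have "cmod ((CLINT \<omega>|M. E ?k \<omega>) - (CLINT \<omega>|M. E j \<omega>)) \<le> (\<integral>\<omega>. ?g \<omega> \<partial>M)"
      unfolding eq by (rule norm_integral_le_integral[OF Hr_int g_int]) (rule Hr)
    also have "\<dots> = exp (t\<^sup>2 / 2) * (A * (\<integral>\<omega>. \<bar>w ?k \<omega>\<bar> powr (2 + \<eta>) * \<bar>e ?k \<omega>\<bar> powr (2 + \<eta>) \<partial>M) + D * (\<integral>\<omega>. \<bar>w ?k \<omega>\<bar> powr (2 + \<eta>) \<partial>M))"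
      using weighted_powr(1)[OF k] w_powr_int[OF k] by simp
    also have "\<dots> \<le> exp (t\<^sup>2 / 2) * (A * (K * (\<integral>\<omega>. \<bar>w ?k \<omega>\<bar> powr (2 + \<eta>) \<partial>M)) + D * (\<integral>\<omega>. \<bar>w ?k \<omega>\<bar> powr (2 + \<eta>) \<partial>M))"
      using weighted_powr(2)[OF k] A_nonneg by (intro mult_left_mono add_right_mono) auto
    finally show ?thesis by (simp add: algebra_simps)
  qed
  have "cmod ((CLINT \<omega>|M. E j \<omega>) - 1) \<le> exp (t\<^sup>2 / 2) * (A * K + D) * (\<Sum>i=1..j. \<integral>\<omega>. \<bar>w i \<omega>\<bar> powr (2 + \<eta>) \<partial>M)"
    if "j \<le> n" for j
    using that
  proof (induction j)
    case 0
    then show ?case by (simp add: E_def prob_space)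
  next
    case (Suc j)
    have "cmod ((CLINT \<omega>|M. E (Suc j) \<omega>) - 1)
      \<le> cmod ((CLINT \<omega>|M. E (Suc j) \<omega>) - (CLINT \<omega>|M. E j \<omega>)) + cmod ((CLINT \<omega>|M. E j \<omega>) - 1)"
      using norm_triangle_ineq[of "(CLINT \<omega>|M. E (Suc j) \<omega>) - (CLINT \<omega>|M. E j \<omega>)" "(CLINT \<omega>|M. E j \<omega>) - 1"] by simp
    then show ?case using step[of j] Suc by (simp add: distrib_left)
  qed
  from this[of n] have En: "cmod ((CLINT \<omega>|M. E n \<omega>) - 1) \<le> exp (t\<^sup>2 / 2) * (A * K + D) * lyapunov"
    by (simp add: lyapunov_def)
  let ?Z = "{\<omega> \<in> space M. (\<Sum>i=1..n. (w i \<omega>)\<^sup>2) = 0}"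
  have W_eq: "W \<omega> = (\<Sum>i=1..n. a i \<omega> * e i \<omega>)" for \<omega>
    by (simp add: W_def weighted_sum_def a_def sum_divide_distrib)
  have W_meas[measurable]: "W \<in> borel_measurable M" unfolding W_def by measurable
  have char: "char (distr M borel W) t = (CLINT \<omega>|M. iexp (t * W \<omega>))"
    unfolding char_def by (subst integral_distr) auto
  have iexp_int: "integrable M (\<lambda>\<omega>. iexp (t * W \<omega>))"
    by (intro integrable_const_bound[where B = 1]) auto
  define q where "q = exp (- (t\<^sup>2) / 2)"
  have q: "0 \<le> q" "q \<le> 1" "q * exp (t\<^sup>2 / 2) = 1"
    unfolding q_def exp_add[symmetric] by simp_all
  \<comment> \<open>On the degenerate event \<open>W\<close> is 0 and \<open>E n\<close> is 1, so
    the discrepancy is 1 - q, at most 1.\<close>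
  have close: "cmod (iexp (t * W \<omega>) - of_real q * E n \<omega>) \<le> indicator ?Z \<omega>" if \<omega>: "\<omega> \<in> space M" for \<omega>
  proof (cases "(\<Sum>i=1..n. (w i \<omega>)\<^sup>2) = 0")
    case True
    then have "W \<omega> = 0" "E n \<omega> = 1" using w_eq_0[OF _ \<omega>] by (simp_all add: W_eq E_def a_def y_def)
    moreover have "cmod (1 - of_real q) \<le> 1"
      using q norm_of_real[of "1 - q", where 'a = complex] by simp
    ultimately show ?thesis using True \<omega> by simp
  next
    case False
    then have "(\<Sum>i=1..n. y i \<omega>) = t\<^sup>2 / 2" using y_sum[OF \<omega>] by simp
    then have "of_real q * E n \<omega> = iexp (t * W \<omega>) * of_real (q * exp (t\<^sup>2 / 2))"
      unfolding E_def W_eq of_real_mult by (simp only: mult_ac)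
    then show ?thesis unfolding q(3) by simp
  qed
  have Z_int: "integrable M (indicator ?Z :: 'a \<Rightarrow> real)" by (simp add: integrable_indicator_iff emeasure_eq_measure)
  have "char (distr M borel W) t - of_real q
    = (CLINT \<omega>|M. iexp (t * W \<omega>) - of_real q * E n \<omega>) + of_real q * ((CLINT \<omega>|M. E n \<omega>) - 1)"
    unfolding char using iexp_int E_int[of n]
    by (subst Bochner_Integration.integral_diff) (auto simp: right_diff_distrib)
  also have "cmod \<dots> \<le> (\<integral>\<omega>. indicator ?Z \<omega> \<partial>M) + q * (exp (t\<^sup>2 / 2) * (A * K + D) * lyapunov)"
  proof (rule norm_triangle_mono)
    show "cmod (CLINT \<omega>|M. iexp (t * W \<omega>) - of_real q * E n \<omega>) \<le> (\<integral>\<omega>. indicator ?Z \<omega> \<partial>M)"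
      using iexp_int E_int[of n] close by (intro norm_integral_le_integral Z_int) auto
    show "cmod (of_real q * ((CLINT \<omega>|M. E n \<omega>) - 1)) \<le> q * (exp (t\<^sup>2 / 2) * (A * K + D) * lyapunov)"
      unfolding norm_mult using En q by (intro mult_mono) auto
  qed
  also have "q * (exp (t\<^sup>2 / 2) * (A * K + D) * lyapunov) = (A * K + D) * lyapunov"
    using q(3) by (metis mult.assoc mult_1)
  finally show ?thesis unfolding A_def D_def q_def by (simp add: add.commute)
qed

text \<open>\<open>var\<close> trades each squared noise for its conditional variance; the sum is
  then \<open>scale_sq\<close>, which is 0 on the degenerate event and at most \<open>K\<close>
  elsewhere.\<close>

lemma weighted_sq_expectation:
  shows "\<And>i. i \<in> {1..n} \<Longrightarrow> integrable M (\<lambda>\<omega>. (w i \<omega>)\<^sup>2 * (e i \<omega>)\<^sup>2)"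
    and "(\<Sum>i=1..n. \<integral>\<omega>. (w i \<omega>)\<^sup>2 * (e i \<omega>)\<^sup>2 \<partial>M) \<le> K"
proof -
  have w2: "(w i \<omega>)\<^sup>2 \<le> 1" if "i \<in> {1..n}" "\<omega> \<in> space M" for i \<omega>
    using w_abs_le[OF that] by (simp add: abs_square_le_1)
  show "integrable M (\<lambda>\<omega>. (w i \<omega>)\<^sup>2 * (e i \<omega>)\<^sup>2)" if i: "i \<in> {1..n}" for i
    using integrable_scaleR_bounded[OF e_sq_int[OF i], of "\<lambda>\<omega>. (w i \<omega>)\<^sup>2" 1] w2[OF i]
    by (simp add: mult.commute)
  have int_v: "integrable M (\<lambda>\<omega>. (w i \<omega>)\<^sup>2 * v i \<omega>)" if i: "i \<in> {1..n}" for i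
    using integrable_scaleR_bounded[OF v_int[OF i], of "\<lambda>\<omega>. (w i \<omega>)\<^sup>2" 1] w2[OF i]
    by (simp add: mult.commute)
  have "(\<Sum>i=1..n. \<integral>\<omega>. (w i \<omega>)\<^sup>2 * (e i \<omega>)\<^sup>2 \<partial>M) = (\<Sum>i=1..n. \<integral>\<omega>. (w i \<omega>)\<^sup>2 * v i \<omega> \<partial>M)"
    by (intro sum.cong refl var[where B = 1]) (use w2 in \<open>auto simp: w_inv\<close>)
  also have "\<dots> = (\<integral>\<omega>. scale_sq \<omega> \<partial>M)"
    unfolding scale_sq_def using int_v by simp
  also have "\<dots> \<le> (\<integral>\<omega>. K \<partial>M)"
  proof (rule integral_mono)
    show "integrable M scale_sq" unfolding scale_sq_def[abs_def] using int_v by (intro Bochner_Integration.integrable_sum)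
    fix \<omega> assume \<omega>: "\<omega> \<in> space M"
    show "scale_sq \<omega> \<le> K"
    proof (cases "(\<Sum>i=1..n. (w i \<omega>)\<^sup>2) = 0")
      case True
      then show ?thesis using w_eq_0[OF _ \<omega>] K_ge by (simp add: scale_sq_def)
    next
      case False
      then show ?thesis using sum_sq[OF \<omega>] scale_sq_bounds(2)[OF \<omega>] by simp
    qed
  qed simp
  finally show "(\<Sum>i=1..n. \<integral>\<omega>. (w i \<omega>)\<^sup>2 * (e i \<omega>)\<^sup>2 \<partial>M) \<le> K" by (simp add: prob_space)
qed

text \<open>Tightness, so that the factor that multiplies the coefficient error in the denominator
  of the statistic stays bounded.\<close>

lemma prob_weighted_sq_gt_le:
  assumes "r > 0"
  shows "prob {\<omega> \<in> space M. weighted_sq \<omega> > r} \<le> K / r"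
proof -
  have "prob {\<omega> \<in> space M. weighted_sq \<omega> > r} \<le> prob {\<omega> \<in> space M. weighted_sq \<omega> \<ge> r}"
    by (rule finite_measure_mono) auto
  also have "\<dots> \<le> (\<integral>\<omega>. weighted_sq \<omega> \<partial>M) / r"
  proof (rule integral_Markov_inequality_measure[where A = "{}"])
    show "integrable M weighted_sq" unfolding weighted_sq_def[abs_def] using weighted_sq_expectation(1) by (intro Bochner_Integration.integrable_sum)
    show "AE \<omega> in M. 0 \<le> weighted_sq \<omega>" unfolding weighted_sq_def by (intro AE_I2 sum_nonneg) auto
  qed (use assms in auto)
  also have "(\<integral>\<omega>. weighted_sq \<omega> \<partial>M) \<le> K"
    unfolding weighted_sq_def using weighted_sq_expectation by simp
  finally show ?thesis using assms by (simp add: divide_right_mono)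
qed

text \<open>Tightness of the numerator, which makes the squared-mean correction in the empirical
  variance negligible. The remainders are taken quadratic, hence the constant
  \<open>K / 2\<close>.\<close>

lemma prob_abs_weighted_sum_gt_le:
  assumes "r > 0"
  shows "prob {\<omega> \<in> space M. \<bar>weighted_sum \<omega>\<bar> > r} \<le> (K / 2) / (sqrt (1 + r\<^sup>2) - 1)"
proof -
  define \<xi> where "\<xi> i \<omega> = w i \<omega> * e i \<omega>" for i \<omega>
  have int: "integrable M (\<xi> i)" if i: "i \<in> {1..n}" for i
    using integrable_scaleR_bounded[OF e_int[OF i], of "w i" 1] w_abs_le[OF i]
    by (simp add: mult.commute \<xi>_def[abs_def])
  have int2: "integrable M (\<lambda>\<omega>. (\<xi> i \<omega>)\<^sup>2 / 2)" if i: "i \<in> {1..n}" for i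
    using weighted_sq_expectation(1)[OF i] by (simp add: \<xi>_def power_mult_distrib)
  have orth: "(\<integral>\<omega>. (\<Sum>i=1..j. \<xi> i \<omega>) / sqrt (1 + (\<Sum>i=1..j. \<xi> i \<omega>)\<^sup>2) * \<xi> (Suc j) \<omega> \<partial>M) = 0" if j: "j < n" for j
  proof -
    have k: "Suc j \<in> {1..n}" using j by auto
    define H where "H \<omega> = (\<Sum>i=1..j. \<xi> i \<omega>) / sqrt (1 + (\<Sum>i=1..j. \<xi> i \<omega>)\<^sup>2) * w (Suc j) \<omega>" for \<omega>
    have "(\<integral>\<omega>. H \<omega> * e (Suc j) \<omega> \<partial>M) = 0"
    proof (rule mean[OF k, where B = 1])
      show "H \<in> borel_measurable M" unfolding H_def[abs_def] \<xi>_def by measurable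
      fix \<omega> assume \<omega>: "\<omega> \<in> space M"
      have "\<bar>H \<omega>\<bar> \<le> 1 * 1" unfolding H_def abs_mult
        by (intro mult_mono abs_div_sqrt_le w_abs_le[OF k \<omega>]) auto
      then show "\<bar>H \<omega>\<bar> \<le> 1" by simp
      have "(\<Sum>i=1..j. \<xi> i (\<zeta> (Suc j) \<omega>)) = (\<Sum>i=1..j. \<xi> i \<omega>)"
        using \<omega> k by (intro sum.cong) (auto simp: \<xi>_def w_inv e_inv)
      then show "H (\<zeta> (Suc j) \<omega>) = H \<omega>" using w_inv[OF k k \<omega>] by (simp add: H_def)
    qed
    then show ?thesis by (simp add: H_def \<xi>_def mult.assoc)
  qed
  have "\<And>i \<omega>. min (2 * \<bar>\<xi> i \<omega>\<bar>) ((\<xi> i \<omega>)\<^sup>2 / 2) \<le> (\<xi> i \<omega>)\<^sup>2 / 2" by simp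
  note * = expectation_sqrt_one_plus_sq_le[where n = n, OF int int2 this orth]
  have "(\<Sum>i=1..n. \<integral>\<omega>. (\<xi> i \<omega>)\<^sup>2 / 2 \<partial>M) \<le> K / 2"
    using weighted_sq_expectation(2) by (simp add: \<xi>_def power_mult_distrib flip: sum_divide_distrib)
  then have "(\<integral>\<omega>. sqrt (1 + (weighted_sum \<omega>)\<^sup>2) \<partial>M) \<le> 1 + K / 2"
    using *(2) by (simp add: weighted_sum_def \<xi>_def)
  moreover have "integrable M (\<lambda>\<omega>. sqrt (1 + (weighted_sum \<omega>)\<^sup>2))"
    using *(1) by (simp add: weighted_sum_def \<xi>_def)
  ultimately show ?thesis using assms by (intro prob_abs_gt_le_sqrt) auto
qed

text \<open>The squared noise need not have a second moment, so Chebyshev's inequality is out of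
  reach; the interpolated increment bound gets by with a power between 1 and 2 of the centred
  squares.\<close>

lemma prob_weighted_sq_deviation_le:
  assumes "r > 0"
  shows "prob {\<omega> \<in> space M. \<bar>weighted_sq \<omega> - scale_sq \<omega>\<bar> > r}
    \<le> (8 * (K + K\<^sup>2) * lyapunov) / (sqrt (1 + r\<^sup>2) - 1)"
proof -
  define \<xi> where "\<xi> i \<omega> = (w i \<omega>)\<^sup>2 * ((e i \<omega>)\<^sup>2 - v i \<omega>)" for i \<omega>
  define g where "g i \<omega> = 8 * (\<bar>w i \<omega>\<bar> powr (2 + \<eta>) * \<bar>e i \<omega>\<bar> powr (2 + \<eta>) + K\<^sup>2 * \<bar>w i \<omega>\<bar> powr (2 + \<eta>))" for i \<omega>
  have w2: "(w i \<omega>)\<^sup>2 \<le> 1" if "i \<in> {1..n}" "\<omega> \<in> space M" for i \<omega>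
    using w_abs_le[OF that] by (simp add: abs_square_le_1)
  have int: "integrable M (\<xi> i)" if i: "i \<in> {1..n}" for i
  proof -
    have "integrable M (\<lambda>\<omega>. (e i \<omega>)\<^sup>2 - v i \<omega>)" using e_sq_int[OF i] v_int[OF i] by simp
    from integrable_scaleR_bounded[OF this, of "\<lambda>\<omega>. (w i \<omega>)\<^sup>2" 1] w2[OF i]
    show ?thesis by (simp add: mult.commute \<xi>_def[abs_def])
  qed
  have g_int: "integrable M (g i)" if i: "i \<in> {1..n}" for i
    unfolding g_def[abs_def] using weighted_powr(1)[OF i] w_powr_int[OF i] by auto
  have le: "min (2 * \<bar>\<xi> i \<omega>\<bar>) ((\<xi> i \<omega>)\<^sup>2 / 2) \<le> g i \<omega>" if i: "i \<in> {1..n}" and \<omega>: "\<omega> \<in> space M" for i \<omega>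
  proof -
    \<comment> \<open>Half of 2 + \<eta>, so that a p-th power of a square is a power of order 2 +
      \<eta>.\<close>
    define p where "p = 1 + \<eta> / 2"
    have p: "1 \<le> p" "p \<le> 2" "2 + \<eta> = 2 * p" using eta by (auto simp: p_def)
    have sq_powr: "(x\<^sup>2) powr p = \<bar>x\<bar> powr (2 + \<eta>)" for x :: real
    proof (cases "x = 0")
      case False
      then have "x\<^sup>2 = \<bar>x\<bar> powr 2" by (simp add: powr_numeral)
      then show ?thesis unfolding p(3) by (simp only: powr_powr)
    qed (use p in simp)
    have v: "0 \<le> v i \<omega>" "v i \<omega> \<le> K" using v_bounds[OF i \<omega>] c_pos by auto
    have "\<bar>(e i \<omega>)\<^sup>2 - v i \<omega>\<bar> \<le> max ((e i \<omega>)\<^sup>2) K"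
      using v zero_le_power2[of "e i \<omega>"] by linarith
    then have "\<bar>(e i \<omega>)\<^sup>2 - v i \<omega>\<bar> powr p \<le> (max ((e i \<omega>)\<^sup>2) K) powr p"
      using p by (intro powr_mono2) auto
    also have "\<dots> \<le> ((e i \<omega>)\<^sup>2) powr p + K powr p" by (auto simp: max_def)
    also have "K powr p \<le> K powr 2" using K_ge p by (intro powr_mono) auto
    also have "K powr 2 = K\<^sup>2" using K_ge by (simp add: powr_numeral)
    finally have d: "\<bar>(e i \<omega>)\<^sup>2 - v i \<omega>\<bar> powr p \<le> \<bar>e i \<omega>\<bar> powr (2 + \<eta>) + K\<^sup>2" by (simp add: sq_powr)
    have "min (2 * \<bar>\<xi> i \<omega>\<bar>) ((\<xi> i \<omega>)\<^sup>2 / 2) \<le> 2 * \<bar>\<xi> i \<omega>\<bar> powr p"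
      by (rule min_abs_sq_le_powr) (use p in auto)
    also have "\<bar>\<xi> i \<omega>\<bar> powr p = \<bar>w i \<omega>\<bar> powr (2 + \<eta>) * \<bar>(e i \<omega>)\<^sup>2 - v i \<omega>\<bar> powr p"
      unfolding \<xi>_def abs_mult using sq_powr[of "w i \<omega>"] by (simp add: powr_mult)
    also have "\<dots> \<le> \<bar>w i \<omega>\<bar> powr (2 + \<eta>) * (\<bar>e i \<omega>\<bar> powr (2 + \<eta>) + K\<^sup>2)"
      using d by (intro mult_left_mono) auto
    also have "2 * \<dots> \<le> 8 * \<dots>" by simp
    finally show ?thesis by (simp add: g_def algebra_simps)
  qed
  have orth: "(\<integral>\<omega>. (\<Sum>i=1..j. \<xi> i \<omega>) / sqrt (1 + (\<Sum>i=1..j. \<xi> i \<omega>)\<^sup>2) * \<xi> (Suc j) \<omega> \<partial>M) = 0" if j: "j < n" for j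
  proof -
    have k: "Suc j \<in> {1..n}" using j by auto
    define H where "H \<omega> = (\<Sum>i=1..j. \<xi> i \<omega>) / sqrt (1 + (\<Sum>i=1..j. \<xi> i \<omega>)\<^sup>2) * (w (Suc j) \<omega>)\<^sup>2" for \<omega>
    have "(\<integral>\<omega>. H \<omega> * ((e (Suc j) \<omega>)\<^sup>2 - v (Suc j) \<omega>) \<partial>M) = 0"
    proof (rule var_diff[OF k, where B = 1])
      show "H \<in> borel_measurable M" unfolding H_def[abs_def] \<xi>_def by measurable
      fix \<omega> assume \<omega>: "\<omega> \<in> space M"
      have "\<bar>H \<omega>\<bar> \<le> 1 * 1" unfolding H_def abs_mult
        using w2[OF k \<omega>] by (intro mult_mono abs_div_sqrt_le) auto
      then show "\<bar>H \<omega>\<bar> \<le> 1" by simp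
      have "(\<Sum>i=1..j. \<xi> i (\<zeta> (Suc j) \<omega>)) = (\<Sum>i=1..j. \<xi> i \<omega>)"
        using \<omega> k by (intro sum.cong) (auto simp: \<xi>_def w_inv e_inv v_inv)
      then show "H (\<zeta> (Suc j) \<omega>) = H \<omega>" using w_inv[OF k k \<omega>] by (simp add: H_def)
    qed
    then show ?thesis by (simp add: H_def \<xi>_def mult.assoc)
  qed
  note * = expectation_sqrt_one_plus_sq_le[where n = n, OF int g_int le orth]
  have sum_eq: "(\<Sum>i=1..n. \<xi> i \<omega>) = weighted_sq \<omega> - scale_sq \<omega>" for \<omega>
    by (simp add: \<xi>_def weighted_sq_def scale_sq_def right_diff_distrib sum_subtractf)
  have "(\<Sum>i=1..n. \<integral>\<omega>. g i \<omega> \<partial>M) \<le> (\<Sum>i=1..n. 8 * (K + K\<^sup>2) * (\<integral>\<omega>. \<bar>w i \<omega>\<bar> powr (2 + \<eta>) \<partial>M))"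
  proof (rule sum_mono)
    fix i assume i: "i \<in> {1..n}"
    have "(\<integral>\<omega>. g i \<omega> \<partial>M) = 8 * ((\<integral>\<omega>. \<bar>w i \<omega>\<bar> powr (2 + \<eta>) * \<bar>e i \<omega>\<bar> powr (2 + \<eta>) \<partial>M) + K\<^sup>2 * (\<integral>\<omega>. \<bar>w i \<omega>\<bar> powr (2 + \<eta>) \<partial>M))"
      unfolding g_def using weighted_powr(1)[OF i] w_powr_int[OF i] by simp
    then show "(\<integral>\<omega>. g i \<omega> \<partial>M) \<le> 8 * (K + K\<^sup>2) * (\<integral>\<omega>. \<bar>w i \<omega>\<bar> powr (2 + \<eta>) \<partial>M)"
      using weighted_powr(2)[OF i] by (simp add: distrib_left distrib_right)
  qed
  also have "\<dots> = 8 * (K + K\<^sup>2) * lyapunov" by (simp add: lyapunov_def sum_distrib_left)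
  finally have "(\<integral>\<omega>. sqrt (1 + (weighted_sq \<omega> - scale_sq \<omega>)\<^sup>2) \<partial>M) \<le> 1 + 8 * (K + K\<^sup>2) * lyapunov"
    using *(2) by (simp add: sum_eq del: One_nat_def)
  moreover have "integrable M (\<lambda>\<omega>. sqrt (1 + (weighted_sq \<omega> - scale_sq \<omega>)\<^sup>2))"
    using *(1) by (simp add: sum_eq del: One_nat_def)
  ultimately show ?thesis using assms by (intro prob_abs_gt_le_sqrt) auto
qed

text \<open>Write |w|^(2 + \<eta>) = |w|^\<eta> w^2, where the squares sum to at most 1. The first
  factor is at most \<open>r powr \<eta>\<close> unless the maximum is large, and at most 1 in any
  case.\<close>

lemma lyapunov_le:
  assumes "n \<ge> 1" and r: "r > 0"
  shows "lyapunov \<le> r powr \<eta> + prob {\<omega> \<in> space M. Max ((\<lambda>i. \<bar>w i \<omega>\<bar>) ` {1..n}) > r}"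
proof -
  let ?B = "{\<omega> \<in> space M. Max ((\<lambda>i. \<bar>w i \<omega>\<bar>) ` {1..n}) > r}"
  have B[measurable]: "?B \<in> sets M" by measurable
  have B_int: "integrable M (indicator ?B :: 'a \<Rightarrow> real)" by (simp add: integrable_indicator_iff emeasure_eq_measure)
  have "lyapunov = (\<integral>\<omega>. (\<Sum>i=1..n. \<bar>w i \<omega>\<bar> powr (2 + \<eta>)) \<partial>M)"
    unfolding lyapunov_def using w_powr_int by simp
  also have "\<dots> \<le> (\<integral>\<omega>. r powr \<eta> + indicator ?B \<omega> \<partial>M)"
  proof (rule integral_mono)
    show "integrable M (\<lambda>\<omega>. \<Sum>i=1..n. \<bar>w i \<omega>\<bar> powr (2 + \<eta>))" using w_powr_int by (intro Bochner_Integration.integrable_sum)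
    show "integrable M (\<lambda>\<omega>. r powr \<eta> + indicator ?B \<omega>)" using B_int by simp
    fix \<omega> assume \<omega>: "\<omega> \<in> space M"
    define m where "m = (if \<omega> \<in> ?B then 1 else r powr \<eta>)"
    have "\<bar>w i \<omega>\<bar> powr (2 + \<eta>) \<le> m * (w i \<omega>)\<^sup>2" if i: "i \<in> {1..n}" for i
    proof (cases "w i \<omega> = 0")
      case False
      have "\<bar>w i \<omega>\<bar> powr \<eta> \<le> m"
      proof (cases "\<omega> \<in> ?B")
        case True
        then show ?thesis using w_abs_le[OF i \<omega>] eta by (auto simp: m_def intro!: powr_le1)
      next
        case F: False
        have "\<bar>w i \<omega>\<bar> \<le> Max ((\<lambda>i. \<bar>w i \<omega>\<bar>) ` {1..n})" using i by (intro Max_ge) auto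
        also have "\<dots> \<le> r" using F \<omega> by auto
        finally show ?thesis using F eta by (auto simp: m_def intro!: powr_mono2)
      qed
      moreover have "\<bar>w i \<omega>\<bar> powr (2 + \<eta>) = \<bar>w i \<omega>\<bar> powr \<eta> * (w i \<omega>)\<^sup>2"
        using False by (simp add: powr_add powr_numeral mult.commute)
      ultimately show ?thesis by (simp add: mult_right_mono)
    qed simp
    then have "(\<Sum>i=1..n. \<bar>w i \<omega>\<bar> powr (2 + \<eta>)) \<le> (\<Sum>i=1..n. m * (w i \<omega>)\<^sup>2)" by (rule sum_mono)
    also have "\<dots> = m * (\<Sum>i=1..n. (w i \<omega>)\<^sup>2)" by (simp add: sum_distrib_left)
    also have "\<dots> \<le> m * 1"
      using sum_sq[OF \<omega>] by (intro mult_left_mono) (auto simp: m_def)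
    also have "m * 1 \<le> r powr \<eta> + indicator ?B \<omega>" by (auto simp: m_def)
    finally show "(\<Sum>i=1..n. \<bar>w i \<omega>\<bar> powr (2 + \<eta>)) \<le> r powr \<eta> + indicator ?B \<omega>" .
  qed
  also have "\<dots> = r powr \<eta> + prob ?B" using B_int B by (simp add: prob_space)
  finally show ?thesis .
qed

end

section \<open>Studentised sums\<close>

text \<open>The Lipschitz constant 1 is a crude bound of the density. It gives continuity, absorbs a
  small rescaling of the argument, and fixes the mesh of the grid in Polya's argument.\<close>

lemma cdf_std_normal_diff_le:
  assumes "a \<le> b"
  shows "cdf std_normal_distribution a \<le> cdf std_normal_distribution b"
    and "cdf std_normal_distribution b - cdf std_normal_distribution a \<le> b - a"
proof -
  interpret N: real_distribution std_normal_distribution by (rule real_dist_normal_dist)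
  show "cdf std_normal_distribution a \<le> cdf std_normal_distribution b"
    using assms by (rule N.cdf_nondecreasing)
  have dens: "std_normal_density x \<le> 1" for x
  proof -
    have "1 \<le> 2 * pi" using pi_ge_two by simp
    then have "1 \<le> sqrt (2 * pi)" by simp
    then have "1 / sqrt (2 * pi) * exp (- x\<^sup>2 / 2) \<le> 1 * 1"
      by (intro mult_mono) (auto simp: divide_le_eq_1)
    then show ?thesis by (simp add: std_normal_density_def)
  qed
  have "emeasure std_normal_distribution {a<..b} = (\<integral>\<^sup>+x. ennreal (std_normal_density x) * indicator {a<..b} x \<partial>lborel)"
    by (intro emeasure_density) auto
  also have "\<dots> \<le> (\<integral>\<^sup>+x. indicator {a<..b} x \<partial>lborel)"
  proof (rule nn_integral_mono)
    show "ennreal (std_normal_density x) * indicator {a<..b} x \<le> indicator {a<..b} x" for x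
      using dens[of x] by (auto simp: indicator_def)
  qed
  also have "\<dots> = ennreal (b - a)" using assms by simp
  finally have "measure std_normal_distribution {a<..b} \<le> b - a"
    using assms by (simp add: N.emeasure_eq_measure)
  moreover have "cdf std_normal_distribution b - cdf std_normal_distribution a = measure std_normal_distribution {a<..b}"
    using assms by (cases "a = b") (auto simp: N.cdf_diff_eq)
  ultimately show "cdf std_normal_distribution b - cdf std_normal_distribution a \<le> b - a" by simp
qed

lemma isCont_cdf_std_normal: "isCont (cdf std_normal_distribution) x"
proof -
  have "\<bar>cdf std_normal_distribution y - cdf std_normal_distribution x\<bar> \<le> \<bar>y - x\<bar>" for y
    using cdf_std_normal_diff_le[of x y] cdf_std_normal_diff_le[of y x]
    by (cases "x \<le> y") (simp_all add: abs_if)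
  then show ?thesis
    unfolding continuous_at_eps_delta dist_real_def by (blast intro: le_less_trans)
qed

text \<open>The cross term 2 e \<Delta> is controlled by |2 e| <= e^2 + 1, so the error is measured
  by the weighted sum of squares itself and no further moment is called for.\<close>

lemma abs_sum_perturbed_sq_diff_le:
  fixes w e \<Delta> :: "'i \<Rightarrow> real"
  assumes one: "(\<Sum>i\<in>I. (w i)\<^sup>2) = 1" and \<Delta>: "\<And>i. i \<in> I \<Longrightarrow> \<bar>\<Delta> i\<bar> \<le> D" and D: "0 \<le> D"
  shows "\<bar>(\<Sum>i\<in>I. ((e i - \<Delta> i) * w i)\<^sup>2) - (\<Sum>i\<in>I. (w i)\<^sup>2 * (e i)\<^sup>2)\<bar>
    \<le> D * ((\<Sum>i\<in>I. (w i)\<^sup>2 * (e i)\<^sup>2) + 1) + D\<^sup>2"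
proof -
  have "\<bar>(\<Sum>i\<in>I. ((e i - \<Delta> i) * w i)\<^sup>2) - (\<Sum>i\<in>I. (w i)\<^sup>2 * (e i)\<^sup>2)\<bar>
    = \<bar>\<Sum>i\<in>I. (w i)\<^sup>2 * ((\<Delta> i)\<^sup>2 - 2 * e i * \<Delta> i)\<bar>"
    unfolding sum_subtractf[symmetric]
    by (intro arg_cong[where f = abs] sum.cong) (auto simp: algebra_simps power2_eq_square)
  also have "\<dots> \<le> (\<Sum>i\<in>I. \<bar>(w i)\<^sup>2 * ((\<Delta> i)\<^sup>2 - 2 * e i * \<Delta> i)\<bar>)" by (rule sum_abs)
  also have "\<dots> \<le> (\<Sum>i\<in>I. (w i)\<^sup>2 * (D\<^sup>2 + D * ((e i)\<^sup>2 + 1)))"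
  proof (rule sum_mono)
    fix i assume i: "i \<in> I"
    have "\<bar>2 * e i\<bar> \<le> (e i)\<^sup>2 + 1"
      using zero_le_power2[of "e i + 1"] zero_le_power2[of "e i - 1"]
      unfolding power2_sum power2_diff abs_le_iff by simp
    then have "\<bar>2 * e i\<bar> * \<bar>\<Delta> i\<bar> \<le> ((e i)\<^sup>2 + 1) * D"
      using \<Delta>[OF i] by (intro mult_mono) auto
    moreover have "(\<Delta> i)\<^sup>2 \<le> D\<^sup>2" using \<Delta>[OF i] D abs_le_square_iff[of "\<Delta> i" D] by simp
    ultimately have "\<bar>(\<Delta> i)\<^sup>2 - 2 * e i * \<Delta> i\<bar> \<le> D\<^sup>2 + D * ((e i)\<^sup>2 + 1)"
      by (intro order_trans[OF abs_triangle_ineq4]) (simp add: abs_mult mult.commute)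
    then show "\<bar>(w i)\<^sup>2 * ((\<Delta> i)\<^sup>2 - 2 * e i * \<Delta> i)\<bar> \<le> (w i)\<^sup>2 * (D\<^sup>2 + D * ((e i)\<^sup>2 + 1))"
      unfolding abs_mult by (simp add: mult_left_mono)
  qed
  also have "\<dots> = D\<^sup>2 * (\<Sum>i\<in>I. (w i)\<^sup>2) + D * ((\<Sum>i\<in>I. (w i)\<^sup>2 * (e i)\<^sup>2) + (\<Sum>i\<in>I. (w i)\<^sup>2))"
    unfolding sum_distrib_left sum.distrib[symmetric] by (intro sum.cong) (auto simp: algebra_simps)
  finally show ?thesis by (simp add: one)
qed

lemma abs_sqrt_minus_1_le: "\<bar>sqrt x - 1\<bar> \<le> \<bar>x - 1\<bar>" if "0 \<le> x"
proof -
  have "\<bar>x - 1\<bar> = \<bar>sqrt x - 1\<bar> * \<bar>sqrt x + 1\<bar>"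
    using that unfolding abs_mult[symmetric] by (simp add: algebra_simps)
  also have "\<dots> \<ge> \<bar>sqrt x - 1\<bar> * 1" using that by (intro mult_left_mono) auto
  finally show ?thesis by simp
qed

text \<open>Off an event of small probability, \<open>W = T * R\<close> with \<open>R\<close> within
  \<open>h\<close> of 1. Hence \<open>T \<le> t\<close> lies between two events on \<open>W\<close>
  whose thresholds differ from t by at most |t| h, and the limit law of \<open>W\<close> passes to
  \<open>T\<close>.\<close>

lemma studentised_sum_cdf_tendsto:
  fixes M :: "nat \<Rightarrow> 'a measure" and T D :: "nat \<Rightarrow> 'a \<Rightarrow> real" and \<Delta> :: "nat \<Rightarrow> nat \<Rightarrow> 'a \<Rightarrow> real"
  assumes arr: "\<And>k. conditional_array (M k) (N k) (\<zeta> k) (e k) (w k) (v k) c K \<eta>"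
    and N_ge: "\<And>k. 1 \<le> N k" and N: "filterlim N at_top sequentially"
    and max: "\<And>r. 0 < r \<Longrightarrow>
      (\<lambda>k. measure (M k) {\<omega> \<in> space (M k). Max ((\<lambda>i. \<bar>w k i \<omega>\<bar>) ` {1..N k}) > r}) \<longlonglongrightarrow> 0"
    and nz: "(\<lambda>k. measure (M k) {\<omega> \<in> space (M k). (\<Sum>i=1..N k. (w k i \<omega>)\<^sup>2) = 0}) \<longlonglongrightarrow> 0"
    and D_meas: "\<And>k. D k \<in> borel_measurable (M k)"
    and D: "\<And>r. 0 < r \<Longrightarrow> (\<lambda>k. measure (M k) {\<omega> \<in> space (M k). D k \<omega> > r}) \<longlonglongrightarrow> 0"
    and \<Delta>: "\<And>k i \<omega>. i \<in> {1..N k} \<Longrightarrow> \<omega> \<in> space (M k) \<Longrightarrow> \<bar>\<Delta> k i \<omega>\<bar> \<le> D k \<omega>"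
    and T_meas: "\<And>k. T k \<in> borel_measurable (M k)"
    and T: "\<And>k. AE \<omega> in M k. (\<Sum>i=1..N k. (w k i \<omega>)\<^sup>2) = 1 \<longrightarrow>
      T k \<omega> = (\<Sum>i=1..N k. w k i \<omega> * e k i \<omega>)
        / sqrt ((\<Sum>i=1..N k. ((e k i \<omega> - \<Delta> k i \<omega>) * w k i \<omega>)\<^sup>2) - (\<Sum>i=1..N k. w k i \<omega> * e k i \<omega>)\<^sup>2 / N k)"
  shows "(\<lambda>k. measure (M k) {\<omega> \<in> space (M k). T k \<omega> \<le> t}) \<longlonglongrightarrow> cdf std_normal_distribution t"
proof -
  interpret A: conditional_array "M k" "N k" "\<zeta> k" "e k" "w k" "v k" c K \<eta> for k by (rule arr)
  note [measurable] = D_meas T_meas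
  define L where "L k = A.lyapunov k" for k
  have L: "L \<longlonglongrightarrow> 0"
  proof (rule tendstoI)
    fix \<epsilon> :: real assume \<epsilon>: "\<epsilon> > 0"
    define r where "r = (\<epsilon> / 2) powr (1 / \<eta>)"
    have \<eta>: "0 < \<eta>" by (rule A.eta)
    have r: "r > 0" "r powr \<eta> = \<epsilon> / 2" using \<epsilon> \<eta> by (auto simp: r_def powr_powr)
    have "eventually (\<lambda>k. measure (M k) {\<omega> \<in> space (M k). Max ((\<lambda>i. \<bar>w k i \<omega>\<bar>) ` {1..N k}) > r} < \<epsilon> / 2) sequentially"
      using \<epsilon> by (intro order_tendstoD(2)[OF max[OF r(1)]]) auto
    then show "eventually (\<lambda>k. dist (L k) 0 < \<epsilon>) sequentially"
    proof eventually_elim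
      case (elim k)
      then show ?case using A.lyapunov_le[OF N_ge r(1), of k] A.lyapunov_nonneg[of k] r(2)
        by (simp add: L_def)
    qed
  qed
  define W where "W k \<omega> = A.weighted_sum k \<omega> / sqrt (A.scale_sq k \<omega>)" for k \<omega>
  have [measurable]: "W k \<in> borel_measurable (M k)" for k unfolding W_def[abs_def] by measurable
  have weak: "weak_conv_m (\<lambda>k. distr (M k) borel (W k)) std_normal_distribution"
  proof (rule levy_continuity)
    show "real_distribution (distr (M k) borel (W k))" for k
      by (rule A.real_distribution_distr) measurable
    show "real_distribution std_normal_distribution" by (rule real_dist_normal_dist)
    fix t
    define B where "B = (\<bar>t\<bar> / sqrt c) powr (2 + \<eta>) * K + t ^ 4 * K\<^sup>2 / (8 * c\<^sup>2)"
    show "(\<lambda>k. char (distr (M k) borel (W k)) t) \<longlonglongrightarrow> char std_normal_distribution t"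
      unfolding char_std_normal_distribution
    proof (rule Lim_null_comparison[THEN LIM_zero_cancel])
      show "\<forall>\<^sub>F k in sequentially. cmod (char (distr (M k) borel (W k)) t - exp (- (t\<^sup>2) / 2))
        \<le> B * L k + measure (M k) {\<omega> \<in> space (M k). (\<Sum>i=1..N k. (w k i \<omega>)\<^sup>2) = 0}"
        using A.cmod_char_weighted_sum_le[of _ t] unfolding B_def L_def W_def by (intro always_eventually) auto
      show "(\<lambda>k. B * L k + measure (M k) {\<omega> \<in> space (M k). (\<Sum>i=1..N k. (w k i \<omega>)\<^sup>2) = 0}) \<longlonglongrightarrow> 0"
        using tendsto_add[OF tendsto_mult_left[OF L, of B] nz] by simp
    qed
  qed
  have W_conv: "(\<lambda>k. measure (M k) {\<omega> \<in> space (M k). W k \<omega> \<le> x}) \<longlonglongrightarrow> cdf std_normal_distribution x" for x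
  proof -
    have "(\<lambda>k. cdf (distr (M k) borel (W k)) x) \<longlonglongrightarrow> cdf std_normal_distribution x"
      using weak unfolding weak_conv_m_def weak_conv_def using isCont_cdf_std_normal by blast
    moreover have "cdf (distr (M k) borel (W k)) x = measure (M k) {\<omega> \<in> space (M k). W k \<omega> \<le> x}" for k
      unfolding cdf_def by (subst measure_distr) (auto intro!: arg_cong[where f = "measure (M k)"])
    ultimately show ?thesis by simp
  qed
  show ?thesis
  proof (rule tendstoI)
    fix \<epsilon>' :: real assume \<epsilon>': "\<epsilon>' > 0"
    \<comment> \<open>The final error is below four of these: two for the bad event, one for the
      limit law of \<open>W\<close>, one for the shifted threshold.\<close>
    define \<epsilon> where "\<epsilon> = \<epsilon>' / 8"
    have \<epsilon>: "\<epsilon> > 0" using \<epsilon>' by (simp add: \<epsilon>_def)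
    have cK: "0 < c" "1 \<le> K" using A.c_pos A.K_ge by auto
    \<comment> \<open>The second bound makes the threshold shift |t| h at most \<epsilon>;
      \<open>1 / 2\<close> keeps both \<open>R\<close> and the empirical variance positive.\<close>
    define h where "h = min (1 / 2) (\<epsilon> / (1 + \<bar>t\<bar>))"
    have h: "h > 0" "h \<le> 1 / 2" "\<bar>t\<bar> * h \<le> \<epsilon>"
    proof -
      show "h \<le> 1 / 2" unfolding h_def by (rule min.cobounded1)
      show "h > 0" using \<epsilon> by (simp add: h_def add_pos_nonneg)
      have "\<bar>t\<bar> * h \<le> \<bar>t\<bar> * (\<epsilon> / (1 + \<bar>t\<bar>))" by (intro mult_left_mono) (auto simp: h_def)
      also have "\<dots> \<le> \<epsilon>" using \<epsilon> by (simp add: field_simps)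
      finally show "\<bar>t\<bar> * h \<le> \<epsilon>" .
    qed
    \<comment> \<open>Three errors of size \<kappa> separate the empirical variance from
      \<open>scale_sq\<close>: coefficient error, weak law, squared mean. Relative to
      \<open>scale_sq\<close>, which is at least c, they add up to \<open>h\<close>.\<close>
    define \<kappa> where "\<kappa> = h * c / 3"
    have \<kappa>: "\<kappa> > 0" using h cK by (simp add: \<kappa>_def)
    \<comment> \<open>Markov's bound for \<open>weighted_sq\<close> then gives \<epsilon>. This is
      the one contribution to \<open>b\<close> that does not vanish.\<close>
    define q where "q = K / \<epsilon>"
    have q: "q > 0" using \<epsilon> cK by (simp add: q_def)
    \<comment> \<open>The perturbation error is D (Q + 1) + D^2. The bound 1 turns D^2 into D, and
      the second bound makes D (Q + 2) at most \<kappa>.\<close>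
    define \<rho> where "\<rho> = min 1 (\<kappa> / (q + 2))"
    have \<rho>: "\<rho> > 0" "\<rho> \<le> 1" "\<rho> * (q + 2) \<le> \<kappa>"
    proof -
      show "\<rho> \<le> 1" unfolding \<rho>_def by (rule min.cobounded1)
      show "\<rho> > 0" using q \<kappa> by (simp add: \<rho>_def)
      have "\<rho> * (q + 2) \<le> \<kappa> / (q + 2) * (q + 2)" using q by (intro mult_right_mono) (auto simp: \<rho>_def)
      then show "\<rho> * (q + 2) \<le> \<kappa>" using q by simp
    qed
    define B1 where "B1 k = {\<omega> \<in> space (M k). (\<Sum>i=1..N k. (w k i \<omega>)\<^sup>2) = 0}" for k
    define B2 where "B2 k = {\<omega> \<in> space (M k). \<bar>A.weighted_sq k \<omega> - A.scale_sq k \<omega>\<bar> > \<kappa>}" for k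
    define B3 where "B3 k = {\<omega> \<in> space (M k). D k \<omega> > \<rho>}" for k
    define B4 where "B4 k = {\<omega> \<in> space (M k). A.weighted_sq k \<omega> > q}" for k
    define B5 where "B5 k = {\<omega> \<in> space (M k). \<bar>A.weighted_sum k \<omega>\<bar> > sqrt (\<kappa> * N k)}" for k
    define B where "B k = B1 k \<union> (B2 k \<union> (B3 k \<union> (B4 k \<union> B5 k)))" for k
    have sets[measurable]: "B1 k \<in> sets (M k)" "B2 k \<in> sets (M k)" "B3 k \<in> sets (M k)" "B4 k \<in> sets (M k)" "B5 k \<in> sets (M k)" for k
      unfolding B1_def B2_def B3_def B4_def B5_def by measurable
    have [measurable]: "B k \<in> sets (M k)" for k unfolding B_def by measurable
    have B_le: "measure (M k) (B k) \<le> measure (M k) (B1 k) + (measure (M k) (B2 k) + (measure (M k) (B3 k)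
        + (measure (M k) (B4 k) + measure (M k) (B5 k))))" for k
      unfolding B_def by (intro order_trans[OF measure_Un_le] add_left_mono) auto
    define b where "b k = measure (M k) (B1 k) + (8 * (K + K\<^sup>2) * L k / (sqrt (1 + \<kappa>\<^sup>2) - 1)
      + (measure (M k) (B3 k) + (\<epsilon> + K / 2 / (sqrt (1 + \<kappa> * N k) - 1))))" for k
    have B_b: "measure (M k) (B k) \<le> b k" for k
    proof -
      have "0 < \<kappa> * N k" using \<kappa> N_ge[of k] by simp
      then have "measure (M k) (B5 k) \<le> K / 2 / (sqrt (1 + \<kappa> * N k) - 1)"
        unfolding B5_def using A.prob_abs_weighted_sum_gt_le[of "sqrt (\<kappa> * N k)" k] by simp
      moreover have "measure (M k) (B4 k) \<le> \<epsilon>"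
        unfolding B4_def using A.prob_weighted_sq_gt_le[OF q, of k] cK by (simp add: q_def)
      moreover have "measure (M k) (B2 k) \<le> 8 * (K + K\<^sup>2) * L k / (sqrt (1 + \<kappa>\<^sup>2) - 1)"
        unfolding B2_def L_def by (rule A.prob_weighted_sq_deviation_le[OF \<kappa>])
      ultimately show ?thesis using B_le[of k] unfolding b_def by linarith
    qed
    have "b \<longlonglongrightarrow> 0 + (8 * (K + K\<^sup>2) * 0 / (sqrt (1 + \<kappa>\<^sup>2) - 1) + (0 + (\<epsilon> + 0)))"
      unfolding b_def[abs_def]
    proof (intro tendsto_add tendsto_divide tendsto_mult tendsto_const L)
      show "(\<lambda>k. measure (M k) (B1 k)) \<longlonglongrightarrow> 0" unfolding B1_def by (rule nz)
      show "(\<lambda>k. measure (M k) (B3 k)) \<longlonglongrightarrow> 0" unfolding B3_def by (rule D) fact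
      show "sqrt (1 + \<kappa>\<^sup>2) - 1 \<noteq> 0" using \<kappa> by simp
      have "filterlim (\<lambda>k. - 1 + sqrt (1 + \<kappa> * real (N k))) at_top sequentially"
        by (intro filterlim_tendsto_add_at_top[OF tendsto_const] filterlim_compose[OF sqrt_at_top]
            filterlim_tendsto_pos_mult_at_top[OF tendsto_const \<kappa>]
            filterlim_compose[OF filterlim_real_sequentially N])
      then have "filterlim (\<lambda>k. sqrt (1 + \<kappa> * real (N k)) - 1) at_top sequentially" by simp
      then show "(\<lambda>k. K / 2 / (sqrt (1 + \<kappa> * real (N k)) - 1)) \<longlonglongrightarrow> 0"
        by (rule tendsto_divide_0[OF tendsto_const filterlim_at_top_imp_at_infinity])
    qed
    then have b_lim: "b \<longlonglongrightarrow> \<epsilon>" by simp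
    have good: "AE \<omega> in M k. \<omega> \<notin> B k \<longrightarrow> (\<exists>R. \<bar>R - 1\<bar> \<le> h \<and> W k \<omega> = T k \<omega> * R)" for k
    proof -
      have "AE \<omega> in M k. \<omega> \<in> space (M k)" by simp
      with T[of k] show ?thesis
      proof eventually_elim
        case (elim \<omega>)
        show ?case
        proof
          assume nB: "\<omega> \<notin> B k"
          from elim(2) have \<omega>: "\<omega> \<in> space (M k)" .
          define S where "S = A.weighted_sum k \<omega>"
          define Q where "Q = A.weighted_sq k \<omega>"
          define s2 where "s2 = A.scale_sq k \<omega>"
          define V where "V = (\<Sum>i=1..N k. ((e k i \<omega> - \<Delta> k i \<omega>) * w k i \<omega>)\<^sup>2)"
          have one: "(\<Sum>i=1..N k. (w k i \<omega>)\<^sup>2) = 1"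
            using nB \<omega> A.sum_sq[of \<omega> k] by (auto simp: B_def B1_def)
          have n: "\<bar>Q - s2\<bar> \<le> \<kappa>" "D k \<omega> \<le> \<rho>" "Q \<le> q" "\<bar>S\<bar> \<le> sqrt (\<kappa> * N k)"
            using nB \<omega> by (auto simp: B_def B2_def B3_def B4_def B5_def Q_def s2_def S_def)
          have s2: "c \<le> s2" unfolding s2_def by (rule A.scale_sq_bounds[OF \<omega> one])
          \<comment> \<open>\<open>D\<close> bounds an absolute value, but only at actual indices;
            index 1 is one because of \<open>N_ge\<close>.\<close>
          have D0: "0 \<le> D k \<omega>" using \<Delta>[of 1 k \<omega>] N_ge[of k] \<omega> by auto
          have Q0: "0 \<le> Q" unfolding Q_def A.weighted_sq_def by (intro sum_nonneg) auto
          have V: "\<bar>V - Q\<bar> \<le> \<kappa>"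
          proof -
            have "\<bar>V - Q\<bar> \<le> D k \<omega> * (Q + 1) + (D k \<omega>)\<^sup>2"
              unfolding V_def Q_def A.weighted_sq_def
              by (rule abs_sum_perturbed_sq_diff_le[OF one _ D0]) (use \<Delta> \<omega> in auto)
            also have "(D k \<omega>)\<^sup>2 \<le> D k \<omega>"
              using D0 n(2) \<rho>(2) by (simp add: power2_eq_square mult_left_le)
            also have "D k \<omega> * (Q + 1) + D k \<omega> = D k \<omega> * (Q + 2)" by (simp add: algebra_simps)
            also have "\<dots> \<le> \<rho> * (q + 2)" using n D0 Q0 \<rho> by (intro mult_mono) auto
            also have "\<dots> \<le> \<kappa>" by (rule \<rho>)
            finally show ?thesis by simp
          qed
          have S: "S\<^sup>2 / N k \<le> \<kappa>"
          proof -
            have "S\<^sup>2 \<le> \<kappa> * N k"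
              using power_mono[OF n(4), of 2] \<kappa> by simp
            then show ?thesis using N_ge[of k] by (simp add: divide_le_eq)
          qed
          define Bq where "Bq = V - S\<^sup>2 / N k"
          have Bq_s2: "\<bar>Bq - s2\<bar> \<le> 3 * \<kappa>"
          proof -
            have "0 \<le> S\<^sup>2 / N k" by simp
            then show ?thesis unfolding Bq_def using V S n(1) by linarith
          qed
          have Bq_h: "\<bar>Bq / s2 - 1\<bar> \<le> h"
          proof -
            have "\<bar>Bq / s2 - 1\<bar> = \<bar>Bq - s2\<bar> / s2" using s2 cK by (simp add: field_simps abs_if)
            also have "\<dots> \<le> 3 * \<kappa> / c" using Bq_s2 s2 cK \<kappa> by (intro frac_le) auto
            also have "\<dots> = h" using cK by (simp add: \<kappa>_def)
            finally show ?thesis .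
          qed
          then have pos: "0 < Bq / s2" using h unfolding abs_le_iff by linarith
          then have R: "\<bar>sqrt (Bq / s2) - 1\<bar> \<le> h"
            using abs_sqrt_minus_1_le[of "Bq / s2"] Bq_h by linarith
          have Bq: "0 < Bq" using pos s2 cK by (simp add: zero_less_divide_iff)
          have Tk: "T k \<omega> = S / sqrt Bq"
            using elim(1) one by (simp add: S_def Bq_def V_def A.weighted_sum_def)
          have "W k \<omega> = T k \<omega> * sqrt (Bq / s2)"
            using Bq s2 cK unfolding W_def Tk by (simp add: S_def[symmetric] s2_def[symmetric] real_sqrt_divide)
          with R show "\<exists>R. \<bar>R - 1\<bar> \<le> h \<and> W k \<omega> = T k \<omega> * R" by blast
        qed
      qed
    qed
    have tR: "t - \<bar>t\<bar> * h \<le> t * R" "t * R \<le> t + \<bar>t\<bar> * h" if "\<bar>R - 1\<bar> \<le> h" for R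
    proof -
      have "\<bar>t * R - t\<bar> = \<bar>t\<bar> * \<bar>R - 1\<bar>"
        unfolding abs_mult[symmetric] by (simp add: algebra_simps)
      also have "\<dots> \<le> \<bar>t\<bar> * h" using that by (intro mult_left_mono) auto
      finally show "t - \<bar>t\<bar> * h \<le> t * R" "t * R \<le> t + \<bar>t\<bar> * h" by linarith+
    qed
    have up: "measure (M k) {\<omega> \<in> space (M k). T k \<omega> \<le> t} \<le> measure (M k) {\<omega> \<in> space (M k). W k \<omega> \<le> t + \<bar>t\<bar> * h} + b k" for k
    proof -
      have "measure (M k) {\<omega> \<in> space (M k). T k \<omega> \<le> t} \<le> measure (M k) ({\<omega> \<in> space (M k). W k \<omega> \<le> t + \<bar>t\<bar> * h} \<union> B k)"
      proof (rule A.finite_measure_mono_AE)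
        show "AE \<omega> in M k. \<omega> \<in> {\<omega> \<in> space (M k). T k \<omega> \<le> t} \<longrightarrow> \<omega> \<in> {\<omega> \<in> space (M k). W k \<omega> \<le> t + \<bar>t\<bar> * h} \<union> B k"
          using good[of k]
        proof eventually_elim
          case (elim \<omega>)
          show ?case
          proof
            assume a: "\<omega> \<in> {\<omega> \<in> space (M k). T k \<omega> \<le> t}"
            show "\<omega> \<in> {\<omega> \<in> space (M k). W k \<omega> \<le> t + \<bar>t\<bar> * h} \<union> B k"
            proof (cases "\<omega> \<in> B k")
              case False
              then obtain R where R: "\<bar>R - 1\<bar> \<le> h" "W k \<omega> = T k \<omega> * R" using elim by auto
              have "T k \<omega> * R \<le> t * R" using a R(1) h by (intro mult_right_mono) auto
              then show ?thesis using a R tR(2)[OF R(1)] by auto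
            qed simp
          qed
        qed
      qed measurable
      also have "\<dots> \<le> measure (M k) {\<omega> \<in> space (M k). W k \<omega> \<le> t + \<bar>t\<bar> * h} + measure (M k) (B k)"
        by (rule measure_Un_le) measurable
      finally show ?thesis using B_b[of k] by linarith
    qed
    have lo: "measure (M k) {\<omega> \<in> space (M k). W k \<omega> \<le> t - \<bar>t\<bar> * h} \<le> measure (M k) {\<omega> \<in> space (M k). T k \<omega> \<le> t} + b k" for k
    proof -
      have "measure (M k) {\<omega> \<in> space (M k). W k \<omega> \<le> t - \<bar>t\<bar> * h} \<le> measure (M k) ({\<omega> \<in> space (M k). T k \<omega> \<le> t} \<union> B k)"
      proof (rule A.finite_measure_mono_AE)
        show "AE \<omega> in M k. \<omega> \<in> {\<omega> \<in> space (M k). W k \<omega> \<le> t - \<bar>t\<bar> * h} \<longrightarrow> \<omega> \<in> {\<omega> \<in> space (M k). T k \<omega> \<le> t} \<union> B k"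
          using good[of k]
        proof eventually_elim
          case (elim \<omega>)
          show ?case
          proof
            assume a: "\<omega> \<in> {\<omega> \<in> space (M k). W k \<omega> \<le> t - \<bar>t\<bar> * h}"
            show "\<omega> \<in> {\<omega> \<in> space (M k). T k \<omega> \<le> t} \<union> B k"
            proof (cases "\<omega> \<in> B k")
              case False
              then obtain R where R: "\<bar>R - 1\<bar> \<le> h" "W k \<omega> = T k \<omega> * R" using elim by auto
              have "T k \<omega> * R \<le> t * R" using a R(2) tR(1)[OF R(1)] by auto
              moreover have "0 < R" using R(1) h by (simp add: abs_le_iff)
              ultimately show ?thesis using a by auto
            qed simp
          qed
        qed
      qed measurable
      also have "\<dots> \<le> measure (M k) {\<omega> \<in> space (M k). T k \<omega> \<le> t} + measure (M k) (B k)"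
        by (rule measure_Un_le) measurable
      finally show ?thesis using B_b[of k] by linarith
    qed
    have \<Phi>: "cdf std_normal_distribution (t + \<bar>t\<bar> * h) \<le> cdf std_normal_distribution t + \<epsilon>"
      "cdf std_normal_distribution t - \<epsilon> \<le> cdf std_normal_distribution (t - \<bar>t\<bar> * h)"
      using cdf_std_normal_diff_le(2)[of t "t + \<bar>t\<bar> * h"] cdf_std_normal_diff_le(2)[of "t - \<bar>t\<bar> * h" t] h by auto
    have "\<forall>\<^sub>F k in sequentially. b k < 2 * \<epsilon>" using \<epsilon> by (intro order_tendstoD(2)[OF b_lim]) auto
    moreover have "\<forall>\<^sub>F k in sequentially. measure (M k) {\<omega> \<in> space (M k). W k \<omega> \<le> t + \<bar>t\<bar> * h}
        < cdf std_normal_distribution (t + \<bar>t\<bar> * h) + \<epsilon>"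
      using \<epsilon> by (intro order_tendstoD(2)[OF W_conv]) auto
    moreover have "\<forall>\<^sub>F k in sequentially. measure (M k) {\<omega> \<in> space (M k). W k \<omega> \<le> t - \<bar>t\<bar> * h}
        > cdf std_normal_distribution (t - \<bar>t\<bar> * h) - \<epsilon>"
      using \<epsilon> by (intro order_tendstoD(1)[OF W_conv]) auto
    ultimately show "\<forall>\<^sub>F k in sequentially.
      dist (measure (M k) {\<omega> \<in> space (M k). T k \<omega> \<le> t}) (cdf std_normal_distribution t) < \<epsilon>'"
    proof eventually_elim
      case (elim k)
      then show ?case using up[of k] lo[of k] \<Phi> \<epsilon> unfolding dist_real_def \<epsilon>_def by (simp add: abs_less_iff)
    qed
  qed
qed

text \<open>Polya's argument: monotonicity and the Lipschitz bound carry a bound on a fixed finite grid over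
  to all points.\<close>

lemma cdf_close_from_grid:
  fixes \<epsilon> :: real
  assumes \<epsilon>: "\<epsilon> > 0"
  obtains G :: "real set" where "finite G"
    "\<And>F t. mono F \<Longrightarrow> (\<And>x. 0 \<le> F x) \<Longrightarrow> (\<And>x. F x \<le> 1) \<Longrightarrow>
      (\<And>x. x \<in> G \<Longrightarrow> \<bar>F x - cdf std_normal_distribution x\<bar> \<le> \<epsilon>) \<Longrightarrow>
      \<bar>F t - cdf std_normal_distribution t\<bar> \<le> 2 * \<epsilon>"
proof -
  interpret N: real_distribution std_normal_distribution by (rule real_dist_normal_dist)
  let ?\<Phi> = "cdf std_normal_distribution"
  have "eventually (\<lambda>x. ?\<Phi> x < \<epsilon>) at_bot"
    using \<epsilon> by (intro order_tendstoD(2)[OF N.cdf_lim_at_bot]) auto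
  then obtain a where a: "\<And>x. x \<le> a \<Longrightarrow> ?\<Phi> x < \<epsilon>" by (auto simp: eventually_at_bot_linorder)
  have "eventually (\<lambda>x. ?\<Phi> x > 1 - \<epsilon>) at_top"
    using \<epsilon> by (intro order_tendstoD(1)[OF N.cdf_lim_at_top_prob]) auto
  then obtain b where b: "\<And>x. x \<ge> b \<Longrightarrow> ?\<Phi> x > 1 - \<epsilon>" by (auto simp: eventually_at_top_linorder)
  \<comment> \<open>Mesh \<epsilon> costs at most \<epsilon> by the Lipschitz bound. Outside the
    grid the normal distribution function is within \<epsilon> of 0 or 1, and monotonicity holds
    \<open>F\<close> within 2 \<epsilon> of the same limit.\<close>
  define x where "x i = a + real i * \<epsilon>" for i :: nat
  obtain m :: nat where m: "(b - a) / \<epsilon> \<le> real m" using real_arch_simple by blast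
  then have "b - a \<le> real m * \<epsilon>" using \<epsilon> by (simp only: pos_divide_le_eq)
  then have xm: "b \<le> x m" by (simp add: x_def)
  show thesis
  proof (rule that[of "x ` {0..m}"])
    fix F :: "real \<Rightarrow> real" and t
    assume F: "mono F" "\<And>x. 0 \<le> F x" "\<And>x. F x \<le> 1"
      and G: "\<And>y. y \<in> x ` {0..m} \<Longrightarrow> \<bar>F y - ?\<Phi> y\<bar> \<le> \<epsilon>"
    have G': "\<bar>F (x i) - ?\<Phi> (x i)\<bar> \<le> \<epsilon>" if "i \<le> m" for i using G that by auto
    have \<Phi>01: "0 \<le> ?\<Phi> t" "?\<Phi> t \<le> 1" by (auto simp: N.cdf_nonneg N.cdf_bounded_prob)
    consider "t < a" | "a \<le> t" "t < x m" | "x m \<le> t" by linarith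
    then show "\<bar>F t - ?\<Phi> t\<bar> \<le> 2 * \<epsilon>"
    proof cases
      case 1
      have "F t \<le> F a" using 1 by (intro monoD[OF F(1)]) auto
      moreover have "F a \<le> ?\<Phi> a + \<epsilon>" using G'[of 0] by (simp add: x_def)
      ultimately show ?thesis using a[of a] a[of t] 1 F(2)[of t] \<Phi>01 unfolding abs_le_iff by linarith
    next
      case 3
      have "F (x m) \<le> F t" using 3 by (intro monoD[OF F(1)]) auto
      then show ?thesis using G'[of m] b[OF xm] b[of t] 3 xm F(3)[of t] \<Phi>01 unfolding abs_le_iff by linarith
    next
      case 2
      define i where "i = nat \<lfloor>(t - a) / \<epsilon>\<rfloor>"
      have fl: "0 \<le> \<lfloor>(t - a) / \<epsilon>\<rfloor>" using 2 \<epsilon> by simp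
      have "real i = of_int \<lfloor>(t - a) / \<epsilon>\<rfloor>" unfolding i_def using fl by simp
      then have "real i \<le> (t - a) / \<epsilon>" "(t - a) / \<epsilon> < real i + 1"
        using of_int_floor_le[of "(t - a) / \<epsilon>"] real_of_int_floor_add_one_gt[of "(t - a) / \<epsilon>"] by auto
      then have "real i * \<epsilon> \<le> t - a" "t - a < (real i + 1) * \<epsilon>"
        using \<epsilon> by (simp_all only: pos_le_divide_eq pos_divide_less_eq)
      then have xi: "x i \<le> t" "t < x (Suc i)" by (simp_all add: x_def algebra_simps)
      have "real i < real m"
      proof -
        have "x i < x m" using xi(1) 2(2) by linarith
        then show ?thesis using \<epsilon> by (simp add: x_def)
      qed
      then have im: "i \<le> m" "Suc i \<le> m" by auto
      have step: "x (Suc i) - x i = \<epsilon>" by (simp add: x_def algebra_simps)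
      have "F (x i) \<le> F t" "F t \<le> F (x (Suc i))" using xi by (auto intro!: monoD[OF F(1)])
      moreover have "?\<Phi> t - ?\<Phi> (x i) \<le> t - x i" "?\<Phi> (x (Suc i)) - ?\<Phi> t \<le> x (Suc i) - t"
        using cdf_std_normal_diff_le(2)[of "x i" t] cdf_std_normal_diff_le(2)[of t "x (Suc i)"] xi by auto
      ultimately show ?thesis using G'[OF im(1)] G'[OF im(2)] step xi unfolding abs_le_iff by linarith
    qed
  qed simp
qed

section \<open>Least squares and Cramer's rule\<close>

lemma rss_fun_upd:
  assumes "finite I" "j < d"
  shows "rss d I D (\<beta>(j := \<beta> j + h)) = rss d I D \<beta>
    - 2 * h * (\<Sum>i\<in>I. (fst (D i) - dotp d \<beta> (snd (D i))) * snd (D i) j) + h\<^sup>2 * (\<Sum>i\<in>I. (snd (D i) j)\<^sup>2)"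
proof -
  have "dotp d (\<beta>(j := \<beta> j + h)) z = dotp d \<beta> z + h * z j" for z
  proof -
    have "dotp d (\<beta>(j := \<beta> j + h)) z = (\<Sum>k<d. \<beta> k * z k + (if k = j then h * z k else 0))"
      unfolding dotp_def by (intro sum.cong) (auto simp: algebra_simps)
    then show ?thesis using assms by (simp add: sum.distrib dotp_def)
  qed
  then have "rss d I D (\<beta>(j := \<beta> j + h)) = (\<Sum>i\<in>I. (fst (D i) - dotp d \<beta> (snd (D i)))\<^sup>2
    - 2 * h * ((fst (D i) - dotp d \<beta> (snd (D i))) * snd (D i) j) + h\<^sup>2 * (snd (D i) j)\<^sup>2)"
    unfolding rss_def by (intro sum.cong) (auto simp: power2_eq_square algebra_simps)
  then show ?thesis by (simp add: sum.distrib sum_subtractf sum_distrib_left rss_def)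
qed

lemma ols_solution_normal_equations:
  assumes "finite I" "j < d" "ols_solution d I D \<beta>"
  shows "(\<Sum>i\<in>I. (fst (D i) - dotp d \<beta> (snd (D i))) * snd (D i) j) = 0"
proof -
  define g where "g = (\<Sum>i\<in>I. (fst (D i) - dotp d \<beta> (snd (D i))) * snd (D i) j)"
  define s where "s = (\<Sum>i\<in>I. (snd (D i) j)\<^sup>2)"
  have s: "s \<ge> 0" by (simp add: s_def sum_nonneg)
  have le: "2 * h * g \<le> h\<^sup>2 * s" for h
  proof -
    have "\<beta>(j := \<beta> j + h) \<in> {..<d} \<rightarrow>\<^sub>E UNIV"
      using assms by (auto simp: ols_solution_def is_arg_min_def PiE_def extensional_def)
    then have "\<not> rss d I D (\<beta>(j := \<beta> j + h)) < rss d I D \<beta>"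
      using assms(3) unfolding ols_solution_def is_arg_min_def by blast
    then show ?thesis using rss_fun_upd[OF assms(1,2), of D \<beta> h] by (simp add: g_def s_def)
  qed
  \<comment> \<open>The optimal step g / s is undefined for a vanishing column; with s + 1 the gain
    still exceeds the cost unless g = 0.\<close>
  define h where "h = g / (s + 1)"
  have "2 * h * g = 2 * (g\<^sup>2 / (s + 1))" by (simp add: h_def power2_eq_square)
  moreover have "h\<^sup>2 * s \<le> g\<^sup>2 / (s + 1)"
  proof -
    have "h\<^sup>2 * s = g\<^sup>2 / (s + 1) * (s / (s + 1))" by (simp add: h_def power2_eq_square)
    also have "\<dots> \<le> g\<^sup>2 / (s + 1) * 1" using s by (intro mult_left_mono) auto
    finally show ?thesis by simp
  qed
  ultimately have "g\<^sup>2 / (s + 1) \<le> 0" using le[of h] by linarith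
  then have "g\<^sup>2 \<le> 0" using s by (simp add: divide_le_0_iff)
  then show ?thesis by (simp add: g_def)
qed

lemma dotp_diff: "dotp d (\<lambda>k. a k - b k) z = dotp d a z - dotp d b z"
  by (simp add: dotp_def left_diff_distrib sum_subtractf)

text \<open>Pythagoras: the residual vector is orthogonal to every linear combination of the
  predictors. This makes the normal equations sufficient for minimality.\<close>

lemma rss_eq_of_normal_equations:
  assumes "finite I"
    and "\<And>j. j < d \<Longrightarrow> (\<Sum>i\<in>I. (fst (D i) - dotp d \<beta> (snd (D i))) * snd (D i) j) = 0"
  shows "rss d I D b = rss d I D \<beta> + (\<Sum>i\<in>I. (dotp d (\<lambda>k. b k - \<beta> k) (snd (D i)))\<^sup>2)"
proof -
  let ?r = "\<lambda>i. fst (D i) - dotp d \<beta> (snd (D i))"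
  have "(\<Sum>i\<in>I. ?r i * dotp d (\<lambda>k. b k - \<beta> k) (snd (D i)))
    = (\<Sum>j<d. (b j - \<beta> j) * (\<Sum>i\<in>I. ?r i * snd (D i) j))"
    unfolding sum_distrib_left unfolding dotp_def[of _ "\<lambda>k. b k - \<beta> k"] sum_distrib_left
    by (subst sum.swap) (intro sum.cong, auto simp: algebra_simps)
  also have "\<dots> = 0" using assms(2) by simp
  finally have 0: "(\<Sum>i\<in>I. ?r i * dotp d (\<lambda>k. b k - \<beta> k) (snd (D i))) = 0" .
  have "rss d I D b = (\<Sum>i\<in>I. (?r i)\<^sup>2 - 2 * (?r i * dotp d (\<lambda>k. b k - \<beta> k) (snd (D i)))
      + (dotp d (\<lambda>k. b k - \<beta> k) (snd (D i)))\<^sup>2)"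
    unfolding rss_def dotp_diff by (intro sum.cong) (auto simp: power2_eq_square algebra_simps)
  then show ?thesis using 0 by (simp add: sum.distrib sum_subtractf rss_def flip: sum_distrib_left)
qed

text \<open>The matrix Z^T Z of the normal equations, in a matrix type whose dimension is a value,
  as d may vary with the sample size.\<close>

definition gram :: "nat \<Rightarrow> nat set \<Rightarrow> (nat \<Rightarrow> real \<times> rvec) \<Rightarrow> real Matrix.mat" where
  "gram d I D = Matrix.mat d d (\<lambda>(j, k). \<Sum>i\<in>I. snd (D i) j * snd (D i) k)"

definition cross_moment :: "nat \<Rightarrow> nat set \<Rightarrow> (nat \<Rightarrow> real \<times> rvec) \<Rightarrow> real Matrix.vec" where
  "cross_moment d I D = Matrix.vec d (\<lambda>j. \<Sum>i\<in>I. fst (D i) * snd (D i) j)"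

lemma gram_carrier: "gram d I D \<in> carrier_mat d d"
  by (simp add: gram_def)

lemma gram_mult_vec:
  assumes "j < d"
  shows "(gram d I D *\<^sub>v Matrix.vec d b) $ j = (\<Sum>i\<in>I. dotp d b (snd (D i)) * snd (D i) j)"
proof -
  have "(gram d I D *\<^sub>v Matrix.vec d b) $ j = (\<Sum>k<d. (\<Sum>i\<in>I. snd (D i) j * snd (D i) k) * b k)"
    using assms by (simp add: gram_def scalar_prod_def atLeast0LessThan)
  also have "\<dots> = (\<Sum>i\<in>I. dotp d b (snd (D i)) * snd (D i) j)"
    unfolding dotp_def sum_distrib_right by (subst sum.swap) (intro sum.cong, auto simp: algebra_simps)
  finally show ?thesis .
qed

lemma normal_equations_iff:
  "(\<forall>j<d. (\<Sum>i\<in>I. (fst (D i) - dotp d b (snd (D i))) * snd (D i) j) = 0)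
    \<longleftrightarrow> gram d I D *\<^sub>v Matrix.vec d b = cross_moment d I D"
proof -
  have "gram d I D *\<^sub>v Matrix.vec d b = cross_moment d I D \<longleftrightarrow>
    (\<forall>j<d. (gram d I D *\<^sub>v Matrix.vec d b) $ j = cross_moment d I D $ j)"
  proof (intro iffI)
    assume "\<forall>j<d. (gram d I D *\<^sub>v Matrix.vec d b) $ j = cross_moment d I D $ j"
    moreover have "dim_vec (gram d I D *\<^sub>v Matrix.vec d b) = d" "dim_vec (cross_moment d I D) = d"
      by (simp_all add: gram_def cross_moment_def)
    ultimately show "gram d I D *\<^sub>v Matrix.vec d b = cross_moment d I D"
      by - (rule eq_vecI, simp_all only:)
  qed simp
  also have "\<dots> \<longleftrightarrow> (\<forall>j<d. (\<Sum>i\<in>I. (fst (D i) - dotp d b (snd (D i))) * snd (D i) j) = 0)"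
    by (auto simp: gram_mult_vec cross_moment_def left_diff_distrib sum_subtractf)
  finally show ?thesis by simp
qed

lemma ols_solution_iff:
  assumes "finite I"
  shows "ols_solution d I D b \<longleftrightarrow> b \<in> {..<d} \<rightarrow>\<^sub>E UNIV \<and> gram d I D *\<^sub>v Matrix.vec d b = cross_moment d I D"
proof
  assume b: "ols_solution d I D b"
  then show "b \<in> {..<d} \<rightarrow>\<^sub>E UNIV \<and> gram d I D *\<^sub>v Matrix.vec d b = cross_moment d I D"
    using ols_solution_normal_equations[OF assms _ b] unfolding normal_equations_iff[symmetric]
    by (auto simp: ols_solution_def is_arg_min_def)
next
  assume b: "b \<in> {..<d} \<rightarrow>\<^sub>E UNIV \<and> gram d I D *\<^sub>v Matrix.vec d b = cross_moment d I D"
  then have eq: "rss d I D b' = rss d I D b + (\<Sum>i\<in>I. (dotp d (\<lambda>k. b' k - b k) (snd (D i)))\<^sup>2)" for b'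
    unfolding normal_equations_iff[symmetric] by (intro rss_eq_of_normal_equations assms) auto
  have "rss d I D b \<le> rss d I D b'" for b'
    unfolding eq[of b'] by (simp add: sum_nonneg)
  then show "ols_solution d I D b" using b by (auto simp: ols_solution_def is_arg_min_def not_less)
qed

text \<open>If the determinant vanishes, a kernel vector added to one solution gives another.
  Otherwise the adjugate matrix produces a solution and Cramer's rule determines its
  components.\<close>

lemma ols_exists_iff:
  assumes "finite I"
  shows "ols_exists d I D \<longleftrightarrow> Determinant.det (gram d I D) \<noteq> 0"
proof
  assume ex: "ols_exists d I D"
  show "Determinant.det (gram d I D) \<noteq> 0"
  proof
    assume "Determinant.det (gram d I D) = 0"
    then obtain v where v: "v \<in> carrier_vec d" "v \<noteq> 0\<^sub>v d" "gram d I D *\<^sub>v v = 0\<^sub>v d"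
      unfolding det_0_iff_vec_prod_zero[OF gram_carrier] by auto
    from ex obtain b where b: "ols_solution d I D b" and uniq: "\<And>b'. ols_solution d I D b' \<Longrightarrow> b' = b"
      unfolding ols_exists_def by auto
    define b' where "b' = (\<lambda>j\<in>{..<d}. b j + v $ j)"
    have "Matrix.vec d b' = Matrix.vec d b + v" using v(1) by (auto simp: b'_def)
    then have "gram d I D *\<^sub>v Matrix.vec d b' = gram d I D *\<^sub>v Matrix.vec d b + gram d I D *\<^sub>v v"
      using v(1) by (simp add: mult_add_distrib_mat_vec[OF gram_carrier])
    then have "ols_solution d I D b'"
      using b v(3) unfolding ols_solution_iff[OF assms] by (auto simp: b'_def cross_moment_def)
    then have "b' = b" by (rule uniq)
    have "v $ j = 0" if "j < d" for j
    proof -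
      have "b' j = b j + v $ j" using that by (simp add: b'_def)
      then show ?thesis using \<open>b' = b\<close> by simp
    qed
    then have "v = 0\<^sub>v d" using v(1) by auto
    with v(2) show False by simp
  qed
next
  assume det: "Determinant.det (gram d I D) \<noteq> 0"
  let ?G = "gram d I D" and ?w = "cross_moment d I D"
  define x where "x = (1 / Determinant.det ?G) \<cdot>\<^sub>v (adj_mat ?G *\<^sub>v ?w)"
  have w: "?w \<in> carrier_vec d" by (simp add: cross_moment_def)
  have aw: "adj_mat ?G *\<^sub>v ?w \<in> carrier_vec d" using adj_mat(1)[OF gram_carrier[of d I D]] w by simp
  then have x: "x \<in> carrier_vec d" by (simp add: x_def)
  have "?G *\<^sub>v x = (1 / Determinant.det ?G) \<cdot>\<^sub>v (?G *\<^sub>v (adj_mat ?G *\<^sub>v ?w))"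
    unfolding x_def using aw gram_carrier[of d I D] by (intro mult_mat_vec) auto
  also have "?G *\<^sub>v (adj_mat ?G *\<^sub>v ?w) = (?G * adj_mat ?G) *\<^sub>v ?w"
    using adj_mat(1)[OF gram_carrier[of d I D]] gram_carrier[of d I D] w by (simp add: assoc_mult_mat_vec)
  also have "\<dots> = Determinant.det ?G \<cdot>\<^sub>v ?w"
    unfolding adj_mat(2)[OF gram_carrier[of d I D]] using w
    by (intro eq_vecI) (auto simp: scalar_prod_smult_left)
  also have "(1 / Determinant.det ?G) \<cdot>\<^sub>v \<dots> = ?w" using det by (simp add: smult_smult_assoc)
  finally have Gx: "?G *\<^sub>v x = ?w" .
  have sol: "ols_solution d I D (\<lambda>j\<in>{..<d}. x $ j)"
  proof -
    have "Matrix.vec d (\<lambda>j\<in>{..<d}. x $ j) = x" using x by auto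
    then show ?thesis unfolding ols_solution_iff[OF assms] using Gx by simp
  qed
  have "b = (\<lambda>j\<in>{..<d}. x $ j)" if b: "ols_solution d I D b" for b
  proof
    fix j
    have b': "b \<in> {..<d} \<rightarrow>\<^sub>E UNIV" "?G *\<^sub>v Matrix.vec d b = ?w"
      using b unfolding ols_solution_iff[OF assms] by auto
    show "b j = (\<lambda>j\<in>{..<d}. x $ j) j"
    proof (cases "j < d")
      case True
      then show ?thesis
        using cramer_lemma_mat[OF gram_carrier[of d I D] _ True, of "Matrix.vec d b"]
          cramer_lemma_mat[OF gram_carrier[of d I D] x True] det Gx b'(2) by simp
    next
      case False
      then show ?thesis using b'(1) by (auto simp: PiE_def extensional_def)
    qed
  qed
  with sol show "ols_exists d I D" unfolding ols_exists_def by blast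
qed

lemma ols_coef_solution:
  assumes "ols_exists d I D"
  shows "ols_solution d I D (ols_coef d I D)"
  using assms theI'[of "ols_solution d I D"] unfolding ols_coef_def ols_exists_def by auto

text \<open>Replaces the definite description by a rational function of the data on all samples; the
  singular case is the default value built into \<open>ols_coef\<close>.\<close>

lemma ols_coef_cramer:
  assumes "finite I" "j < d"
  shows "ols_coef d I D j
    = (if Determinant.det (gram d I D) = 0 then 0
       else Determinant.det (replace_col (gram d I D) (cross_moment d I D) j) / Determinant.det (gram d I D))"
proof (cases "Determinant.det (gram d I D) = 0")
  case True
  then show ?thesis using assms ols_exists_iff[OF assms(1), of d D] by (simp add: ols_coef_def)
next
  case False
  then have "ols_solution d I D (ols_coef d I D)"
    using ols_exists_iff[OF assms(1), of d D] by (simp add: ols_coef_solution)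
  then have "gram d I D *\<^sub>v Matrix.vec d (ols_coef d I D) = cross_moment d I D"
    unfolding ols_solution_iff[OF assms(1)] by simp
  then show ?thesis
    using cramer_lemma_mat[OF gram_carrier[of d I D] _ assms(2), of "Matrix.vec d (ols_coef d I D)"] False assms(2)
    by (simp add: field_simps)
qed

section \<open>Measurability of least squares coefficients\<close>

lemma det_measurable:
  fixes A :: "'a \<Rightarrow> real Matrix.mat"
  assumes "\<And>\<omega>. A \<omega> \<in> carrier_mat d d"
    and [measurable]: "\<And>j k. j < d \<Longrightarrow> k < d \<Longrightarrow> (\<lambda>\<omega>. A \<omega> $$ (j, k)) \<in> borel_measurable M"
  shows "(\<lambda>\<omega>. Determinant.det (A \<omega>)) \<in> borel_measurable M"
proof -
  have "(\<lambda>\<omega>. Determinant.det (A \<omega>))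
    = (\<lambda>\<omega>. \<Sum>p | p permutes {0..<d}. signof p * (\<Prod>i = 0..<d. A \<omega> $$ (i, p i)))"
    using det_def'[OF assms(1)] by auto
  also have "\<dots> \<in> borel_measurable M"
  proof (intro borel_measurable_sum borel_measurable_times borel_measurable_const borel_measurable_prod)
    fix p i assume "p \<in> {p. p permutes {0..<d}}" "i \<in> {0..<d}"
    then have "p i < d" "i < d" by (auto simp: permutes_in_image dest: permutes_in_image[THEN iffD2])
    then show "(\<lambda>\<omega>. A \<omega> $$ (i, p i)) \<in> borel_measurable M" by measurable
  qed
  finally show ?thesis .
qed

lemma ols_coef_measurable:
  assumes I: "finite I" and j: "j < d"
    and [measurable]: "\<And>i. i \<in> I \<Longrightarrow> (\<lambda>\<omega>. fst (D \<omega> i)) \<in> borel_measurable M"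
      "\<And>i k. i \<in> I \<Longrightarrow> k < d \<Longrightarrow> (\<lambda>\<omega>. snd (D \<omega> i) k) \<in> borel_measurable M"
  shows "(\<lambda>\<omega>. ols_coef d I (D \<omega>) j) \<in> borel_measurable M"
proof -
  have G: "(\<lambda>\<omega>. gram d I (D \<omega>) $$ (k, l)) \<in> borel_measurable M" if "k < d" "l < d" for k l
    using that by (simp add: gram_def)
  have [measurable]: "(\<lambda>\<omega>. Determinant.det (gram d I (D \<omega>))) \<in> borel_measurable M"
    by (rule det_measurable[OF gram_carrier G])
  have [measurable]: "(\<lambda>\<omega>. Determinant.det (replace_col (gram d I (D \<omega>)) (cross_moment d I (D \<omega>)) j)) \<in> borel_measurable M"
  proof (rule det_measurable)
    show "replace_col (gram d I (D \<omega>)) (cross_moment d I (D \<omega>)) j \<in> carrier_mat d d" for \<omega>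
      using gram_carrier[of d I "D \<omega>"] by (simp add: replace_col_def)
    show "(\<lambda>\<omega>. replace_col (gram d I (D \<omega>)) (cross_moment d I (D \<omega>)) j $$ (k, l)) \<in> borel_measurable M"
      if "k < d" "l < d" for k l
      using that G[OF that] by (cases "l = j") (simp_all add: replace_col_def cross_moment_def gram_def)
  qed
  show ?thesis unfolding ols_coef_cramer[OF I j] by measurable
qed

section \<open>Measurability of the test statistic\<close>

lemma inverse_ennreal_antimono: "x \<le> y \<Longrightarrow> inverse (ennreal y) \<le> inverse (ennreal x)"
  by (cases "x \<le> 0") (auto simp: ennreal_neg inverse_ennreal intro!: ennreal_leI le_imp_inverse_le)

lemma variance_correction_antimono:
  assumes "0 \<le> c" "c \<le> c'"
  shows "(\<Sum>i\<in>I. ennreal (r i) / ennreal (v i + c')) / of_nat n \<le> (\<Sum>i\<in>I. ennreal (r i) / ennreal (v i + c)) / of_nat n"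
  unfolding divide_ennreal_def using assms
  by (intro mult_right_mono sum_mono mult_left_mono) (auto intro!: inverse_ennreal_antimono)

text \<open>For c > 0 all denominators are positive and A is a continuous real function, so the
  intermediate value theorem applies. Only the left end point is delicate, since A may be infinite
  at 0. Uniqueness comes from strict monotonicity, which needs a single positive residual.\<close>

lemma variance_correction_ex1:
  fixes r v :: "'i \<Rightarrow> real" and I :: "'i set" and n :: nat
  defines "A \<equiv> \<lambda>c. (\<Sum>i\<in>I. ennreal (r i) / ennreal (v i + c)) / of_nat n"
  assumes I: "finite I" and n: "0 < n" and nonneg: "\<And>i. i \<in> I \<Longrightarrow> 0 \<le> r i" "\<And>i. i \<in> I \<Longrightarrow> 0 \<le> v i"
    and gt: "A 0 > 1"
  shows "\<exists>!c. 0 \<le> c \<and> A c = 1"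
proof -
  define b where "b c = (\<Sum>i\<in>I. r i / (v i + c)) / n" for c
  have A_b': "A c = ennreal (b c)" if "0 \<le> c" "\<And>i. i \<in> I \<Longrightarrow> r i = 0 \<or> 0 < v i + c" for c
  proof -
    have "(\<Sum>i\<in>I. ennreal (r i) / ennreal (v i + c)) = (\<Sum>i\<in>I. ennreal (r i / (v i + c)))"
    proof (rule sum.cong[OF refl])
      fix i assume i: "i \<in> I"
      show "ennreal (r i) / ennreal (v i + c) = ennreal (r i / (v i + c))"
        using that(2)[OF i] nonneg[OF i] by (auto simp: divide_ennreal)
    qed
    also have "\<dots> = ennreal (\<Sum>i\<in>I. r i / (v i + c))"
      using nonneg that(1) by (intro sum_ennreal) auto
    finally have "A c = ennreal (\<Sum>i\<in>I. r i / (v i + c)) / ennreal (real n)"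
      by (simp add: A_def ennreal_of_nat_eq_real_of_nat)
    also have "\<dots> = ennreal (b c)"
      unfolding b_def using n nonneg that(1) by (intro divide_ennreal sum_nonneg) auto
    finally show ?thesis .
  qed
  have A_b: "A c = ennreal (b c)" if "0 < c" for c
  proof (rule A_b')
    show "r i = 0 \<or> 0 < v i + c" if "i \<in> I" for i using nonneg(2)[OF that] \<open>0 < c\<close> by auto
  qed (use that in simp)
  define R where "R = (\<Sum>i\<in>I. r i)"
  obtain i0 where i0: "i0 \<in> I" "0 < r i0"
  proof -
    have "\<not> (\<forall>i\<in>I. r i = 0)"
    proof
      assume "\<forall>i\<in>I. r i = 0"
      then have "A 0 = 0" by (simp add: A_def)
      with gt show False by simp
    qed
    then show ?thesis using nonneg(1) that by force
  qed
  have r_le: "r i \<le> R" if "i \<in> I" for i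
    unfolding R_def using that nonneg(1) I by (intro member_le_sum) auto
  have R: "0 < R" using i0 r_le[of i0] by linarith
  have cont: "continuous_on {x..y} b" if "\<And>i. i \<in> I \<Longrightarrow> r i = 0 \<or> 0 < v i + x" for x y
    unfolding b_def[abs_def]
  proof (rule continuous_on_divide[OF continuous_on_sum continuous_on_const])
    fix i assume i: "i \<in> I"
    show "continuous_on {x..y} (\<lambda>c. r i / (v i + c))"
    proof (cases "r i = 0")
      case False
      then show ?thesis using that[OF i] by (intro continuous_intros) auto
    qed simp
  next
    show "\<forall>c\<in>{x..y}. real n \<noteq> 0" using n by simp
  qed
  \<comment> \<open>At c = R / n each summand is at most n r_i / R, and these bounds sum to
    n.\<close>
  have b_top: "b (R / n) \<le> 1"
  proof -
    have "(\<Sum>i\<in>I. r i / (v i + R / n)) \<le> (\<Sum>i\<in>I. r i / (R / n))"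
      using nonneg R n by (intro sum_mono frac_le) auto
    also have "\<dots> = n" unfolding sum_divide_distrib[symmetric] R_def[symmetric] using R n by simp
    finally show ?thesis using n by (simp add: b_def)
  qed
  have "\<exists>c>0. b c = 1"
  proof (cases "\<exists>i\<in>I. v i = 0 \<and> 0 < r i")
    case True
    then obtain i where i: "i \<in> I" "v i = 0" "0 < r i" by auto
    have pos: "0 < r i / n" using i n by simp
    \<comment> \<open>A vanishing v_i with positive residual makes A infinite at 0, so the search
      starts at r_i / n, where this one summand equals n.\<close>
    have "b (r i / n) \<ge> 1"
    proof -
      have "n = r i / (v i + r i / n)" using i n by simp
      also have "\<dots> \<le> (\<Sum>j\<in>I. r j / (v j + r i / n))"
        using i nonneg pos I by (intro member_le_sum) auto
      finally show ?thesis using n by (simp add: b_def)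
    qed
    moreover have "r i / n \<le> R / n" using r_le[OF i(1)] by (intro divide_right_mono) auto
    ultimately obtain c where "r i / n \<le> c" "b c = 1"
      using IVT2'[of b "R / n" 1 "r i / n"] b_top cont[of "r i / n"] nonneg pos by (auto simp: add_nonneg_pos)
    then show ?thesis using pos by (intro exI[of _ c]) auto
  next
    case False
    then have *: "r i = 0 \<or> 0 < v i + 0" if "i \<in> I" for i using nonneg[OF that] that by force
    have b0: "b 0 > 1" using gt A_b'[OF _ *] by simp
    then obtain c where c: "0 \<le> c" "b c = 1"
      using IVT2'[of b "R / n" 1 0] b_top cont[OF *] R n by auto
    then have "c \<noteq> 0" using b0 by auto
    then show ?thesis using c by (intro exI[of _ c]) auto
  qed
  then obtain c where c: "0 < c" "b c = 1" by blast
  have strict: "b y < b x" if "0 < x" "x < y" for x y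
  proof -
    have "(\<Sum>i\<in>I. r i / (v i + y)) < (\<Sum>i\<in>I. r i / (v i + x))"
    proof (rule sum_strict_mono_ex1[OF I])
      show "\<forall>i\<in>I. r i / (v i + y) \<le> r i / (v i + x)"
        using nonneg that by (intro ballI frac_le) (auto intro: add_nonneg_pos)
      show "\<exists>i\<in>I. r i / (v i + y) < r i / (v i + x)"
        using i0 nonneg(2)[of i0] that by (intro bexI[of _ i0] divide_strict_left_mono mult_pos_pos) auto
    qed
    then show ?thesis using n by (simp add: b_def divide_strict_right_mono)
  qed
  show ?thesis
  proof (rule ex1I[of _ c])
    show "0 \<le> c \<and> A c = 1" using c A_b[of c] by simp
    fix y assume y: "0 \<le> y \<and> A y = 1"
    then have "y \<noteq> 0" using gt by auto
    then have "0 < y" using y by simp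
    then have "b y = 1" using y A_b[of y] by simp
    then show "y = c" using strict[of y c] strict[of c y] c \<open>0 < y\<close> by (cases y c rule: linorder_cases) auto
  qed
qed

lemma acrit_antimono:
  assumes "0 \<le> c" "c \<le> c'"
  shows "acrit R n D u c' \<le> acrit R n D u c"
  unfolding acrit_def by (rule variance_correction_antimono[OF assms])

lemma chat_solves:
  assumes "\<not> acrit R n D u 0 \<le> 1"
  shows "\<exists>!c. 0 \<le> c \<and> acrit R n D u c = 1" "0 \<le> chat R n D u" "acrit R n D u (chat R n D u) = 1"
proof -
  \<comment> \<open>For n = 0 the sum is empty and 0 / 0 = 0 in \<open>ennreal\<close>, so
    \<open>acrit\<close> could not exceed 1.\<close>
  have n: "0 < n" using assms by (cases "n = 0") (auto simp: acrit_def I2_def)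
  show ex1: "\<exists>!c. 0 \<le> c \<and> acrit R n D u c = 1"
    unfolding acrit_def
    by (rule variance_correction_ex1) (use assms n in \<open>auto simp: acrit_def I2_def not_le\<close>)
  show "0 \<le> chat R n D u" "acrit R n D u (chat R n D u) = 1"
    using theI'[OF ex1] assms by (auto simp: chat_def)
qed

lemma chat_nonneg: "0 \<le> chat R n D u"
  using chat_solves(2)[of R n D u] by (cases "acrit R n D u 0 \<le> 1") (auto simp: chat_def)

text \<open>One direction is antitonicity. In the other, a point below \<open>chat\<close> with
  \<open>acrit\<close> at most 1 would be squeezed to the value 1, contradicting uniqueness of the
  solution.\<close>

lemma chat_le_iff:
  assumes c: "0 \<le> c"
  shows "chat R n D u \<le> c \<longleftrightarrow> acrit R n D u c \<le> 1"
proof (cases "acrit R n D u 0 \<le> 1")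
  case True
  then show ?thesis using acrit_antimono[OF _ c, of R n D u] c by (auto simp: chat_def)
next
  case False
  note sol = chat_solves[OF False]
  show ?thesis
  proof
    assume "chat R n D u \<le> c"
    then show "acrit R n D u c \<le> 1" using acrit_antimono[OF sol(2), of c R n D u] sol(3) by simp
  next
    assume le: "acrit R n D u c \<le> 1"
    show "chat R n D u \<le> c"
    proof (rule ccontr)
      assume gt: "\<not> chat R n D u \<le> c"
      then have "acrit R n D u c = 1" using acrit_antimono[OF c, of "chat R n D u" R n D u] le sol(3) by simp
      then show False using sol c gt by (metis order_refl)
    qed
  qed
qed

section \<open>Measurability of the fitted quantities\<close>

lemma obsY_measurable: "obsY \<in> borel_measurable (obs_space MX d)"
  and obsZ_measurable: "obsZ \<in> obs_space MX d \<rightarrow>\<^sub>M rvec_space d"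
  and obsXZ_measurable: "obsXZ \<in> obs_space MX d \<rightarrow>\<^sub>M MX \<Otimes>\<^sub>M rvec_space d"
  unfolding obsY_def[abs_def] obsZ_def[abs_def] obsXZ_def[abs_def] obs_space_def by measurable

lemma rvec_component_measurable: "j < d \<Longrightarrow> (\<lambda>z. z j) \<in> borel_measurable (rvec_space d)"
  unfolding rvec_space_def by measurable

lemma measurable_procedureD:
  assumes "measurable_procedure U I W V R" "u \<in> M \<rightarrow>\<^sub>M U"
    and S: "\<And>i. i \<in> I \<Longrightarrow> (\<lambda>\<omega>. S \<omega> i) \<in> M \<rightarrow>\<^sub>M borel \<Otimes>\<^sub>M W" and "x \<in> M \<rightarrow>\<^sub>M V"
  shows "(\<lambda>\<omega>. R (u \<omega>) (\<lambda>i\<in>I. S \<omega> i) (x \<omega>)) \<in> borel_measurable M"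
proof -
  have "(\<lambda>\<omega>. (u \<omega>, (\<lambda>i\<in>I. S \<omega> i), x \<omega>)) \<in> M \<rightarrow>\<^sub>M U \<Otimes>\<^sub>M PiM I (\<lambda>_. borel \<Otimes>\<^sub>M W) \<Otimes>\<^sub>M V"
    using assms by (intro measurable_Pair measurable_restrict) auto
  from measurable_compose[OF this assms(1)[unfolded measurable_procedure_def]]
  show ?thesis by simp
qed

text \<open>Data and seed are maps on an arbitrary space, and fitted functions are evaluated at
  observations only. Every claim is then the measurability of a real-valued map, and no measurable
  structure on a function space is involved.\<close>

locale pcm_data =
  fixes M :: "'a measure" and U :: "'u measure" and MX :: "'x measure" and d n :: nat
    and R :: "('u, 'x) pcm_methods" and D :: "'a \<Rightarrow> nat \<Rightarrow> 'x obs" and u :: "'a \<Rightarrow> 'u"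
  assumes methods: "measurable_methods U MX d n R"
    and D_meas: "\<And>i. i \<in> I1 n \<union> I2 n \<Longrightarrow> (\<lambda>\<omega>. D \<omega> i) \<in> M \<rightarrow>\<^sub>M obs_space MX d"
    and u_meas: "u \<in> M \<rightarrow>\<^sub>M U"
begin

lemma Y_meas: "i \<in> I1 n \<union> I2 n \<Longrightarrow> (\<lambda>\<omega>. obsY (D \<omega> i)) \<in> borel_measurable M"
  and Z_meas: "i \<in> I1 n \<union> I2 n \<Longrightarrow> (\<lambda>\<omega>. obsZ (D \<omega> i)) \<in> M \<rightarrow>\<^sub>M rvec_space d"
  and XZ_meas: "i \<in> I1 n \<union> I2 n \<Longrightarrow> (\<lambda>\<omega>. obsXZ (D \<omega> i)) \<in> M \<rightarrow>\<^sub>M MX \<Otimes>\<^sub>M rvec_space d"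
  using measurable_compose[OF D_meas obsY_measurable] measurable_compose[OF D_meas obsZ_measurable]
    measurable_compose[OF D_meas obsXZ_measurable] by auto

lemma Zj_meas: "i \<in> I1 n \<union> I2 n \<Longrightarrow> j < d \<Longrightarrow> (\<lambda>\<omega>. obsZ (D \<omega> i) j) \<in> borel_measurable M"
  using measurable_compose[OF Z_meas rvec_component_measurable] by auto

lemma reg_g_procedure: "measurable_procedure U (I2 n) (MX \<Otimes>\<^sub>M rvec_space d) (MX \<Otimes>\<^sub>M rvec_space d) (reg_g R)"
  and z_part_procedure: "measurable_procedure U (I2 n) (MX \<Otimes>\<^sub>M rvec_space d) (rvec_space d) (z_part R)"
  and reg_m_procedure: "measurable_procedure U (I2 n) (rvec_space d) (rvec_space d) (reg_m R)"
  and reg_v_procedure: "measurable_procedure U (I2 n) (MX \<Otimes>\<^sub>M rvec_space d) (MX \<Otimes>\<^sub>M rvec_space d) (reg_v R)"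
  using methods by (simp_all add: measurable_methods_def)

lemma ghat_meas:
  assumes "i \<in> I1 n \<union> I2 n"
  shows "(\<lambda>\<omega>. ghat R n (D \<omega>) (u \<omega>) (obsXZ (D \<omega> i))) \<in> borel_measurable M"
  unfolding ghat_def D2_YXZ_def
  by (rule measurable_procedureD[OF reg_g_procedure u_meas, where S = "\<lambda>\<omega> i. (obsY (D \<omega> i), obsXZ (D \<omega> i))"])
    (intro measurable_Pair Y_meas XZ_meas; use assms in simp)+

lemma gtilde_meas:
  assumes "i \<in> I1 n \<union> I2 n"
  shows "(\<lambda>\<omega>. gtilde R n (D \<omega>) (u \<omega>) (obsXZ (D \<omega> i))) \<in> borel_measurable M"
proof -
  have "(\<lambda>\<omega>. z_part R (u \<omega>) (D2_YXZ n (D \<omega>)) (obsZ (D \<omega> i))) \<in> borel_measurable M"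
    unfolding D2_YXZ_def
  by (rule measurable_procedureD[OF z_part_procedure u_meas, where S = "\<lambda>\<omega> i. (obsY (D \<omega> i), obsXZ (D \<omega> i))"])
    (intro measurable_Pair Y_meas XZ_meas Z_meas; use assms in simp)+
  then show ?thesis
    using ghat_meas[OF assms] by (simp add: gtilde_def obsXZ_def obsZ_def)
qed

lemma mtilde_meas:
  assumes "i \<in> I1 n \<union> I2 n"
  shows "(\<lambda>\<omega>. mtilde R n (D \<omega>) (u \<omega>) (obsZ (D \<omega> i))) \<in> borel_measurable M"
  unfolding mtilde_def
  by (rule measurable_procedureD[OF reg_m_procedure u_meas, where S = "\<lambda>\<omega> i. (gtilde R n (D \<omega>) (u \<omega>) (obsXZ (D \<omega> i)), obsZ (D \<omega> i))"])
    (intro measurable_Pair gtilde_meas Z_meas; use assms in simp)+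

lemma htilde_meas:
  assumes "i \<in> I1 n \<union> I2 n"
  shows "(\<lambda>\<omega>. htilde R n (D \<omega>) (u \<omega>) (obsXZ (D \<omega> i))) \<in> borel_measurable M"
  using borel_measurable_diff[OF gtilde_meas[OF assms] mtilde_meas[OF assms]]
  by (simp add: htilde_def obsXZ_def obsZ_def)

lemma rhohat_meas: "(\<lambda>\<omega>. rhohat R n (D \<omega>) (u \<omega>)) \<in> borel_measurable M"
  unfolding rhohat_def
  by (intro borel_measurable_times borel_measurable_const borel_measurable_sum borel_measurable_diff
      borel_measurable_add Y_meas ghat_meas gtilde_meas mtilde_meas htilde_meas) auto

lemma vtilde_meas:
  assumes "i \<in> I1 n \<union> I2 n"
  shows "(\<lambda>\<omega>. vtilde R n (D \<omega>) (u \<omega>) (obsXZ (D \<omega> i))) \<in> borel_measurable M"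
  unfolding vtilde_def
  by (rule measurable_procedureD[OF reg_v_procedure u_meas, where S = "\<lambda>\<omega> i. ((obsY (D \<omega> i) - ghat R n (D \<omega>) (u \<omega>) (obsXZ (D \<omega> i)))\<^sup>2, obsXZ (D \<omega> i))"])
    (intro measurable_Pair XZ_meas borel_measurable_power borel_measurable_diff Y_meas ghat_meas; use assms in simp)+

lemma chat_meas: "(\<lambda>\<omega>. chat R n (D \<omega>) (u \<omega>)) \<in> borel_measurable M"
proof (rule borel_measurableI_le)
  fix c
  show "{\<omega> \<in> space M. chat R n (D \<omega>) (u \<omega>) \<le> c} \<in> sets M"
  proof (cases "0 \<le> c")
    case True
    have "(\<lambda>\<omega>. acrit R n (D \<omega>) (u \<omega>) c) \<in> borel_measurable M"
      unfolding acrit_def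
      by (intro borel_measurable_divide_ennreal borel_measurable_sum borel_measurable_const measurable_compose[OF _ measurable_ennreal]
        borel_measurable_power borel_measurable_diff borel_measurable_add borel_measurable_max Y_meas ghat_meas vtilde_meas) auto
    then show ?thesis unfolding chat_le_iff[OF True] by measurable
  next
    case False
    then have "\<not> chat R n (D \<omega>) (u \<omega>) \<le> c" for \<omega> using chat_nonneg[of R n "D \<omega>" "u \<omega>"] by linarith
    then show ?thesis by simp
  qed
qed

lemma fhat_meas:
  assumes "i \<in> I1 n \<union> I2 n"
  shows "(\<lambda>\<omega>. fhat R n (D \<omega>) (u \<omega>) (obsXZ (D \<omega> i))) \<in> borel_measurable M"
  unfolding fhat_def hhat_def vhat_def using assms
  by (intro borel_measurable_divide borel_measurable_times borel_measurable_add borel_measurable_max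
      borel_measurable_const chat_meas vtilde_meas htilde_meas measurable_compose[OF rhohat_meas borel_measurable_sgn]) auto

lemma gammahat_meas: "j < d \<Longrightarrow> (\<lambda>\<omega>. gammahat d n (D \<omega>) j) \<in> borel_measurable M"
  unfolding gammahat_def
  by (rule ols_coef_measurable) (auto simp: D1_YZ_def I1_def intro!: Y_meas Zj_meas)

lemma dotp_meas:
  assumes "\<And>j. j < d \<Longrightarrow> (\<lambda>\<omega>. b \<omega> j) \<in> borel_measurable M" "\<And>j. j < d \<Longrightarrow> (\<lambda>\<omega>. z \<omega> j) \<in> borel_measurable M"
  shows "(\<lambda>\<omega>. dotp d (b \<omega>) (z \<omega>)) \<in> borel_measurable M"
  unfolding dotp_def using assms by (intro borel_measurable_sum borel_measurable_times) auto

lemma mhat_meas: "i \<in> I1 n \<Longrightarrow> (\<lambda>\<omega>. mhat_ols d n (D \<omega>) (obsZ (D \<omega> i))) \<in> borel_measurable M"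
  unfolding mhat_ols_def by (intro dotp_meas gammahat_meas Zj_meas) auto

lemma mfhat_meas: "i \<in> I1 n \<Longrightarrow> (\<lambda>\<omega>. mfhat_ols R d n (D \<omega>) (u \<omega>) (obsZ (D \<omega> i))) \<in> borel_measurable M"
  unfolding mfhat_ols_def
  by (intro dotp_meas Zj_meas ols_coef_measurable) (auto simp: D1_fZ_def I1_def intro!: fhat_meas Zj_meas)

lemma pcm_u_meas: "i \<in> I1 n \<Longrightarrow> (\<lambda>\<omega>. pcm_u R d n (D \<omega>) (u \<omega>) i) \<in> borel_measurable M"
  unfolding pcm_u_def by (intro borel_measurable_diff fhat_meas mfhat_meas) auto

lemma pcm_upsilon_meas: "i \<in> I1 n \<Longrightarrow> (\<lambda>\<omega>. pcm_upsilon R d n (D \<omega>) (u \<omega>) i) \<in> borel_measurable M"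
  unfolding pcm_upsilon_def
  by (intro borel_measurable_divide pcm_u_meas measurable_compose[OF _ borel_measurable_sqrt]
      borel_measurable_sum borel_measurable_power) auto

lemma pcm_T_meas: "(\<lambda>\<omega>. pcm_T R d n (D \<omega>) (u \<omega>)) \<in> borel_measurable M"
proof -
  have [measurable]: "(\<lambda>\<omega>. pcm_L R d n (D \<omega>) (u \<omega>) i) \<in> borel_measurable M" if "i \<in> I1 n" for i
    unfolding pcm_L_def using that
    by (intro borel_measurable_diff borel_measurable_times Y_meas mhat_meas fhat_meas mfhat_meas) auto
  show ?thesis unfolding pcm_T_def by measurable
qed

lemma norm_inf_meas: "i \<in> I1 n \<Longrightarrow> (\<lambda>\<omega>. norm_inf d (obsZ (D \<omega> i))) \<in> borel_measurable M"
  unfolding norm_inf_def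
  by (intro borel_measurable_Max borel_measurable_abs Zj_meas) auto

lemma coef_error_meas:
  "(\<lambda>\<omega>. Max ((\<lambda>i. norm_inf d (obsZ (D \<omega> i))) ` I1 n) * norm_1 d (\<lambda>j. gammahat d n (D \<omega>) j - g j)) \<in> borel_measurable M"
  unfolding norm_1_def
  by (intro borel_measurable_times borel_measurable_Max norm_inf_meas borel_measurable_sum
      borel_measurable_abs borel_measurable_diff gammahat_meas borel_measurable_const)
    (auto simp: I1_def)

end

section \<open>Conditional moments of the noise\<close>

text \<open>Two observations agree in (X, Z) exactly when they agree after erasure, so sigma (X, Z)
  can be handled through invariance under this map. The value 0 is an arbitrary placeholder.\<close>

definition erase_Y :: "'x obs \<Rightarrow> 'x obs" where
  "erase_Y w = (fst w, 0, snd (snd w))"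

lemma obsXZ_erase_Y [simp]: "obsXZ (erase_Y w) = obsXZ w"
  and obsZ_erase_Y [simp]: "obsZ (erase_Y w) = obsZ w"
  by (simp_all add: obsXZ_def obsZ_def erase_Y_def)

text \<open>Singletons are closed, so each level set of f is the preimage of a set under g. Applied
  to a version of a conditional expectation, this gives invariance under erasure everywhere and not
  just almost everywhere.\<close>

lemma measurable_vimage_algebra_const_on_fibres:
  fixes f :: "'a \<Rightarrow> 'b::t1_space"
  assumes f: "f \<in> borel_measurable (vimage_algebra X g N)" and g: "g \<in> X \<rightarrow> space N"
    and xy: "x \<in> X" "y \<in> X" "g x = g y"
  shows "f x = f y"
proof -
  have "f -` {f x} \<inter> space (vimage_algebra X g N) \<in> sets (vimage_algebra X g N)"
    using f by (rule measurable_sets) (simp add: borel_closed)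
  then obtain A where "f -` {f x} \<inter> X = g -` A \<inter> X"
    unfolding sets_vimage_algebra2[OF g] by auto
  then have A: "f z = f x \<longleftrightarrow> g z \<in> A" if "z \<in> X" for z using that by blast
  show ?thesis using A[OF xy(1)] A[OF xy(2)] xy(3) by simp
qed

lemma powr_le_1_plus_powr:
  fixes x a b :: real
  assumes "0 \<le> x" "0 \<le> a" "a \<le> b"
  shows "x powr a \<le> 1 + x powr b"
proof (cases "x \<le> 1")
  case True
  then have "x powr a \<le> 1" using assms by (intro powr_le1) auto
  then show ?thesis using powr_ge_zero[of x b] by linarith
next
  case False
  then have "x powr a \<le> x powr b" using assms by (intro powr_mono) auto
  then show ?thesis by simp
qed

text \<open>Links the two conditional expectations in use: the real one, with its rule for
  integrating against measurable factors, and the extended one, in which the moment bounds are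
  stated.\<close>

lemma (in sigma_finite_subalgebra) real_cond_exp_nonneg_eq:
  assumes "\<And>x. 0 \<le> f x"
  shows "AE x in M. real_cond_exp M F f x = enn2real (nn_cond_exp M F (\<lambda>x. ennreal (f x)) x)"
proof -
  have "AE x in M. 0 = nn_cond_exp M F (\<lambda>x. 0) x" by (rule nn_cond_exp_F_meas) simp
  moreover have "(\<lambda>x. ennreal (- f x)) = (\<lambda>x. 0)" using assms by (auto simp: ennreal_neg)
  ultimately show ?thesis unfolding real_cond_exp_def by (auto elim!: eventually_mono)
qed

locale regression_model = prob_space P for P :: "'x obs measure" +
  fixes MX :: "'x measure" and d :: nat and \<gamma> :: rvec and \<delta> c C :: real
  assumes sets_P: "sets P = sets (obs_space MX d)"
    and model: "linear_model MX d P \<gamma>"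
    and moments: "noise_moments MX d P \<gamma> \<delta> c C"
    and pos: "0 < \<delta>" "0 < c" "0 < C"
begin

abbreviation "F \<equiv> sigma_XZ MX d"
abbreviation "\<epsilon> \<equiv> noise d \<gamma>"

text \<open>Truncated at 1 because the Taylor remainder of the complex exponential gains no more
  than one power beyond the second.\<close>

definition \<eta> :: real where "\<eta> = min \<delta> 1"

lemma \<eta>: "0 < \<eta>" "\<eta> \<le> 1" "\<eta> \<le> \<delta>"
  using pos by (auto simp: \<eta>_def)

lemma space_P: "space P = space (obs_space MX d)"
  by (rule sets_eq_imp_space_eq[OF sets_P])

lemma space_F: "space F = space P"
  by (simp add: sigma_XZ_def space_P)

lemma obsXZ_space: "obsXZ \<in> space (obs_space MX d) \<rightarrow> space (MX \<Otimes>\<^sub>M rvec_space d)"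
  using measurable_space[OF obsXZ_measurable] by auto

lemma subalg_F: "subalgebra P F"
proof -
  have "sets F \<subseteq> sets P"
    unfolding sigma_XZ_def sets_vimage_algebra2[OF obsXZ_space] sets_P
    using measurable_sets[OF obsXZ_measurable[of MX d]] by auto
  then show ?thesis by (simp add: subalgebra_def space_F)
qed

sublocale finite_measure_subalgebra P F
  by unfold_locales (rule subalg_F)

lemma measurable_P: "measurable P N = measurable (obs_space MX d) N"
  by (rule measurable_cong_sets[OF sets_P refl])

lemma erase_Y_F: "erase_Y \<in> F \<rightarrow>\<^sub>M P"
proof -
  have "(\<lambda>p. (fst p, 0, snd p)) \<in> MX \<Otimes>\<^sub>M rvec_space d \<rightarrow>\<^sub>M obs_space MX d"
    unfolding obs_space_def by measurable
  then have "(\<lambda>w. (fst (obsXZ w), 0, snd (obsXZ w))) \<in> F \<rightarrow>\<^sub>M obs_space MX d"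
    unfolding sigma_XZ_def by (rule measurable_compose[OF measurable_vimage_algebra1[OF obsXZ_space]])
  then show ?thesis
    by (simp add: erase_Y_def[abs_def] obsXZ_def measurable_cong_sets[OF refl sets_P])
qed

lemma erase_Y_P: "erase_Y \<in> P \<rightarrow>\<^sub>M P"
  using measurable_from_subalg[OF subalg_F erase_Y_F] .

lemma erase_Y_space: "w \<in> space P \<Longrightarrow> erase_Y w \<in> space P"
  using measurable_space[OF erase_Y_P] .

text \<open>An invariant function equals its composition with \<open>erase_Y\<close>, and
  \<open>erase_Y\<close> factors through (X, Z).\<close>

lemma invariant_measurable_F:
  fixes h :: "'x obs \<Rightarrow> real"
  assumes "h \<in> borel_measurable P" "\<And>w. w \<in> space P \<Longrightarrow> h (erase_Y w) = h w"
  shows "h \<in> borel_measurable F"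
proof -
  have "(\<lambda>w. h (erase_Y w)) \<in> borel_measurable F" by (rule measurable_compose[OF erase_Y_F assms(1)])
  then show ?thesis using assms(2) by (subst measurable_cong[of F _ "\<lambda>w. h (erase_Y w)"]) (auto simp: space_F)
qed

lemma noise_measurable [measurable]: "\<epsilon> \<in> borel_measurable P"
proof -
  have "(\<lambda>w. obsZ w j) \<in> borel_measurable (obs_space MX d)" if "j < d" for j
    using measurable_compose[OF obsZ_measurable rvec_component_measurable[OF that]] .
  then show ?thesis
    unfolding measurable_P noise_def[abs_def] dotp_def
    by (intro borel_measurable_diff obsY_measurable borel_measurable_sum borel_measurable_times) auto
qed

lemma noise_integrable: "integrable P \<epsilon>"
  using model by (simp add: linear_model_def)

lemma conditional_mean:
  assumes h: "h \<in> borel_measurable P" "\<And>w. w \<in> space P \<Longrightarrow> \<bar>h w\<bar> \<le> B"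
    "\<And>w. w \<in> space P \<Longrightarrow> h (erase_Y w) = h w"
  shows "(\<integral>w. h w * \<epsilon> w \<partial>P) = 0"
proof -
  have "(\<integral>w. h w * \<epsilon> w \<partial>P) = (\<integral>w. h w * real_cond_exp P F \<epsilon> w \<partial>P)"
    using integrable_mult_bounded[OF noise_integrable h(1,2)] invariant_measurable_F[OF h(1,3)]
    by (intro real_cond_exp_intg(2)[symmetric]) auto
  also have "\<dots> = (\<integral>w. 0 \<partial>P)"
  proof (rule integral_cong_AE)
    show "(\<lambda>w. h w * real_cond_exp P F \<epsilon> w) \<in> borel_measurable P" using h(1) by measurable
    have "AE w in P. real_cond_exp P F \<epsilon> w = 0" using model by (simp add: linear_model_def)
    then show "AE w in P. h w * real_cond_exp P F \<epsilon> w = 0" by (auto elim!: eventually_mono)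
  qed simp
  finally show ?thesis by simp
qed

text \<open>Treats the orders 2 and 2 + \<eta> at once, both powers being at most 1 plus the power
  of order 2 + \<delta>. This is the origin of the constant \<open>1 + C\<close>.\<close>

lemma dominated_moment:
  fixes f :: "'x obs \<Rightarrow> real"
  assumes [measurable]: "f \<in> borel_measurable P"
    and f: "\<And>w. 0 \<le> f w" "\<And>w. f w \<le> 1 + \<bar>\<epsilon> w\<bar> powr (2 + \<delta>)"
  shows "AE w in P. nn_cond_exp P F (\<lambda>w. ennreal (f w)) w \<le> ennreal (1 + C)" "integrable P f"
    "\<And>h B. h \<in> borel_measurable P \<Longrightarrow> (\<And>w. w \<in> space P \<Longrightarrow> \<bar>h w\<bar> \<le> B) \<Longrightarrow>
      (\<And>w. w \<in> space P \<Longrightarrow> h (erase_Y w) = h w) \<Longrightarrow>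
      (\<integral>w. h w * f w \<partial>P) = (\<integral>w. h w * enn2real (nn_cond_exp P F (\<lambda>w. ennreal (f w)) w) \<partial>P)"
proof -
  let ?g = "\<lambda>w. ennreal (\<bar>\<epsilon> w\<bar> powr (2 + \<delta>))"
  let ?N = "nn_cond_exp P F (\<lambda>w. ennreal (f w))"
  have "AE w in P. ?N w \<le> nn_cond_exp P F (\<lambda>w. 1 + ?g w) w"
  proof (rule nn_cond_exp_mono)
    have "ennreal (f w) \<le> 1 + ?g w" for w
      using f(2)[of w] by (simp flip: ennreal_1 ennreal_plus add: ennreal_leI)
    then show "AE w in P. ennreal (f w) \<le> 1 + ?g w" by simp
  qed measurable
  moreover have "AE w in P. nn_cond_exp P F (\<lambda>_. 1) w + nn_cond_exp P F ?g w = nn_cond_exp P F (\<lambda>w. 1 + ?g w) w"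
    by (rule nn_cond_exp_sum) measurable
  moreover have "AE w in P. 1 = nn_cond_exp P F (\<lambda>_. 1) w" by (rule nn_cond_exp_F_meas) simp
  moreover have "AE w in P. nn_cond_exp P F ?g w \<le> ennreal C" using moments by (simp add: noise_moments_def)
  ultimately show AE: "AE w in P. ?N w \<le> ennreal (1 + C)"
  proof eventually_elim
    case (elim w)
    have "?N w \<le> 1 + nn_cond_exp P F ?g w" using elim by metis
    also have "\<dots> \<le> 1 + ennreal C" using elim(4) by (rule add_left_mono)
    finally show ?case using pos by simp
  qed
  have "(\<integral>\<^sup>+w. ennreal (f w) \<partial>P) = (\<integral>\<^sup>+w. 1 * ?N w \<partial>P)"
    by (subst nn_cond_exp_intg) auto
  also have "\<dots> \<le> (\<integral>\<^sup>+w. ennreal (1 + C) \<partial>P)" using AE by (intro nn_integral_mono_AE) auto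
  also have "\<dots> < \<infinity>" by (simp add: emeasure_space_1 ennreal_mult_less_top)
  finally show int: "integrable P f" using f(1) by (intro integrableI_nonneg) auto
  fix h :: "'x obs \<Rightarrow> real" and B
  assume h: "h \<in> borel_measurable P" "\<And>w. w \<in> space P \<Longrightarrow> \<bar>h w\<bar> \<le> B"
    "\<And>w. w \<in> space P \<Longrightarrow> h (erase_Y w) = h w"
  have "(\<integral>w. h w * f w \<partial>P) = (\<integral>w. h w * real_cond_exp P F f w \<partial>P)"
    using integrable_mult_bounded[OF int h(1,2)] invariant_measurable_F[OF h(1,3)]
    by (intro real_cond_exp_intg(2)[symmetric]) auto
  also have "\<dots> = (\<integral>w. h w * enn2real (?N w) \<partial>P)"
  proof (rule integral_cong_AE)
    show "(\<lambda>w. h w * real_cond_exp P F f w) \<in> borel_measurable P" using h(1) by measurable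
    show "(\<lambda>w. h w * enn2real (?N w)) \<in> borel_measurable P" using h(1) by measurable
    show "AE w in P. h w * real_cond_exp P F f w = h w * enn2real (?N w)"
      using real_cond_exp_nonneg_eq[of f, OF f(1)] by (auto elim!: eventually_mono)
  qed
  finally show "(\<integral>w. h w * f w \<partial>P) = (\<integral>w. h w * enn2real (?N w) \<partial>P)" .
qed

lemma abs_powr_2: "\<bar>x\<bar> powr 2 = x\<^sup>2" for x :: real
  by (cases "x = 0") (simp_all add: powr_numeral)

lemma noise_sq_dominated: "(\<epsilon> w)\<^sup>2 \<le> 1 + \<bar>\<epsilon> w\<bar> powr (2 + \<delta>)"
  using powr_le_1_plus_powr[of "\<bar>\<epsilon> w\<bar>" 2 "2 + \<delta>"] pos by (simp add: abs_powr_2)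

lemma noise_powr_dominated: "\<bar>\<epsilon> w\<bar> powr (2 + \<eta>) \<le> 1 + \<bar>\<epsilon> w\<bar> powr (2 + \<delta>)"
  using powr_le_1_plus_powr[of "\<bar>\<epsilon> w\<bar>" "2 + \<eta>" "2 + \<delta>"] \<eta> by simp

lemma noise_sq_integrable: "integrable P (\<lambda>w. (\<epsilon> w)\<^sup>2)"
  and noise_powr_integrable: "integrable P (\<lambda>w. \<bar>\<epsilon> w\<bar> powr (2 + \<eta>))"
  using dominated_moment(2)[of "\<lambda>w. (\<epsilon> w)\<^sup>2"] dominated_moment(2)[of "\<lambda>w. \<bar>\<epsilon> w\<bar> powr (2 + \<eta>)"]
    noise_sq_dominated noise_powr_dominated by auto

text \<open>Clipping makes the bounds hold everywhere and not just almost everywhere.\<close>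

definition cvar :: "'x obs \<Rightarrow> real" where
  "cvar w = max c (min (1 + C) (enn2real (nn_cond_exp P F (\<lambda>w. ennreal ((\<epsilon> w)\<^sup>2)) w)))"

lemma cvar_F: "cvar \<in> borel_measurable F"
  unfolding cvar_def[abs_def] by measurable

lemma cvar_P [measurable]: "cvar \<in> borel_measurable P"
  by (rule measurable_from_subalg[OF subalg_F cvar_F])

lemma cvar_erase_Y: "cvar (erase_Y w) = cvar w" if "w \<in> space P"
proof (rule measurable_vimage_algebra_const_on_fibres[where f = cvar and x = "erase_Y w" and y = w])
  show "cvar \<in> borel_measurable (vimage_algebra (space (obs_space MX d)) obsXZ (MX \<Otimes>\<^sub>M rvec_space d))"
    using cvar_F by (simp add: sigma_XZ_def)
qed (use that erase_Y_space obsXZ_space in \<open>auto simp: space_P\<close>)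

lemma cond_var_bounds:
  "AE w in P. c \<le> enn2real (nn_cond_exp P F (\<lambda>w. ennreal ((\<epsilon> w)\<^sup>2)) w)
     \<and> enn2real (nn_cond_exp P F (\<lambda>w. ennreal ((\<epsilon> w)\<^sup>2)) w) \<le> 1 + C"
proof -
  let ?N = "nn_cond_exp P F (\<lambda>w. ennreal ((\<epsilon> w)\<^sup>2))"
  have "AE w in P. ?N w \<le> ennreal (1 + C)"
    using noise_sq_dominated by (intro dominated_moment) auto
  moreover have "AE w in P. ennreal c \<le> ?N w" using moments by (simp add: noise_moments_def)
  ultimately show ?thesis
  proof eventually_elim
    case (elim w)
    then have "?N w < \<infinity>" by (simp add: le_less_trans)
    then obtain r where r: "0 \<le> r" "?N w = ennreal r" by (cases "?N w") auto
    have "r \<le> 1 + C" using elim(1) pos unfolding r(2) by (subst (asm) ennreal_le_iff) auto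
    moreover have "c \<le> r" using elim(2) r(1) unfolding r(2) by (subst (asm) ennreal_le_iff) auto
    ultimately show ?case using r by simp
  qed
qed

text \<open>An almost sure inequality between constants holds outright on a probability space. It
  makes the clipping in \<open>cvar\<close> consistent: the outer maximum with c does not overshoot
  \<open>1 + C\<close>.\<close>

lemma c_le: "c \<le> 1 + C"
proof -
  have "AE w in P. c \<le> 1 + C" using cond_var_bounds by eventually_elim linarith
  then show ?thesis by simp
qed

lemma cvar_bounds: "c \<le> cvar w" "cvar w \<le> 1 + C"
  using c_le by (auto simp: cvar_def)

lemma conditional_variance:
  assumes h: "h \<in> borel_measurable P" "\<And>w. w \<in> space P \<Longrightarrow> \<bar>h w\<bar> \<le> B"
    "\<And>w. w \<in> space P \<Longrightarrow> h (erase_Y w) = h w"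
  shows "(\<integral>w. h w * (\<epsilon> w)\<^sup>2 \<partial>P) = (\<integral>w. h w * cvar w \<partial>P)"
proof -
  have "(\<integral>w. h w * (\<epsilon> w)\<^sup>2 \<partial>P) = (\<integral>w. h w * enn2real (nn_cond_exp P F (\<lambda>w. ennreal ((\<epsilon> w)\<^sup>2)) w) \<partial>P)"
    using noise_sq_dominated by (intro dominated_moment(3)[OF _ _ _ h]) auto
  also have "\<dots> = (\<integral>w. h w * cvar w \<partial>P)"
  proof (rule integral_cong_AE)
    show "AE w in P. h w * enn2real (nn_cond_exp P F (\<lambda>w. ennreal ((\<epsilon> w)\<^sup>2)) w) = h w * cvar w"
      using cond_var_bounds by eventually_elim (auto simp: cvar_def)
  qed (use h(1) in measurable)
  finally show ?thesis .
qed

lemma conditional_moment: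
  assumes h: "h \<in> borel_measurable P" "\<And>w. w \<in> space P \<Longrightarrow> 0 \<le> h w \<and> h w \<le> B"
    "\<And>w. w \<in> space P \<Longrightarrow> h (erase_Y w) = h w"
  shows "(\<integral>w. h w * \<bar>\<epsilon> w\<bar> powr (2 + \<eta>) \<partial>P) \<le> (\<integral>w. h w * (1 + C) \<partial>P)"
proof -
  let ?f = "\<lambda>w. \<bar>\<epsilon> w\<bar> powr (2 + \<eta>)"
  let ?N = "nn_cond_exp P F (\<lambda>w. ennreal (?f w))"
  have hB: "\<bar>h w\<bar> \<le> B" if "w \<in> space P" for w using h(2)[OF that] by auto
  have f: "?f \<in> borel_measurable P" by measurable
  have eq: "(\<integral>w. h w * ?f w \<partial>P) = (\<integral>w. h w * enn2real (?N w) \<partial>P)"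
    by (rule dominated_moment(3)[OF f _ noise_powr_dominated h(1) hB h(3)]) auto
  have "AE w in P. ?N w \<le> ennreal (1 + C)"
    by (rule dominated_moment(1)[OF f _ noise_powr_dominated]) auto
  then have N: "AE w in P. enn2real (?N w) \<le> 1 + C"
    using pos by (auto elim!: eventually_mono intro: enn2real_leI)
  show ?thesis unfolding eq
  proof (rule integral_mono_AE)
    \<comment> \<open>The bound on the conditional expectation holds only almost surely, so
      integrability is shown for a truncated version and carried over.\<close>
    have "integrable P (\<lambda>w. min (1 + C) (enn2real (?N w)))"
      using pos by (intro integrable_const_bound[where B = "1 + C"]) (auto simp: min_def)
    then have "integrable P (\<lambda>w. h w * min (1 + C) (enn2real (?N w)))"
      by (rule integrable_mult_bounded[OF _ h(1) hB])
    then show "integrable P (\<lambda>w. h w * enn2real (?N w))"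
    proof (rule integrable_cong_AE_imp)
      show "(\<lambda>w. h w * enn2real (?N w)) \<in> borel_measurable P" using h(1) by measurable
      show "AE w in P. h w * min (1 + C) (enn2real (?N w)) = h w * enn2real (?N w)"
        using N by eventually_elim simp
    qed
    show "integrable P (\<lambda>w. h w * (1 + C))"
      by (rule integrable_mult_bounded[OF _ h(1) hB]) simp
    show "AE w in P. h w * enn2real (?N w) \<le> h w * (1 + C)"
      using N AE_space by eventually_elim (use h(2) in \<open>auto intro: mult_left_mono\<close>)
  qed
qed

end

text \<open>Fubini with coordinate j drawn separately: the product measure is the image of P times
  the remaining product under inserting that coordinate. A statement about signs serves identities
  and inequalities alike, since an identity follows from applying it to a function and to its
  negative.\<close>

lemma integral_resample_nonneg:
  fixes G :: "('i \<Rightarrow> 'b) \<times> 'u \<Rightarrow> real"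
  assumes P: "prob_space P" and U: "prob_space U" and j: "j \<in> J"
    and G: "integrable (PiM J (\<lambda>_. P) \<Otimes>\<^sub>M U) G"
    and nonneg: "\<And>D u. D \<in> space (PiM (J - {j}) (\<lambda>_. P)) \<Longrightarrow> u \<in> space U \<Longrightarrow> 0 \<le> (\<integral>w. G (D(j := w), u) \<partial>P)"
  shows "0 \<le> (\<integral>\<omega>. G \<omega> \<partial>(PiM J (\<lambda>_. P) \<Otimes>\<^sub>M U))"
proof -
  let ?J = "PiM J (\<lambda>_. P)" and ?Q = "PiM (J - {j}) (\<lambda>_. P)"
  let ?R = "P \<Otimes>\<^sub>M ?Q" and ?f = "\<lambda>(x, X). X(j := x)"
  interpret P: prob_space P by fact
  interpret U: prob_space U by fact
  interpret Q: prob_space ?Q by (intro prob_space_PiM P)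
  interpret PQ: pair_prob_space P ?Q ..
  interpret RU: pair_prob_space ?R U ..
  have J: "insert j (J - {j}) = J" using j by auto
  have f[measurable]: "?f \<in> ?R \<rightarrow>\<^sub>M ?J"
  proof -
    have "(\<lambda>x. (snd x)(j := fst x)) \<in> ?R \<rightarrow>\<^sub>M ?J"
      by (rule measurable_fun_upd[where J = "J - {j}"]) (use j in auto)
    then show ?thesis by (simp add: case_prod_beta')
  qed
  have J_eq: "distr ?R ?J ?f = ?J"
    using distr_pair_PiM_eq_PiM[of "J - {j}" "\<lambda>_. P" j] P unfolding J by simp
  let ?g = "\<lambda>(x, y). (?f x, y)"
  have g: "?g \<in> ?R \<Otimes>\<^sub>M U \<rightarrow>\<^sub>M ?J \<Otimes>\<^sub>M U" by measurable
  have E: "?J \<Otimes>\<^sub>M U = distr (?R \<Otimes>\<^sub>M U) (?J \<Otimes>\<^sub>M U) ?g"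
  proof -
    have "distr ?R ?J ?f \<Otimes>\<^sub>M distr U U (\<lambda>x. x) = distr (?R \<Otimes>\<^sub>M U) (?J \<Otimes>\<^sub>M U) (\<lambda>(x, y). (?f x, y))"
      by (rule pair_measure_distr) (simp_all add: f distr_id2 U.sigma_finite_measure_axioms)
    then show ?thesis unfolding J_eq by (simp add: distr_id2)
  qed
  have G_meas: "G \<in> borel_measurable (?J \<Otimes>\<^sub>M U)" using G by auto
  have int: "integrable (?R \<Otimes>\<^sub>M U) (\<lambda>x. G (?g x))"
  proof -
    have "integrable (distr (?R \<Otimes>\<^sub>M U) (?J \<Otimes>\<^sub>M U) ?g) G" using G by (simp only: E[symmetric])
    then show ?thesis using integrable_distr_eq[OF g G_meas] by simp
  qed
  then have int': "integrable (?R \<Otimes>\<^sub>M U) (\<lambda>(x, y). G (?f x, y))" by (simp add: case_prod_beta')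
  have "(\<integral>\<omega>. G \<omega> \<partial>(?J \<Otimes>\<^sub>M U)) = (\<integral>x. G (?g x) \<partial>(?R \<Otimes>\<^sub>M U))"
    using integral_distr[OF g G_meas] by (simp only: E[symmetric])
  also have "\<dots> = (\<integral>u. (\<integral>x. G (?f x, u) \<partial>?R) \<partial>U)"
    by (subst RU.integral_snd[OF int']) (simp add: case_prod_beta')
  also have "\<dots> \<ge> 0"
  proof (rule integral_nonneg_AE)
    have "AE u in U. integrable ?R (\<lambda>x. G (?f x, u))" using RU.AE_integrable_snd[OF int'] .
    then show "AE u in U. 0 \<le> (\<integral>x. G (?f x, u) \<partial>?R)"
      using AE_space
    proof eventually_elim
      case (elim u)
      then have i: "integrable ?R (\<lambda>(w, D). G (D(j := w), u))" by (simp add: case_prod_beta')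
      have "(\<integral>x. G (?f x, u) \<partial>?R) = (\<integral>D. (\<integral>w. G (D(j := w), u) \<partial>P) \<partial>?Q)"
        by (subst PQ.integral_snd[OF i]) (simp add: case_prod_beta')
      also have "\<dots> \<ge> 0" using nonneg elim(2) by (intro integral_nonneg_AE) (auto intro: AE_I2)
      finally show ?case .
    qed
  qed
  finally show ?thesis .
qed

section \<open>Invariance of the weights under erasing a response\<close>

definition erase_response :: "nat \<Rightarrow> (nat \<Rightarrow> 'x obs) \<times> 'u \<Rightarrow> (nat \<Rightarrow> 'x obs) \<times> 'u" where
  "erase_response j = (\<lambda>(D, u). (D(j := erase_Y (D j)), u))"

lemma I1_I2_disjoint: "i \<in> I1 n \<Longrightarrow> i \<notin> I2 n"
  by (auto simp: I1_def I2_def)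

text \<open>Sample splitting: every ingredient of \<open>fhat\<close> is a function of the second
  subsample and the seed.\<close>

lemma fhat_cong:
  assumes "\<And>i. i \<in> I2 n \<Longrightarrow> D i = D' i"
  shows "fhat R n D u = fhat R n D' u"
proof -
  have D2: "D2_YXZ n D = D2_YXZ n D'"
    unfolding D2_YXZ_def using assms by (intro restrict_ext) auto
  have g: "ghat R n D u = ghat R n D' u" by (simp add: ghat_def D2)
  have gt: "gtilde R n D u = gtilde R n D' u" by (simp add: gtilde_def g D2)
  have mt: "mtilde R n D u = mtilde R n D' u"
    unfolding mtilde_def gt using assms by (intro arg_cong[where f = "reg_m R u"] restrict_ext) auto
  have ht: "htilde R n D u = htilde R n D' u" by (simp add: htilde_def gt mt)
  have rho: "rhohat R n D u = rhohat R n D' u"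
    unfolding rhohat_def g gt mt ht using assms by (intro arg_cong[where f = "(*) (1 / real n)"] sum.cong) auto
  have vt: "vtilde R n D u = vtilde R n D' u"
    unfolding vtilde_def g using assms by (intro arg_cong[where f = "reg_v R u"] restrict_ext) auto
  have ac: "acrit R n D u = acrit R n D' u"
    unfolding acrit_def[abs_def] g vt using assms by (intro ext arg_cong[where f = "\<lambda>x. x / of_nat n"] sum.cong) auto
  have ch: "chat R n D u = chat R n D' u" by (simp add: chat_def ac)
  show ?thesis by (simp add: fhat_def hhat_def vhat_def rho ht vt ch)
qed

text \<open>First-subsample responses enter neither \<open>fhat\<close> nor its regression on Z;
  only \<open>gammahat\<close> uses them, and the weights do not involve it.\<close>

lemma pcm_upsilon_erase_response:
  assumes j: "j \<in> I1 n" and i: "i \<in> I1 n"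
  shows "pcm_upsilon R d n (D(j := erase_Y (D j))) u i = pcm_upsilon R d n D u i"
proof -
  let ?D = "D(j := erase_Y (D j))"
  have f: "fhat R n ?D u = fhat R n D u"
    using I1_I2_disjoint[OF j] by (intro fhat_cong) auto
  have XZ: "obsXZ (?D k) = obsXZ (D k)" "obsZ (?D k) = obsZ (D k)" for k by auto
  have m: "mfhat_ols R d n ?D u = mfhat_ols R d n D u"
    unfolding mfhat_ols_def D1_fZ_def f XZ ..
  have "pcm_u R d n ?D u k = pcm_u R d n D u k" for k
    unfolding pcm_u_def f m XZ ..
  then show ?thesis by (simp add: pcm_upsilon_def)
qed

text \<open>Division by zero gives 0, so the weights all vanish when the residuals do. A deviation
  of the sum from 1 is therefore the same as this degenerate event.\<close>

lemma sum_pcm_upsilon_sq: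
  "(\<Sum>i\<in>I1 n. (pcm_upsilon R d n D u i)\<^sup>2) = (if (\<Sum>k\<in>I1 n. (pcm_u R d n D u k)\<^sup>2) = 0 then 0 else 1)"
proof -
  define q where "q = (\<Sum>k\<in>I1 n. (pcm_u R d n D u k)\<^sup>2)"
  have q: "0 \<le> q" unfolding q_def by (rule sum_nonneg) simp
  have "(\<Sum>i\<in>I1 n. (pcm_upsilon R d n D u i)\<^sup>2) = (\<Sum>i\<in>I1 n. (pcm_u R d n D u i)\<^sup>2 / q)"
    unfolding pcm_upsilon_def q_def[symmetric] using q by (simp add: power_divide)
  also have "\<dots> = q / q" unfolding sum_divide_distrib[symmetric] q_def[symmetric] ..
  finally show ?thesis unfolding q_def[symmetric] by simp
qed

section \<open>The noise as a conditionally centred array\<close>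

context regression_model
begin

lemma
  assumes U: "prob_space U"
  shows prob_space_experiment: "prob_space (pcm_experiment U n P)"
    and observation_measurable: "i \<in> I1 n \<union> I2 n \<Longrightarrow> (\<lambda>\<omega>. fst \<omega> i) \<in> pcm_experiment U n P \<rightarrow>\<^sub>M P"
    and observation_distr: "i \<in> I1 n \<union> I2 n \<Longrightarrow> distr (pcm_experiment U n P) P (\<lambda>\<omega>. fst \<omega> i) = P"
proof -
  let ?J = "PiM (I1 n \<union> I2 n) (\<lambda>_. P)"
  interpret U: prob_space U by fact
  interpret J: prob_space ?J by (intro prob_space_PiM prob_space_axioms)
  show "prob_space (pcm_experiment U n P)"
    unfolding pcm_experiment_def by (rule prob_space_pair) unfold_locales
  assume i: "i \<in> I1 n \<union> I2 n"
  have i_meas: "(\<lambda>D. D i) \<in> ?J \<rightarrow>\<^sub>M P" using i by (rule measurable_component_singleton)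
  then show "(\<lambda>\<omega>. fst \<omega> i) \<in> pcm_experiment U n P \<rightarrow>\<^sub>M P"
    unfolding pcm_experiment_def by (rule measurable_compose[OF measurable_fst])
  have "distr (pcm_experiment U n P) P (\<lambda>\<omega>. fst \<omega> i) = distr (distr (?J \<Otimes>\<^sub>M U) ?J fst) P (\<lambda>D. D i)"
    unfolding pcm_experiment_def using i_meas by (subst distr_distr) (auto simp: comp_def)
  also have "\<dots> = P"
    unfolding U.distr_pair_fst by (rule distr_PiM_component[OF prob_space_axioms i])
  finally show "distr (pcm_experiment U n P) P (\<lambda>\<omega>. fst \<omega> i) = P" .
qed

lemma observation_integrable:
  fixes g :: "'x obs \<Rightarrow> real"
  assumes U: "prob_space U" and i: "i \<in> I1 n \<union> I2 n" and g: "integrable P g"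
  shows "integrable (pcm_experiment U n P) (\<lambda>\<omega>. g (fst \<omega> i))"
proof -
  have "integrable (distr (pcm_experiment U n P) P (\<lambda>\<omega>. fst \<omega> i)) g"
    unfolding observation_distr[OF U i] by (rule g)
  then show ?thesis
    using g by (subst (asm) integrable_distr_eq[OF observation_measurable[OF U i]]) auto
qed

text \<open>Freezing all data but observation j turns H into a function h of one observation, and
  \<open>Q\<close> hands the pointwise bound on H over to h. Two choices of \<open>Q\<close> occur:
  |x| <= B for the identities and 0 <= x <= B for the moment inequality.\<close>

lemma integral_lift_nonneg:
  fixes H :: "(nat \<Rightarrow> 'x obs) \<times> 'u \<Rightarrow> real"
  assumes U: "prob_space U" and j: "j \<in> I1 n \<union> I2 n" and g: "integrable P g"
    and H: "H \<in> borel_measurable (pcm_experiment U n P)"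
    and Q: "\<And>\<omega>. \<omega> \<in> space (pcm_experiment U n P) \<Longrightarrow> Q (H \<omega>)" and B: "\<And>x. Q x \<Longrightarrow> \<bar>x\<bar> \<le> B"
    and inv: "\<And>\<omega>. \<omega> \<in> space (pcm_experiment U n P) \<Longrightarrow> H (erase_response j \<omega>) = H \<omega>"
    and nonneg: "\<And>h. h \<in> borel_measurable P \<Longrightarrow> (\<And>w. w \<in> space P \<Longrightarrow> Q (h w)) \<Longrightarrow>
      (\<And>w. w \<in> space P \<Longrightarrow> h (erase_Y w) = h w) \<Longrightarrow> 0 \<le> (\<integral>w. h w * g w \<partial>P)"
  shows "0 \<le> (\<integral>\<omega>. H \<omega> * g (fst \<omega> j) \<partial>pcm_experiment U n P)"
  unfolding pcm_experiment_def
proof (rule integral_resample_nonneg[OF prob_space_axioms U j, where G = "\<lambda>\<omega>. H \<omega> * g (fst \<omega> j)"])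
  show "integrable (PiM (I1 n \<union> I2 n) (\<lambda>_. P) \<Otimes>\<^sub>M U) (\<lambda>\<omega>. H \<omega> * g (fst \<omega> j))"
    using integrable_mult_bounded[OF observation_integrable[OF U j g] H] Q B
    unfolding pcm_experiment_def by blast
  fix D u assume D: "D \<in> space (PiM (I1 n \<union> I2 n - {j}) (\<lambda>_. P))" and u: "u \<in> space U"
  have upd: "(\<lambda>w. (D(j := w), u)) \<in> P \<rightarrow>\<^sub>M pcm_experiment U n P"
    unfolding pcm_experiment_def
  proof (rule measurable_Pair)
    show "(\<lambda>w. D(j := w)) \<in> P \<rightarrow>\<^sub>M PiM (I1 n \<union> I2 n) (\<lambda>_. P)"
      by (rule measurable_fun_upd[where J = "I1 n \<union> I2 n - {j}"]) (use j D in auto)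
  qed (use u in simp)
  have space: "(D(j := w), u) \<in> space (pcm_experiment U n P)" if "w \<in> space P" for w
    using measurable_space[OF upd that] .
  have "0 \<le> (\<integral>w. H (D(j := w), u) * g w \<partial>P)"
  proof (rule nonneg)
    show "(\<lambda>w. H (D(j := w), u)) \<in> borel_measurable P" by (rule measurable_compose[OF upd H])
    show "Q (H (D(j := w), u))" if "w \<in> space P" for w using Q space[OF that] .
    show "H (D(j := erase_Y w), u) = H (D(j := w), u)" if "w \<in> space P" for w
      using inv[OF space[OF that]] by (simp add: erase_response_def)
  qed
  then show "0 \<le> (\<integral>w. H (D(j := w), u) * g (fst (D(j := w), u) j) \<partial>P)" by simp
qed

lemma integral_lift_zero:
  fixes H :: "(nat \<Rightarrow> 'x obs) \<times> 'u \<Rightarrow> real"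
  assumes U: "prob_space U" and j: "j \<in> I1 n \<union> I2 n" and g: "integrable P g"
    and H: "H \<in> borel_measurable (pcm_experiment U n P)"
    and B: "\<And>\<omega>. \<omega> \<in> space (pcm_experiment U n P) \<Longrightarrow> \<bar>H \<omega>\<bar> \<le> B"
    and inv: "\<And>\<omega>. \<omega> \<in> space (pcm_experiment U n P) \<Longrightarrow> H (erase_response j \<omega>) = H \<omega>"
    and zero: "\<And>h. h \<in> borel_measurable P \<Longrightarrow> (\<And>w. w \<in> space P \<Longrightarrow> \<bar>h w\<bar> \<le> B) \<Longrightarrow>
      (\<And>w. w \<in> space P \<Longrightarrow> h (erase_Y w) = h w) \<Longrightarrow> (\<integral>w. h w * g w \<partial>P) = 0"
  shows "(\<integral>\<omega>. H \<omega> * g (fst \<omega> j) \<partial>pcm_experiment U n P) = 0"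
proof (rule order_antisym)
  show "0 \<le> (\<integral>\<omega>. H \<omega> * g (fst \<omega> j) \<partial>pcm_experiment U n P)"
    using zero by (intro integral_lift_nonneg[OF U j g H, where Q = "\<lambda>x. \<bar>x\<bar> \<le> B"] B inv) auto
  have "0 \<le> (\<integral>\<omega>. H \<omega> * (- g (fst \<omega> j)) \<partial>pcm_experiment U n P)"
    using zero g by (intro integral_lift_nonneg[OF U j _ H, where Q = "\<lambda>x. \<bar>x\<bar> \<le> B"] B inv) auto
  then show "(\<integral>\<omega>. H \<omega> * g (fst \<omega> j) \<partial>pcm_experiment U n P) \<le> 0" by simp
qed

lemma pcm_data_experiment:
  assumes U: "prob_space U" and methods: "measurable_methods U MX d n R"
  shows "pcm_data (pcm_experiment U n P) U MX d n R fst snd"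
proof
  show "measurable_methods U MX d n R" by fact
  show "(\<lambda>\<omega>. fst \<omega> i) \<in> pcm_experiment U n P \<rightarrow>\<^sub>M obs_space MX d" if "i \<in> I1 n \<union> I2 n" for i
    using observation_measurable[OF U that] by (simp add: measurable_cong_sets[OF refl sets_P])
  show "snd \<in> pcm_experiment U n P \<rightarrow>\<^sub>M U" unfolding pcm_experiment_def by measurable
qed

text \<open>The arrays are padded by 0 outside \<open>I1 n\<close>, because the measurability
  assumptions of \<open>conditional_array\<close> range over all indices while observations exist
  only for those of the sample.\<close>

lemma conditional_array_experiment:
  fixes U :: "'u measure"
  assumes U: "prob_space U" and methods: "measurable_methods U MX d n R"
  shows "conditional_array (pcm_experiment U n P) n erase_response
    (\<lambda>i \<omega>. if i \<in> I1 n then \<epsilon> (fst \<omega> i) else 0)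
    (\<lambda>i \<omega>. if i \<in> I1 n then pcm_upsilon R d n (fst \<omega>) (snd \<omega>) i else 0)
    (\<lambda>i \<omega>. if i \<in> I1 n then cvar (fst \<omega> i) else 0) c (1 + C) \<eta>"
proof -
  let ?E = "pcm_experiment U n P"
  interpret E: prob_space ?E by (rule prob_space_experiment[OF U])
  interpret D: pcm_data ?E U MX d n R fst snd by (rule pcm_data_experiment[OF U methods])
  have I: "{1..n} = I1 n" by (simp add: I1_def)
  have obs_meas: "(\<lambda>\<omega>. fst \<omega> i) \<in> ?E \<rightarrow>\<^sub>M P" if "i \<in> I1 n" for i
    by (rule observation_measurable[OF U]) (use that in auto)
  have obs_space: "fst \<omega> i \<in> space P" if "\<omega> \<in> space ?E" "i \<in> I1 n" for \<omega> i
    using measurable_space[OF obs_meas[OF that(2)] that(1)] .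
  have mem: "j \<in> I1 n \<union> I2 n" if "j \<in> I1 n" for j using that by auto
  show ?thesis
  proof (unfold_locales, unfold I)
    show "0 < c" "1 \<le> 1 + C" "0 < \<eta>" "\<eta> \<le> 1" using pos \<eta> by auto
    show "(\<lambda>\<omega>. if i \<in> I1 n then \<epsilon> (fst \<omega> i) else 0) \<in> borel_measurable ?E" for i
      using measurable_compose[OF obs_meas noise_measurable, of i] by (cases "i \<in> I1 n") auto
    show "(\<lambda>\<omega>. if i \<in> I1 n then pcm_upsilon R d n (fst \<omega>) (snd \<omega>) i else 0) \<in> borel_measurable ?E" for i
      using D.pcm_upsilon_meas[of i] by (cases "i \<in> I1 n") auto
    show "(\<lambda>\<omega>. if i \<in> I1 n then cvar (fst \<omega> i) else 0) \<in> borel_measurable ?E" for i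
      using measurable_compose[OF obs_meas cvar_P, of i] by (cases "i \<in> I1 n") auto
    show "c \<le> (if i \<in> I1 n then cvar (fst \<omega> i) else 0) \<and> (if i \<in> I1 n then cvar (fst \<omega> i) else 0) \<le> 1 + C"
      if "i \<in> I1 n" for i and \<omega> :: "(nat \<Rightarrow> 'x obs) \<times> 'u"
      using that cvar_bounds by simp
    show "(\<Sum>i\<in>I1 n. (if i \<in> I1 n then pcm_upsilon R d n (fst \<omega>) (snd \<omega>) i else 0)\<^sup>2) \<in> {0, 1}" for \<omega>
    proof -
      have "(\<Sum>i\<in>I1 n. (if i \<in> I1 n then pcm_upsilon R d n (fst \<omega>) (snd \<omega>) i else 0)\<^sup>2)
        = (\<Sum>i\<in>I1 n. (pcm_upsilon R d n (fst \<omega>) (snd \<omega>) i)\<^sup>2)" by (intro sum.cong) auto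
      then show ?thesis unfolding sum_pcm_upsilon_sq by simp
    qed
    show "integrable ?E (\<lambda>\<omega>. if i \<in> I1 n then \<epsilon> (fst \<omega> i) else 0)" if "i \<in> I1 n" for i
      using observation_integrable[OF U mem[OF that] noise_integrable] that by simp
    show "integrable ?E (\<lambda>\<omega>. (if i \<in> I1 n then \<epsilon> (fst \<omega> i) else 0)\<^sup>2)" if "i \<in> I1 n" for i
      using observation_integrable[OF U mem[OF that] noise_sq_integrable] that by simp
    show "integrable ?E (\<lambda>\<omega>. \<bar>if i \<in> I1 n then \<epsilon> (fst \<omega> i) else 0\<bar> powr (2 + \<eta>))" if "i \<in> I1 n" for i
      using observation_integrable[OF U mem[OF that] noise_powr_integrable] that by simp
    show "(if i \<in> I1 n then pcm_upsilon R d n (fst (erase_response j \<omega>)) (snd (erase_response j \<omega>)) i else 0)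
      = (if i \<in> I1 n then pcm_upsilon R d n (fst \<omega>) (snd \<omega>) i else 0)" if "i \<in> I1 n" "j \<in> I1 n" for i j \<omega>
      using pcm_upsilon_erase_response[OF that(2,1), of R d "fst \<omega>" "snd \<omega>"] by (simp add: erase_response_def case_prod_beta)
    show "(if i \<in> I1 n then cvar (fst (erase_response j \<omega>) i) else 0) = (if i \<in> I1 n then cvar (fst \<omega> i) else 0)"
      if "i \<in> I1 n" "j \<in> I1 n" "\<omega> \<in> space ?E" for i j \<omega>
      using cvar_erase_Y obs_space[OF that(3)] that by (simp add: erase_response_def case_prod_beta)
    show "(if i \<in> I1 n then \<epsilon> (fst (erase_response j \<omega>) i) else 0) = (if i \<in> I1 n then \<epsilon> (fst \<omega> i) else 0)"
      if "i \<noteq> j" for i j and \<omega> :: "(nat \<Rightarrow> 'x obs) \<times> 'u"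
      using that by (simp add: erase_response_def case_prod_beta)
  next
    fix j B and H :: "(nat \<Rightarrow> 'x obs) \<times> 'u \<Rightarrow> real"
    assume j: "j \<in> I1 n" and H: "H \<in> borel_measurable ?E" "\<And>\<omega>. \<omega> \<in> space ?E \<Longrightarrow> \<bar>H \<omega>\<bar> \<le> B"
      "\<And>\<omega>. \<omega> \<in> space ?E \<Longrightarrow> H (erase_response j \<omega>) = H \<omega>"
    have "(\<integral>\<omega>. H \<omega> * \<epsilon> (fst \<omega> j) \<partial>?E) = 0"
      by (rule integral_lift_zero[OF U mem[OF j] noise_integrable H]) (assumption | rule conditional_mean)+
    then show "(\<integral>\<omega>. H \<omega> * (if j \<in> I1 n then \<epsilon> (fst \<omega> j) else 0) \<partial>?E) = 0"
      using j by simp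
    have "\<bar>cvar w\<bar> \<le> 1 + C" for w using cvar_bounds[of w] pos by linarith
    then have cvar_int: "integrable P cvar"
      by (intro integrable_const_bound[where B = "1 + C"]) auto
    \<comment> \<open>Lifting works for a single function integrating to 0, so the variance identity
      is lifted as a difference. The moment bound is treated likewise below, as
      nonnegativity.\<close>
    have g: "integrable P (\<lambda>w. (\<epsilon> w)\<^sup>2 - cvar w)" using noise_sq_integrable cvar_int by simp
    have "(\<integral>\<omega>. H \<omega> * ((\<epsilon> (fst \<omega> j))\<^sup>2 - cvar (fst \<omega> j)) \<partial>?E) = 0"
    proof (rule integral_lift_zero[OF U mem[OF j] g H])
      fix h :: "'x obs \<Rightarrow> real"
      assume h: "h \<in> borel_measurable P" "\<And>w. w \<in> space P \<Longrightarrow> \<bar>h w\<bar> \<le> B" "\<And>w. w \<in> space P \<Longrightarrow> h (erase_Y w) = h w"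
      show "(\<integral>w. h w * ((\<epsilon> w)\<^sup>2 - cvar w) \<partial>P) = 0"
        using conditional_variance[OF h] integrable_mult_bounded[OF noise_sq_integrable h(1,2)]
          integrable_mult_bounded[OF cvar_int h(1,2)] by (simp add: right_diff_distrib)
    qed
    then show "(\<integral>\<omega>. H \<omega> * (if j \<in> I1 n then \<epsilon> (fst \<omega> j) else 0)\<^sup>2 \<partial>?E)
      = (\<integral>\<omega>. H \<omega> * (if j \<in> I1 n then cvar (fst \<omega> j) else 0) \<partial>?E)"
      using integrable_mult_bounded[OF observation_integrable[OF U mem[OF j] noise_sq_integrable] H(1,2)]
        integrable_mult_bounded[OF observation_integrable[OF U mem[OF j] cvar_int] H(1,2)] j
      by (simp add: right_diff_distrib)
  next
    fix j B and H :: "(nat \<Rightarrow> 'x obs) \<times> 'u \<Rightarrow> real"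
    assume j: "j \<in> I1 n" and H: "H \<in> borel_measurable ?E" "\<And>\<omega>. \<omega> \<in> space ?E \<Longrightarrow> 0 \<le> H \<omega> \<and> H \<omega> \<le> B"
      "\<And>\<omega>. \<omega> \<in> space ?E \<Longrightarrow> H (erase_response j \<omega>) = H \<omega>"
    have HB: "\<bar>H \<omega>\<bar> \<le> B" if "\<omega> \<in> space ?E" for \<omega> using H(2)[OF that] by auto
    have g: "integrable P (\<lambda>w. (1 + C) - \<bar>\<epsilon> w\<bar> powr (2 + \<eta>))" using noise_powr_integrable by simp
    have "0 \<le> (\<integral>\<omega>. H \<omega> * ((1 + C) - \<bar>\<epsilon> (fst \<omega> j)\<bar> powr (2 + \<eta>)) \<partial>?E)"
    proof (rule integral_lift_nonneg[OF U mem[OF j] g H(1), where Q = "\<lambda>x. 0 \<le> x \<and> x \<le> B"])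
      fix h :: "'x obs \<Rightarrow> real"
      assume h: "h \<in> borel_measurable P" "\<And>w. w \<in> space P \<Longrightarrow> 0 \<le> h w \<and> h w \<le> B" "\<And>w. w \<in> space P \<Longrightarrow> h (erase_Y w) = h w"
      have hB: "\<bar>h w\<bar> \<le> B" if "w \<in> space P" for w using h(2)[OF that] by auto
      have "integrable P (\<lambda>w. h w * (1 + C))" by (rule integrable_mult_bounded[OF _ h(1) hB]) simp
      then show "0 \<le> (\<integral>w. h w * ((1 + C) - \<bar>\<epsilon> w\<bar> powr (2 + \<eta>)) \<partial>P)"
        using conditional_moment[OF h] integrable_mult_bounded[OF noise_powr_integrable h(1) hB]
        unfolding right_diff_distrib[of "h _"] by (subst Bochner_Integration.integral_diff) auto
    qed (use H in auto)
    moreover have "(\<integral>\<omega>. H \<omega> * ((1 + C) - \<bar>\<epsilon> (fst \<omega> j)\<bar> powr (2 + \<eta>)) \<partial>?E)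
      = (1 + C) * (\<integral>\<omega>. H \<omega> \<partial>?E) - (\<integral>\<omega>. H \<omega> * \<bar>\<epsilon> (fst \<omega> j)\<bar> powr (2 + \<eta>) \<partial>?E)"
    proof -
      have "integrable ?E (\<lambda>\<omega>. H \<omega> * (1 + C))" by (rule integrable_mult_bounded[OF _ H(1) HB]) simp
      then show ?thesis
        using integrable_mult_bounded[OF observation_integrable[OF U mem[OF j] noise_powr_integrable] H(1) HB]
        unfolding right_diff_distrib[of "H _"] by (subst Bochner_Integration.integral_diff) (auto simp: mult.commute)
    qed
    ultimately show "(\<integral>\<omega>. H \<omega> * \<bar>if j \<in> I1 n then \<epsilon> (fst \<omega> j) else 0\<bar> powr (2 + \<eta>) \<partial>?E) \<le> (1 + C) * (\<integral>\<omega>. H \<omega> \<partial>?E)"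
      using j by simp
  qed
qed

end

section \<open>The projected covariance measure\<close>

text \<open>The residuals are \<open>r\<close> times the weights, and r > 0 cancels in the quotient;
  \<open>one\<close> rules out the case in which all residuals vanish.\<close>

lemma pcm_T_eq:
  fixes R :: "('u, 'x) pcm_methods" and D :: "nat \<Rightarrow> 'x obs" and d n :: nat and u :: 'u and \<gamma> :: rvec
  defines "w \<equiv> pcm_upsilon R d n D u"
    and "e \<equiv> \<lambda>i. noise d \<gamma> (D i)"
    and "\<Delta> \<equiv> \<lambda>i. dotp d (\<lambda>j. gammahat d n D j - \<gamma> j) (obsZ (D i))"
  assumes n: "1 \<le> n" and ols: "ols_exists d (I1 n) (D1_fZ R n D u)"
    and one: "(\<Sum>i\<in>I1 n. (w i)\<^sup>2) = 1"
  shows "pcm_T R d n D u = (\<Sum>i\<in>I1 n. w i * e i)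
    / sqrt ((\<Sum>i\<in>I1 n. ((e i - \<Delta> i) * w i)\<^sup>2) - (\<Sum>i\<in>I1 n. w i * e i)\<^sup>2 / n)"
proof -
  define q where "q = (\<Sum>k\<in>I1 n. (pcm_u R d n D u k)\<^sup>2)"
  define r where "r = sqrt q"
  have q: "0 < q"
  proof -
    have "q \<noteq> 0" using one sum_pcm_upsilon_sq[of R d n D u] by (auto simp: w_def q_def)
    moreover have "0 \<le> q" unfolding q_def by (rule sum_nonneg) simp
    ultimately show ?thesis by simp
  qed
  have r: "0 < r" "r\<^sup>2 = q" using q by (auto simp: r_def)
  have u_eq: "pcm_u R d n D u i = r * w i" for i
    unfolding w_def pcm_upsilon_def q_def[symmetric] r_def[symmetric] using r by simp
  have orth: "(\<Sum>i\<in>I1 n. w i * obsZ (D i) j) = 0" if j: "j < d" for j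
  proof -
    have "0 = (\<Sum>i\<in>I1 n. (fst (D1_fZ R n D u i) - dotp d (ols_coef d (I1 n) (D1_fZ R n D u)) (snd (D1_fZ R n D u i)))
        * snd (D1_fZ R n D u i) j)"
      by (rule ols_solution_normal_equations[OF _ j ols_coef_solution[OF ols], symmetric]) (simp add: I1_def)
    also have "\<dots> = (\<Sum>i\<in>I1 n. r * (w i * obsZ (D i) j))"
      by (intro sum.cong) (auto simp: D1_fZ_def pcm_u_def mfhat_ols_def mult.assoc simp flip: u_eq)
    also have "\<dots> = r * (\<Sum>i\<in>I1 n. w i * obsZ (D i) j)" by (simp add: sum_distrib_left)
    finally show ?thesis using r by simp
  qed
  have L: "pcm_L R d n D u i = r * ((e i - \<Delta> i) * w i)" for i
  proof -
    have "pcm_L R d n D u i = (obsY (D i) - mhat_ols d n D (obsZ (D i))) * pcm_u R d n D u i"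
      by (simp add: pcm_L_def pcm_u_def)
    also have "obsY (D i) - mhat_ols d n D (obsZ (D i)) = e i - \<Delta> i"
      by (simp add: e_def \<Delta>_def noise_def mhat_ols_def dotp_diff)
    finally show ?thesis by (simp add: u_eq)
  qed
  define A where "A = (\<Sum>i\<in>I1 n. w i * e i)"
  define V where "V = (\<Sum>i\<in>I1 n. ((e i - \<Delta> i) * w i)\<^sup>2)"
  have "(\<Sum>i\<in>I1 n. w i * \<Delta> i) = (\<Sum>j<d. (gammahat d n D j - \<gamma> j) * (\<Sum>i\<in>I1 n. w i * obsZ (D i) j))"
    unfolding \<Delta>_def dotp_def sum_distrib_left by (subst sum.swap) (intro sum.cong, auto)
  then have w\<Delta>: "(\<Sum>i\<in>I1 n. w i * \<Delta> i) = 0" using orth by simp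
  have sumL: "(\<Sum>i\<in>I1 n. pcm_L R d n D u i) = r * A"
  proof -
    have "(\<Sum>i\<in>I1 n. pcm_L R d n D u i) = r * (\<Sum>i\<in>I1 n. w i * e i - w i * \<Delta> i)"
      unfolding L sum_distrib_left[symmetric] by (simp add: algebra_simps)
    then show ?thesis using w\<Delta> by (simp add: sum_subtractf A_def)
  qed
  have sumL2: "(\<Sum>i\<in>I1 n. (pcm_L R d n D u i)\<^sup>2) = q * V"
    unfolding L V_def power_mult_distrib[of r] r(2) by (simp add: sum_distrib_left)
  have "(1 / n) * (q * V) - ((1 / n) * (r * A))\<^sup>2 = (r\<^sup>2 / n) * (V - A\<^sup>2 / n)"
    unfolding r(2)[symmetric] using n by (simp add: field_simps power2_eq_square)
  then have "sqrt ((1 / n) * (q * V) - ((1 / n) * (r * A))\<^sup>2) = r / sqrt n * sqrt (V - A\<^sup>2 / n)"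
    using r(1) by (simp add: real_sqrt_mult real_sqrt_divide)
  then have "pcm_T R d n D u = ((1 / sqrt n) * (r * A)) / (r / sqrt n * sqrt (V - A\<^sup>2 / n))"
    unfolding pcm_T_def sumL sumL2 by simp
  also have "\<dots> = A / sqrt (V - A\<^sup>2 / n)" using r(1) n by simp
  finally show ?thesis by (simp add: A_def V_def)
qed

text \<open>Hoelder's inequality for the pair of norms in (c).\<close>

lemma abs_dotp_le:
  assumes "1 \<le> d"
  shows "\<bar>dotp d a z\<bar> \<le> norm_inf d z * norm_1 d a"
proof -
  have "\<bar>dotp d a z\<bar> \<le> (\<Sum>j<d. \<bar>a j\<bar> * \<bar>z j\<bar>)"
    unfolding dotp_def by (rule order_trans[OF sum_abs]) (simp add: abs_mult)
  also have "\<dots> \<le> (\<Sum>j<d. \<bar>a j\<bar> * norm_inf d z)"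
    unfolding norm_inf_def by (intro sum_mono mult_left_mono Max_ge) auto
  finally show ?thesis by (simp add: norm_1_def sum_distrib_left mult.commute)
qed

text \<open>The supremum dominates the member chosen at each index, so the uniform notion controls
  any sequence of distributions drawn from the families.\<close>

lemma uniform_oP_subsequence:
  assumes "uniform_oP \<P> M V" "strict_mono r" "\<And>k. P k \<in> \<P> (r k)" "\<And>k. finite_measure (M (r k) (P k))" "0 < e"
  shows "(\<lambda>k. measure (M (r k) (P k)) {\<omega> \<in> space (M (r k) (P k)). \<bar>V (r k) (P k) \<omega>\<bar> > e}) \<longlonglongrightarrow> 0"
proof -
  let ?S = "\<lambda>n P. {\<omega> \<in> space (M n P). \<bar>V n P \<omega>\<bar> > e}"
  have "(\<lambda>n. SUP P\<in>\<P> n. emeasure (M n P) (?S n P)) \<longlonglongrightarrow> 0"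
    using assms(1,5) by (auto simp: uniform_oP_def)
  then have "(\<lambda>k. SUP P\<in>\<P> (r k). emeasure (M (r k) P) (?S (r k) P)) \<longlonglongrightarrow> 0"
    using LIMSEQ_subseq_LIMSEQ[OF _ assms(2)] by (fastforce simp: comp_def)
  then have "(\<lambda>k. emeasure (M (r k) (P k)) (?S (r k) (P k))) \<longlonglongrightarrow> 0"
    by (rule tendsto_sandwich[OF _ _ tendsto_const, rotated 2]) (auto intro!: always_eventually SUP_upper assms(3))
  then have "(\<lambda>k. ennreal (measure (M (r k) (P k)) (?S (r k) (P k)))) \<longlonglongrightarrow> ennreal 0"
    using finite_measure.emeasure_eq_measure[OF assms(4)] by simp
  then show ?thesis by (subst (asm) tendsto_ennreal_iff) auto
qed

theorem proposition2:
  fixes MX :: "nat \<Rightarrow> 'x measure"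
    and U :: "nat \<Rightarrow> 'u measure"
    and d :: "nat \<Rightarrow> nat"
    and \<P>\<^sub>0 :: "nat \<Rightarrow> 'x obs measure set"
    and \<gamma> :: "nat \<Rightarrow> 'x obs measure \<Rightarrow> rvec"
    and R :: "nat \<Rightarrow> ('u, 'x) pcm_methods"
    and \<delta> c C :: real
  assumes dim: "\<And>n. d n \<ge> 1"
    and distributions:
      "\<And>n P. P \<in> \<P>\<^sub>0 n \<Longrightarrow> prob_space P \<and> sets P = sets (obs_space (MX n) (d n))"
    and model: "\<And>n P. P \<in> \<P>\<^sub>0 n \<Longrightarrow> linear_model (MX n) (d n) P (\<gamma> n P)"
    and seed: "\<And>n. prob_space (U n)"
    and methods: "\<And>n. measurable_methods (U n) (MX n) (d n) n (R n)"
    and a: "0 < \<delta>" "\<delta> \<le> 2" "0 < c" "0 < C"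
      "\<And>n P. P \<in> \<P>\<^sub>0 n \<Longrightarrow> noise_moments (MX n) (d n) P (\<gamma> n P) \<delta> c C"
    and b_max: "uniform_oP \<P>\<^sub>0 (\<lambda>n. pcm_experiment (U n) n)
      (\<lambda>n P (D, u). Max ((\<lambda>i. \<bar>pcm_upsilon (R n) (d n) n D u i\<bar>) ` I1 n))"
    and b_sum: "uniform_oP \<P>\<^sub>0 (\<lambda>n. pcm_experiment (U n) n)
      (\<lambda>n P (D, u). (\<Sum>i\<in>I1 n. (pcm_upsilon (R n) (d n) n D u i)\<^sup>2) - 1)"
    and c: "uniform_oP \<P>\<^sub>0 (\<lambda>n. pcm_experiment (U n) n)
      (\<lambda>n P (D, u). Max ((\<lambda>i. norm_inf (d n) (obsZ (D i))) ` I1 n)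
                      * norm_1 (d n) (\<lambda>j. gammahat (d n) n D j - \<gamma> n P j))"
    and ols: "\<forall>\<^sub>F n in sequentially. \<forall>P\<in>\<P>\<^sub>0 n. AE (D, u) in pcm_experiment (U n) n P.
      ols_exists (d n) (I1 n) (D1_YZ n D) \<and> ols_exists (d n) (I1 n) (D1_fZ (R n) n D u)"
  shows "(\<lambda>n. SUP P\<in>\<P>\<^sub>0 n. SUP t. ennreal
            \<bar>measure (pcm_experiment (U n) n P)
               {(D, u) \<in> space (pcm_experiment (U n) n P). pcm_T (R n) (d n) n D u \<le> t}
             - cdf std_normal_distribution t\<bar>) \<longlonglongrightarrow> 0"
proof -
  let ?\<Phi> = "cdf std_normal_distribution"
  define E where "E n P = pcm_experiment (U n) n P" for n and P :: "'x obs measure"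
  define F where "F n P t = measure (E n P) {\<omega> \<in> space (E n P). pcm_T (R n) (d n) n (fst \<omega>) (snd \<omega>) \<le> t}" for n P t
  have E_eq: "(\<lambda>n. pcm_experiment (U n) n) = E" by (intro ext) (simp add: E_def)
  have rm: "regression_model P (MX n) (d n) (\<gamma> n P) \<delta> c C" if "P \<in> \<P>\<^sub>0 n" for n P
    using distributions[OF that] model[OF that] a that
    by (auto simp: regression_model_def regression_model_axioms_def)
  have prob_E: "prob_space (E n P)" if "P \<in> \<P>\<^sub>0 n" for n P
    unfolding E_def by (rule regression_model.prob_space_experiment[OF rm[OF that] seed])
  have data: "pcm_data (E n P) (U n) (MX n) (d n) n (R n) fst snd" if "P \<in> \<P>\<^sub>0 n" for n P
    unfolding E_def by (rule regression_model.pcm_data_experiment[OF rm[OF that] seed methods])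
  \<comment> \<open>If this fails, there are infinitely many sample sizes with a bad distribution
    each; along them the limit theorem for a single sequence gives the contradiction.\<close>
  have pointwise: "\<forall>\<^sub>F n in sequentially. \<forall>P\<in>\<P>\<^sub>0 n. \<bar>F n P t - ?\<Phi> t\<bar> \<le> \<epsilon>" if \<epsilon>: "0 < \<epsilon>" for t \<epsilon>
  proof (rule ccontr)
    \<comment> \<open>Least squares solutions exist only from some sample size on, and sample size 0
      has no indices. Building this into the negated statement before extracting the subsequence
      makes it hold at every one of its members.\<close>
    define ok where "ok n \<longleftrightarrow> 1 \<le> n \<and> (\<forall>P\<in>\<P>\<^sub>0 n. AE \<omega> in E n P. ols_exists (d n) (I1 n) (D1_fZ (R n) n (fst \<omega>) (snd \<omega>)))" for n
    have ok: "eventually ok sequentially"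
      using ols eventually_ge_at_top[of 1]
    proof eventually_elim
      case (elim n)
      have "AE \<omega> in E n P. ols_exists (d n) (I1 n) (D1_fZ (R n) n (fst \<omega>) (snd \<omega>))" if "P \<in> \<P>\<^sub>0 n" for P
      proof -
        have "AE (D, u) in E n P. ols_exists (d n) (I1 n) (D1_YZ n D) \<and> ols_exists (d n) (I1 n) (D1_fZ (R n) n D u)"
          unfolding E_def using elim(1) that by blast
        then show ?thesis by eventually_elim auto
      qed
      then show ?case using elim(2) by (simp add: ok_def)
    qed
    assume "\<not> (\<forall>\<^sub>F n in sequentially. \<forall>P\<in>\<P>\<^sub>0 n. \<bar>F n P t - ?\<Phi> t\<bar> \<le> \<epsilon>)"
    then have "\<not> (\<forall>\<^sub>F n in sequentially. ok n \<longrightarrow> (\<forall>P\<in>\<P>\<^sub>0 n. \<bar>F n P t - ?\<Phi> t\<bar> \<le> \<epsilon>))"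
      by (rule contrapos_nn) (rule eventually_mp[OF _ ok])
    then obtain r :: "nat \<Rightarrow> nat" where r: "strict_mono r"
      and bad: "\<And>k. \<not> (ok (r k) \<longrightarrow> (\<forall>P\<in>\<P>\<^sub>0 (r k). \<bar>F (r k) P t - ?\<Phi> t\<bar> \<le> \<epsilon>))"
      using not_eventually_sequentiallyD by blast
    then have okr: "ok (r k)" and "\<exists>P\<in>\<P>\<^sub>0 (r k). \<not> \<bar>F (r k) P t - ?\<Phi> t\<bar> \<le> \<epsilon>" for k by blast+
    then obtain P where P: "\<And>k. P k \<in> \<P>\<^sub>0 (r k)" and far: "\<And>k. \<not> \<bar>F (r k) (P k) t - ?\<Phi> t\<bar> \<le> \<epsilon>" by metis
    have rk: "1 \<le> r k" for k using okr by (simp add: ok_def)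
    let ?M = "\<lambda>k. E (r k) (P k)"
    have fin: "finite_measure (?M k)" for k
      using prob_E[OF P[of k]] by (rule prob_space.finite_measure)
    note subseq = uniform_oP_subsequence[where M = E, OF _ r P fin]
    define e where "e k i \<omega> = (if i \<in> I1 (r k) then noise (d (r k)) (\<gamma> (r k) (P k)) (fst \<omega> i) else 0)" for k i and \<omega> :: "(nat \<Rightarrow> 'x obs) \<times> 'u"
    define w where "w k i \<omega> = (if i \<in> I1 (r k) then pcm_upsilon (R (r k)) (d (r k)) (r k) (fst \<omega>) (snd \<omega>) i else 0)" for k i \<omega>
    define v where "v k i \<omega> = (if i \<in> I1 (r k) then regression_model.cvar (P k) (MX (r k)) (d (r k)) (\<gamma> (r k) (P k)) c C (fst \<omega> i) else 0)" for k i and \<omega> :: "(nat \<Rightarrow> 'x obs) \<times> 'u"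
    define X where "X k \<omega> = Max ((\<lambda>i. norm_inf (d (r k)) (obsZ (fst \<omega> i))) ` I1 (r k))
      * norm_1 (d (r k)) (\<lambda>j. gammahat (d (r k)) (r k) (fst \<omega>) j - \<gamma> (r k) (P k) j)" for k and \<omega> :: "(nat \<Rightarrow> 'x obs) \<times> 'u"
    define \<Delta> where "\<Delta> k i \<omega> = dotp (d (r k)) (\<lambda>j. gammahat (d (r k)) (r k) (fst \<omega>) j - \<gamma> (r k) (P k) j) (obsZ (fst \<omega> i))" for k i and \<omega> :: "(nat \<Rightarrow> 'x obs) \<times> 'u"
    define T where "T k \<omega> = pcm_T (R (r k)) (d (r k)) (r k) (fst \<omega>) (snd \<omega>)" for k \<omega>
    have I: "{1..r k} = I1 (r k)" for k by (simp add: I1_def)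
    have wsum: "(\<Sum>i=1..r k. (w k i \<omega>)\<^sup>2) = (\<Sum>i\<in>I1 (r k). (pcm_upsilon (R (r k)) (d (r k)) (r k) (fst \<omega>) (snd \<omega>) i)\<^sup>2)" for k \<omega>
      unfolding I by (intro sum.cong) (auto simp: w_def)
    have "(\<lambda>k. measure (?M k) {\<omega> \<in> space (?M k). T k \<omega> \<le> t}) \<longlonglongrightarrow> ?\<Phi> t"
    proof (rule studentised_sum_cdf_tendsto[where N = r and \<zeta> = "\<lambda>_. erase_response" and e = e and w = w and v = v
          and c = c and K = "1 + C" and \<eta> = "regression_model.\<eta> \<delta>" and D = "\<lambda>k \<omega>. \<bar>X k \<omega>\<bar>" and \<Delta> = \<Delta>])
      show "conditional_array (?M k) (r k) erase_response (e k) (w k) (v k) c (1 + C) (regression_model.\<eta> \<delta>)" for k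
        unfolding E_def e_def[abs_def] w_def[abs_def] v_def[abs_def]
        by (rule regression_model.conditional_array_experiment[OF rm[OF P] seed methods])
      show "1 \<le> r k" for k by (rule rk)
      show "filterlim r at_top sequentially" by (rule filterlim_subseq[OF r])
      fix \<rho> :: real assume \<rho>: "0 < \<rho>"
      \<comment> \<open>The outer absolute value in \<open>uniform_oP\<close> is harmless: with at
        least one index, a maximum of absolute values is nonnegative.\<close>
      have "{\<omega> \<in> space (?M k). Max ((\<lambda>i. \<bar>w k i \<omega>\<bar>) ` {1..r k}) > \<rho>}
        = {\<omega> \<in> space (?M k). \<bar>case \<omega> of (D, u) \<Rightarrow> Max ((\<lambda>i. \<bar>pcm_upsilon (R (r k)) (d (r k)) (r k) D u i\<bar>) ` I1 (r k))\<bar> > \<rho>}" for k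
      proof -
        have "(\<lambda>i. \<bar>w k i \<omega>\<bar>) ` {1..r k} = (\<lambda>i. \<bar>pcm_upsilon (R (r k)) (d (r k)) (r k) (fst \<omega>) (snd \<omega>) i\<bar>) ` I1 (r k)" for \<omega>
          unfolding I by (intro image_cong) (auto simp: w_def)
        moreover have "\<bar>Max ((\<lambda>i. \<bar>g i\<bar>) ` I1 (r k))\<bar> = Max ((\<lambda>i. \<bar>g i\<bar>) ` I1 (r k))" for g :: "nat \<Rightarrow> real"
        proof -
          have "1 \<in> I1 (r k)" using rk by (simp add: I1_def)
          then have "\<bar>g 1\<bar> \<le> Max ((\<lambda>i. \<bar>g i\<bar>) ` I1 (r k))" by (intro Max_ge) (auto simp: I1_def)
          then show ?thesis by linarith
        qed
        ultimately show ?thesis by (simp add: case_prod_beta)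
      qed
      then show "(\<lambda>k. measure (?M k) {\<omega> \<in> space (?M k). Max ((\<lambda>i. \<bar>w k i \<omega>\<bar>) ` {1..r k}) > \<rho>}) \<longlonglongrightarrow> 0"
        using subseq[OF b_max[unfolded E_eq] \<rho>] by simp
      have "{\<omega> \<in> space (?M k). \<bar>X k \<omega>\<bar> > \<rho>}
        = {\<omega> \<in> space (?M k). \<bar>case \<omega> of (D, u) \<Rightarrow> Max ((\<lambda>i. norm_inf (d (r k)) (obsZ (D i))) ` I1 (r k))
                      * norm_1 (d (r k)) (\<lambda>j. gammahat (d (r k)) (r k) D j - \<gamma> (r k) (P k) j)\<bar> > \<rho>}" for k
        by (auto simp: X_def case_prod_beta)
      then show "(\<lambda>k. measure (?M k) {\<omega> \<in> space (?M k). \<bar>X k \<omega>\<bar> > \<rho>}) \<longlonglongrightarrow> 0"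
        using subseq[OF c[unfolded E_eq] \<rho>] by simp
    next
      \<comment> \<open>The sum is 0 or 1, so being more than 1/2 away from 1 means being 0.\<close>
      have "{\<omega> \<in> space (?M k). (\<Sum>i=1..r k. (w k i \<omega>)\<^sup>2) = 0}
        = {\<omega> \<in> space (?M k). \<bar>case \<omega> of (D, u) \<Rightarrow> (\<Sum>i\<in>I1 (r k). (pcm_upsilon (R (r k)) (d (r k)) (r k) D u i)\<^sup>2) - 1\<bar> > 1 / 2}" for k
        unfolding wsum sum_pcm_upsilon_sq by (auto simp: case_prod_beta)
      then show "(\<lambda>k. measure (?M k) {\<omega> \<in> space (?M k). (\<Sum>i=1..r k. (w k i \<omega>)\<^sup>2) = 0}) \<longlonglongrightarrow> 0"
        using subseq[OF b_sum[unfolded E_eq], of "1 / 2"] by simp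
      show "(\<lambda>\<omega>. \<bar>X k \<omega>\<bar>) \<in> borel_measurable (?M k)" for k
        unfolding X_def by (rule borel_measurable_abs[OF pcm_data.coef_error_meas[OF data[OF P]]])
      show "T k \<in> borel_measurable (?M k)" for k
        unfolding T_def[abs_def] by (rule pcm_data.pcm_T_meas[OF data[OF P]])
      show "\<bar>\<Delta> k i \<omega>\<bar> \<le> \<bar>X k \<omega>\<bar>" if "i \<in> {1..r k}" for k i \<omega>
      proof -
        have "\<bar>\<Delta> k i \<omega>\<bar> \<le> norm_inf (d (r k)) (obsZ (fst \<omega> i)) * norm_1 (d (r k)) (\<lambda>j. gammahat (d (r k)) (r k) (fst \<omega>) j - \<gamma> (r k) (P k) j)"
          unfolding \<Delta>_def by (rule abs_dotp_le[OF dim])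
        also have "\<dots> \<le> X k \<omega>" unfolding X_def using that
          by (intro mult_right_mono Max_ge) (auto simp: I1_def norm_1_def intro!: sum_nonneg)
        finally show ?thesis by simp
      qed
      show "AE \<omega> in ?M k. (\<Sum>i=1..r k. (w k i \<omega>)\<^sup>2) = 1 \<longrightarrow>
        T k \<omega> = (\<Sum>i=1..r k. w k i \<omega> * e k i \<omega>)
          / sqrt ((\<Sum>i=1..r k. ((e k i \<omega> - \<Delta> k i \<omega>) * w k i \<omega>)\<^sup>2) - (\<Sum>i=1..r k. w k i \<omega> * e k i \<omega>)\<^sup>2 / real (r k))" for k
      proof -
        have "AE \<omega> in ?M k. ols_exists (d (r k)) (I1 (r k)) (D1_fZ (R (r k)) (r k) (fst \<omega>) (snd \<omega>))"
          using okr[of k] P[of k] by (simp add: ok_def)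
        then show ?thesis
        proof eventually_elim
          case (elim \<omega>)
          have 1: "(\<Sum>i=1..r k. w k i \<omega> * e k i \<omega>)
            = (\<Sum>i\<in>I1 (r k). pcm_upsilon (R (r k)) (d (r k)) (r k) (fst \<omega>) (snd \<omega>) i * noise (d (r k)) (\<gamma> (r k) (P k)) (fst \<omega> i))"
            unfolding I by (intro sum.cong) (auto simp: w_def e_def)
          have 2: "(\<Sum>i=1..r k. ((e k i \<omega> - \<Delta> k i \<omega>) * w k i \<omega>)\<^sup>2)
            = (\<Sum>i\<in>I1 (r k). ((noise (d (r k)) (\<gamma> (r k) (P k)) (fst \<omega> i) - \<Delta> k i \<omega>) * pcm_upsilon (R (r k)) (d (r k)) (r k) (fst \<omega>) (snd \<omega>) i)\<^sup>2)"
            unfolding I by (intro sum.cong) (auto simp: w_def e_def)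
          show ?case unfolding 1 2 wsum unfolding T_def \<Delta>_def
            by (intro impI pcm_T_eq[OF rk elim])
        qed
      qed
    qed
    then have "\<forall>\<^sub>F k in sequentially. dist (F (r k) (P k) t) (?\<Phi> t) < \<epsilon>"
      unfolding F_def T_def by (rule tendstoD) (rule \<epsilon>)
    then obtain k where "dist (F (r k) (P k) t) (?\<Phi> t) < \<epsilon>" by (auto simp: eventually_sequentially)
    then show False using far[of k] by (simp add: dist_real_def)
  qed
  \<comment> \<open>The grid is finite and depends only on \<epsilon>, so the eventual statements at
    its points hold simultaneously and for all distributions.\<close>
  have uniform: "\<forall>\<^sub>F n in sequentially. \<forall>P\<in>\<P>\<^sub>0 n. \<forall>t. \<bar>F n P t - ?\<Phi> t\<bar> \<le> 2 * \<epsilon>" if \<epsilon>: "0 < \<epsilon>" for \<epsilon>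
  proof -
    obtain G where G: "finite G" "\<And>F t. mono F \<Longrightarrow> (\<And>x. 0 \<le> F x) \<Longrightarrow> (\<And>x. F x \<le> 1) \<Longrightarrow>
      (\<And>x. x \<in> G \<Longrightarrow> \<bar>F x - ?\<Phi> x\<bar> \<le> \<epsilon>) \<Longrightarrow> \<bar>F t - ?\<Phi> t\<bar> \<le> 2 * \<epsilon>"
      using cdf_close_from_grid[OF \<epsilon>] by metis
    have "\<forall>\<^sub>F n in sequentially. \<forall>x\<in>G. \<forall>P\<in>\<P>\<^sub>0 n. \<bar>F n P x - ?\<Phi> x\<bar> \<le> \<epsilon>"
      using pointwise[OF \<epsilon>] by (intro eventually_ball_finite[OF G(1)]) auto
    then show ?thesis
    proof eventually_elim
      case (elim n)
      show ?case
      proof (intro ballI allI)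
        fix P t assume P: "P \<in> \<P>\<^sub>0 n"
        interpret EP: prob_space "E n P" by (rule prob_E[OF P])
        have [measurable]: "(\<lambda>\<omega>. pcm_T (R n) (d n) n (fst \<omega>) (snd \<omega>)) \<in> borel_measurable (E n P)"
          by (rule pcm_data.pcm_T_meas[OF data[OF P]])
        show "\<bar>F n P t - ?\<Phi> t\<bar> \<le> 2 * \<epsilon>"
        proof (rule G(2))
          show "mono (F n P)" unfolding F_def
            by (intro monoI EP.finite_measure_mono) auto
          show "0 \<le> F n P x" "F n P x \<le> 1" for x by (simp_all add: F_def)
          show "\<bar>F n P x - ?\<Phi> x\<bar> \<le> \<epsilon>" if "x \<in> G" for x using elim P that by blast
        qed
      qed
    qed
  qed
  have F_eq: "measure (pcm_experiment (U n) n P)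
       {(D, u) \<in> space (pcm_experiment (U n) n P). pcm_T (R n) (d n) n D u \<le> t} = F n P t" for n P t
    unfolding F_def E_def by (rule arg_cong[where f = "measure _"]) auto
  show ?thesis unfolding F_eq
  proof (rule order_tendstoI)
    fix b :: ennreal assume b: "0 < b"
    \<comment> \<open>A finite value strictly between 0 and b: the supremum is bounded only weakly
      by it, and b itself may be infinite.\<close>
    then obtain b' where b': "0 < b'" "b' < b" using dense by blast
    have "b' \<noteq> \<infinity>" using b'(2) by auto
    then obtain x where x: "b' = ennreal x" "0 < x" using b'(1) by (cases b') auto
    have "\<forall>\<^sub>F n in sequentially. \<forall>P\<in>\<P>\<^sub>0 n. \<forall>t. \<bar>F n P t - ?\<Phi> t\<bar> \<le> 2 * (x / 2)"
      by (rule uniform) (use x in simp)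
    then show "\<forall>\<^sub>F n in sequentially. (SUP P\<in>\<P>\<^sub>0 n. SUP t. ennreal \<bar>F n P t - ?\<Phi> t\<bar>) < b"
    proof eventually_elim
      case (elim n)
      have "(SUP P\<in>\<P>\<^sub>0 n. SUP t. ennreal \<bar>F n P t - ?\<Phi> t\<bar>) \<le> ennreal x"
        using elim by (intro SUP_least ennreal_leI) auto
      then show ?case using b' x by simp
    qed
  qed simp
qed

end
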